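(* For every $\varepsilon>0$, there is a $(1+\varepsilon)$-approximate Turing kernelization for \textsc{Connected Dominating Set} parameterized by $\mathrm{tw}+\Delta$ whose oracle queries are graphs with $\mathcal{O}(\frac{1+\varepsilon}{\varepsilon}\cdot\mathrm{tw}\cdot\Delta)$ vertices.
   Context: \textsc{Connected Dominating Set}: given a graph $G=(V,E)$, find a minimum-size set $X\subseteq V$ with $N[X]=V$ and $G[X]$ connected. $\mathrm{tw}$ is the treewidth and $\Delta$ the maximum degree of the input graph. The algorithm receives the graph together with a nice tree decomposition of width $\mathrm{tw}(G)$ (rooted, root and leaf bags empty, every other node a forget, introduce, or join node). A $(1+\varepsilon)$-approximate Turing kernelization is a polynomial-time algorithm that, with access to an oracle returning in a single step a $c$-approximate solution for any instance of bounded size (here: with the stated number of vertices), outputs a $c(1+\varepsilon)$-approximate solution for the input, without knowing or depending on $c$. *)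

theory Defs
  imports Complex_Main "HOL-Computational_Algebra.Polynomial"
begin

section \<open>Graphs\<close>

type_synonym 'a graph = "'a set \<times> 'a set set"

abbreviation verts :: "'a graph \<Rightarrow> 'a set" where "verts \<equiv> fst"
abbreviation edges :: "'a graph \<Rightarrow> 'a set set" where "edges \<equiv> snd"

definition simple_graph :: "'a graph \<Rightarrow> bool" where
  "simple_graph G \<longleftrightarrow> finite (verts G) \<and> (\<forall>e\<in>edges G. e \<subseteq> verts G \<and> card e = 2)"

definition adj :: "'a graph \<Rightarrow> 'a \<Rightarrow> 'a \<Rightarrow> bool" where
  "adj G u v \<longleftrightarrow> {u, v} \<in> edges G"

definition induced :: "'a graph \<Rightarrow> 'a set \<Rightarrow> 'a graph" where
  "induced G X = (X, {e \<in> edges G. e \<subseteq> X})"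

text \<open>The graph without vertices counts as connected.\<close>

definition connected_graph :: "'a graph \<Rightarrow> bool" where
  "connected_graph G \<longleftrightarrow> (\<forall>u\<in>verts G. \<forall>v\<in>verts G. (adj G)\<^sup>*\<^sup>* u v)"

definition is_cycle :: "'a graph \<Rightarrow> 'a list \<Rightarrow> bool" where
  "is_cycle G p \<longleftrightarrow> 3 \<le> length p \<and> distinct p \<and>
     (\<forall>i<length p. adj G (p ! i) (p ! (Suc i mod length p)))"

definition is_tree :: "'a graph \<Rightarrow> bool" where
  "is_tree G \<longleftrightarrow> simple_graph G \<and> verts G \<noteq> {} \<and> connected_graph G \<and> (\<nexists>p. is_cycle G p)"

definition degree_of :: "'a graph \<Rightarrow> 'a \<Rightarrow> nat" where
  "degree_of G v = card {u \<in> verts G. adj G v u}"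

definition max_degree :: "'a graph \<Rightarrow> nat" where
  "max_degree G = Max (insert 0 (degree_of G ` verts G))"


section \<open>Tree decompositions and treewidth\<close>

definition tree_decomposition :: "'a graph \<Rightarrow> 'n graph \<Rightarrow> ('n \<Rightarrow> 'a set) \<Rightarrow> bool" where
  "tree_decomposition G T \<beta> \<longleftrightarrow>
     is_tree T \<and>
     (\<Union>t\<in>verts T. \<beta> t) = verts G \<and>
     (\<forall>e\<in>edges G. \<exists>t\<in>verts T. e \<subseteq> \<beta> t) \<and>
     (\<forall>v\<in>verts G. connected_graph (induced T {t \<in> verts T. v \<in> \<beta> t}))"

text \<open>Truncated subtraction only matters for the graph without vertices, whose width is 0 here
  (instead of -1).\<close>

definition td_width :: "'n graph \<Rightarrow> ('n \<Rightarrow> 'a set) \<Rightarrow> nat" where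
  "td_width T \<beta> = Max ((\<lambda>t. card (\<beta> t)) ` verts T) - 1"

text \<open>Every finite tree has an isomorphic copy on natural numbers.\<close>

definition treewidth :: "'a graph \<Rightarrow> nat" where
  "treewidth G =
     (LEAST w. \<exists>(T :: nat graph) \<beta>. tree_decomposition G T \<beta> \<and> td_width T \<beta> = w)"

text \<open>A nice tree decomposition is given by its rooted tree with typed nodes; the bags are
  determined by the node types. The nodes are addressed by their paths from the root; the child of
  an introduce or forget node is in position \<open>False\<close>.\<close>

datatype 'a ntd = Leaf | Introduce 'a "'a ntd" | Forget 'a "'a ntd" | Join "'a ntd" "'a ntd"

fun root_bag :: "'a ntd \<Rightarrow> 'a set" where
  "root_bag Leaf = {}"
| "root_bag (Introduce v t) = insert v (root_bag t)"
| "root_bag (Forget v t) = root_bag t - {v}"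
| "root_bag (Join l r) = root_bag l"

fun ntd_wf :: "'a ntd \<Rightarrow> bool" where
  "ntd_wf Leaf \<longleftrightarrow> True"
| "ntd_wf (Introduce v t) \<longleftrightarrow> v \<notin> root_bag t \<and> ntd_wf t"
| "ntd_wf (Forget v t) \<longleftrightarrow> v \<in> root_bag t \<and> ntd_wf t"
| "ntd_wf (Join l r) \<longleftrightarrow> root_bag l = root_bag r \<and> ntd_wf l \<and> ntd_wf r"

fun ntd_nodes :: "'a ntd \<Rightarrow> bool list set" where
  "ntd_nodes Leaf = {[]}"
| "ntd_nodes (Introduce v t) = insert [] ((#) False ` ntd_nodes t)"
| "ntd_nodes (Forget v t) = insert [] ((#) False ` ntd_nodes t)"
| "ntd_nodes (Join l r) = insert [] ((#) False ` ntd_nodes l \<union> (#) True ` ntd_nodes r)"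

fun ntd_subtree :: "'a ntd \<Rightarrow> bool list \<Rightarrow> 'a ntd" where
  "ntd_subtree t [] = t"
| "ntd_subtree Leaf (b # p) = Leaf"
| "ntd_subtree (Introduce v t) (b # p) = ntd_subtree t p"
| "ntd_subtree (Forget v t) (b # p) = ntd_subtree t p"
| "ntd_subtree (Join l r) (b # p) = ntd_subtree (if b then r else l) p"

definition ntd_tree :: "'a ntd \<Rightarrow> bool list graph" where
  "ntd_tree t = (ntd_nodes t, {{p, p @ [b]} | p b. p @ [b] \<in> ntd_nodes t})"

definition ntd_bag :: "'a ntd \<Rightarrow> bool list \<Rightarrow> 'a set" where
  "ntd_bag t p = root_bag (ntd_subtree t p)"

definition nice_tree_decomposition :: "'a graph \<Rightarrow> 'a ntd \<Rightarrow> bool" where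
  "nice_tree_decomposition G t \<longleftrightarrow>
     ntd_wf t \<and> root_bag t = {} \<and> tree_decomposition G (ntd_tree t) (ntd_bag t)"

definition ntd_width :: "'a ntd \<Rightarrow> nat" where
  "ntd_width t = td_width (ntd_tree t) (ntd_bag t)"


section \<open>Connected dominating sets\<close>

definition closed_nbhd :: "'a graph \<Rightarrow> 'a set \<Rightarrow> 'a set" where
  "closed_nbhd G X = X \<union> {v \<in> verts G. \<exists>u\<in>X. adj G u v}"

definition connected_dominating_set :: "'a graph \<Rightarrow> 'a set \<Rightarrow> bool" where
  "connected_dominating_set G X \<longleftrightarrow>
     X \<subseteq> verts G \<and> closed_nbhd G X = verts G \<and> connected_graph (induced G X)"

definition cds_opt :: "'a graph \<Rightarrow> nat" where
  "cds_opt G = Min (card ` {X. connected_dominating_set G X})"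

text \<open>A disconnected graph has no feasible solution, so that its optimum is infinite; any vertex set
  is then accepted.\<close>

definition cds_approx :: "real \<Rightarrow> 'a graph \<Rightarrow> 'a set \<Rightarrow> bool" where
  "cds_approx c G X \<longleftrightarrow> X \<subseteq> verts G \<and>
     ((\<exists>Y. connected_dominating_set G Y) \<longrightarrow>
        connected_dominating_set G X \<and> real (card X) \<le> c * real (cds_opt G))"


section \<open>Oracle programs with running time\<close>

text \<open>Programs operate on binary trees, as in Jones's language WHILE, but in point-free form: a program
  maps one input tree to one output tree. Reading a tree costs its size, so that all trees occurring
  in a run (apart from oracle answers) have size at most that of the input plus the running time;
  hence running times are those of (oracle) Turing machines up to polynomials.\<close>

datatype dat = Null | Dot dat dat

fun dcar :: "dat \<Rightarrow> dat" where
  "dcar Null = Null"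
| "dcar (Dot x y) = x"

fun dcdr :: "dat \<Rightarrow> dat" where
  "dcdr Null = Null"
| "dcdr (Dot x y) = y"

datatype prog =
    PId
  | PNull
  | PCar
  | PCdr
  | PEq                  \<comment> \<open>compares the two components of the input\<close>
  | PPair prog prog      \<comment> \<open>both programs are run on the same input\<close>
  | PSeq prog prog
  | PIf prog prog prog   \<comment> \<open>the test and the chosen branch are run on the same input\<close>
  | PWhile prog prog     \<comment> \<open>test, body\<close>
  | PQuery

text \<open>\<open>exec orc P x y t Q\<close>: with oracle \<open>orc\<close>, the program \<open>P\<close> halts on input \<open>x\<close> with output \<open>y\<close>
  after \<open>t\<close> steps, and \<open>Q\<close> is the set of all its oracle queries. In tests, \<open>Null\<close> is false.\<close>

inductive exec :: "(dat \<Rightarrow> dat) \<Rightarrow> prog \<Rightarrow> dat \<Rightarrow> dat \<Rightarrow> nat \<Rightarrow> dat set \<Rightarrow> bool"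
  for orc :: "dat \<Rightarrow> dat" where
  Id: "exec orc PId x x (Suc (size x)) {}"
| Null: "exec orc PNull x Null 1 {}"
| Car: "exec orc PCar x (dcar x) (Suc (size x)) {}"
| Cdr: "exec orc PCdr x (dcdr x) (Suc (size x)) {}"
| Eq: "exec orc PEq x (if dcar x = dcdr x then Dot Null Null else Null) (Suc (size x)) {}"
| Pair: "exec orc P x y t Q \<Longrightarrow> exec orc P' x y' t' Q' \<Longrightarrow>
    exec orc (PPair P P') x (Dot y y') (Suc (t + t')) (Q \<union> Q')"
| Seq: "exec orc P x y t Q \<Longrightarrow> exec orc P' y z t' Q' \<Longrightarrow>
    exec orc (PSeq P P') x z (Suc (t + t')) (Q \<union> Q')"
| IfTrue: "exec orc B x b t Q \<Longrightarrow> b \<noteq> Null \<Longrightarrow> exec orc P x y t' Q' \<Longrightarrow>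
    exec orc (PIf B P P') x y (Suc (t + t')) (Q \<union> Q')"
| IfFalse: "exec orc B x b t Q \<Longrightarrow> b = Null \<Longrightarrow> exec orc P' x y t' Q' \<Longrightarrow>
    exec orc (PIf B P P') x y (Suc (t + t')) (Q \<union> Q')"
| WhileTrue: "exec orc B x b t Q \<Longrightarrow> b \<noteq> Null \<Longrightarrow> exec orc P x y t' Q' \<Longrightarrow>
    exec orc (PWhile B P) y z t'' Q'' \<Longrightarrow>
    exec orc (PWhile B P) x z (Suc (t + t' + t'')) (Q \<union> Q' \<union> Q'')"
| WhileFalse: "exec orc B x b t Q \<Longrightarrow> b = Null \<Longrightarrow>
    exec orc (PWhile B P) x x (Suc (t + size x)) Q"
| Query: "exec orc PQuery x (orc x) 1 {x}"


section \<open>Encodings\<close>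

text \<open>The vertices of the graphs handled by programs are arbitrary trees, which serve as names and are
  encoded by themselves.\<close>

fun enc_list :: "dat list \<Rightarrow> dat" where
  "enc_list [] = Null"
| "enc_list (x # xs) = Dot x (enc_list xs)"

definition encodes_set :: "dat \<Rightarrow> dat set \<Rightarrow> bool" where
  "encodes_set d X \<longleftrightarrow> (\<exists>xs. distinct xs \<and> set xs = X \<and> d = enc_list xs)"

definition encodes_graph :: "dat \<Rightarrow> dat graph \<Rightarrow> bool" where
  "encodes_graph d G \<longleftrightarrow> (\<exists>a es. encodes_set a (verts G) \<and>
     (\<lambda>(u, v). {u, v}) ` set es = edges G \<and>
     d = Dot a (enc_list (map (\<lambda>(u, v). Dot u v) es)))"

fun enc_ntd :: "dat ntd \<Rightarrow> dat" where
  "enc_ntd Leaf = Null"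
| "enc_ntd (Introduce v t) = Dot Null (Dot v (enc_ntd t))"
| "enc_ntd (Forget v t) = Dot (Dot Null Null) (Dot v (enc_ntd t))"
| "enc_ntd (Join l r) = Dot (Dot (Dot Null Null) Null) (Dot (enc_ntd l) (enc_ntd r))"


section \<open>Approximate Turing kernelization\<close>

text \<open>Nothing is assumed about the answers to inputs that do not encode a graph with at most \<open>s\<close>
  vertices.\<close>

definition cds_oracle :: "real \<Rightarrow> real \<Rightarrow> (dat \<Rightarrow> dat) \<Rightarrow> bool" where
  "cds_oracle c s orc \<longleftrightarrow>
     (\<forall>d H. simple_graph H \<longrightarrow> real (card (verts H)) \<le> s \<longrightarrow> encodes_graph d H \<longrightarrow>
        (\<exists>X. encodes_set (orc d) X \<and> cds_approx c H X))"

text \<open>An \<open>\<alpha>\<close>-approximate Turing kernelization whose queries have at most \<open>f G\<close> vertices. The program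
  \<open>P\<close> and its time bound \<open>q\<close> are chosen before the oracle and its approximation factor \<open>c\<close>.\<close>

definition cds_turing_kernelization :: "real \<Rightarrow> (dat graph \<Rightarrow> real) \<Rightarrow> prog \<Rightarrow> bool" where
  "cds_turing_kernelization \<alpha> f P \<longleftrightarrow>
     (\<exists>q :: nat poly. \<forall>G T d c orc.
        simple_graph G \<longrightarrow>
        nice_tree_decomposition G T \<longrightarrow> ntd_width T = treewidth G \<longrightarrow>
        encodes_graph d G \<longrightarrow>
        1 \<le> c \<longrightarrow> cds_oracle c (f G) orc \<longrightarrow>
        (\<exists>y t Q X.
           exec orc P (Dot d (enc_ntd T)) y t Q \<and>
           t \<le> poly q (size (Dot d (enc_ntd T))) \<and>
           (\<forall>x\<in>Q. \<exists>H. simple_graph H \<and> real (card (verts H)) \<le> f G \<and> encodes_graph x H) \<and>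
           encodes_set y X \<and> cds_approx (c * \<alpha>) G X))"

end

theory Submission
  imports Defs
begin

text \<open>Evaluate the nice tree decomposition bottom-up and keep the set \<open>W\<close> of vertices seen below the
  current node. As soon as \<open>W\<close> has \<open>s = K (tw + 1) \<Delta>\<close> vertices, it becomes a piece and only the bag is
  kept. The boundary \<open>X\<close> of a piece consists of the bag and of the bags of the earlier cuts directly
  below it; no other vertex of the piece has neighbours outside. Query the graph induced by each piece
  with its boundary turned into a clique: if \<open>O\<close> is an optimal solution, then the vertices of \<open>O\<close> inside
  the piece together with \<open>X\<close> are feasible. The union of the answers and of all boundaries dominates
  the graph, each of its components meets a boundary, and two more vertices always suffice to merge two
  components. So the cost is at most \<open>c\<close> times the optimum plus \<open>O(c)\<close> times the total size of the
  boundaries. That size is \<open>O(tw n / s) = O(n / (K \<Delta>))\<close>, and every dominating set has at least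
  \<open>n / (\<Delta> + 1)\<close> vertices, so a large constant \<open>K = O((1 + \<epsilon>) / \<epsilon>)\<close> makes the error an
  \<open>\<epsilon>\<close>-fraction. The queries do not depend on the answers.\<close>

section \<open>Polynomial-time functions\<close>

text \<open>The clique on a boundary replaces connections of an optimal solution that run outside
  the piece. Its price is that an answer is connected only up to clique edges, so connectivity must
  be repaired afterwards. The repair counts boundary vertices reached from one fixed vertex
  \<open>r\<close>, not components; this bounds its rounds by the total boundary size. Putting
  \<open>r\<close> into every boundary keeps the boundaries nonempty and gives the repair its start.
  Boundaries are charged by two counts. With \<open>b\<close> the largest bag size, a cut retires at
  least \<open>s - b\<close> vertices for good, and its bag is listed at most twice: for the piece
  below and for the piece above. The factor \<Delta> in \<open>s\<close> absorbs the \<Delta> + 1 of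
  the domination bound. On the program side there are only while loops, so the bottom-up evaluation
  runs on a stack, and every intermediate value needs a size bound. An answer costs one step
  whatever its size; what bounds it is that it lists vertices of the query without repetition.
  Disconnected inputs are allowed, so the output must be a set of vertices even if no solution
  exists.\<close>

lemma poly_nat_mono: "x \<le> y \<Longrightarrow> poly p x \<le> poly p y" for p :: "nat poly"
  by (induction p) (auto intro: add_mono mult_mono)

lemma poly_nat_mono_trans: "m \<le> poly p x \<Longrightarrow> x \<le> y \<Longrightarrow> m \<le> poly p y" for p :: "nat poly"
  using poly_nat_mono le_trans by blast

lemma size_dcar: "size (dcar x) \<le> size x"
  by (cases x) auto

lemma size_dcdr: "size (dcdr x) \<le> size x"
  by (cases x) auto

text \<open>Reading a tree is charged its size, so a run cannot output more than it has paid for.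
  Queries break this, since an answer of any size costs one step; hence
  \<open>Q = {}\<close>.\<close>

lemma exec_size: "exec orc P x y t Q \<Longrightarrow> Q = {} \<Longrightarrow> size y \<le> t"
  by (induction rule: exec.induct) (auto simp: le_SucI size_dcar size_dcdr)

section \<open>Encoded types and polynomial-time functions on them\<close>

class enc = fixes enc :: "'a \<Rightarrow> dat"

instantiation dat :: enc begin
definition "enc (x :: dat) = x"
instance ..
end

instantiation unit :: enc begin
definition "enc (x :: unit) = Null"
instance ..
end

instantiation bool :: enc begin
definition "enc b = (if b then Dot Null Null else Null)"
instance ..
end

instantiation nat :: enc begin
definition "enc (n :: nat) = enc_list (replicate n Null)"
instance ..
end

instantiation prod :: (enc, enc) enc begin
definition "enc p = Dot (enc (fst p)) (enc (snd p))"
instance ..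
end

instantiation list :: (enc) enc begin
definition "enc xs = enc_list (map enc xs)"
instance ..
end

instantiation ntd :: (enc) enc begin
definition "enc t = enc_ntd (map_ntd enc t)"
instance ..
end

lemma enc_simps [simp]:
  "enc (x :: dat) = x" "enc () = Null" "enc True = Dot Null Null" "enc False = Null"
  "enc (a, b) = Dot (enc a) (enc b)"
  "enc [] = Null" "enc (y # ys) = Dot (enc y) (enc ys)"
  "enc (0 :: nat) = Null" "enc (Suc n) = Dot Null (enc n)"
  "enc Leaf = Null"
  "enc (Introduce v t) = Dot Null (Dot (enc v) (enc t))"
  "enc (Forget v t) = Dot (Dot Null Null) (Dot (enc v) (enc t))"
  "enc (Join l r) = Dot (Dot (Dot Null Null) Null) (Dot (enc l) (enc r))"
  by (simp_all add: enc_dat_def enc_unit_def enc_bool_def enc_nat_def enc_prod_def enc_list_def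
      enc_ntd_def)

abbreviation esize :: "'a::enc \<Rightarrow> nat" where "esize x \<equiv> size (enc x)"

text \<open>One program and one polynomial serve all oracles and all inputs, without queries. The
  domain \<open>A\<close> is there for case distinctions: a branch has to be computed only on inputs
  that reach it.\<close>

definition polytime_on :: "'a::enc set \<Rightarrow> ('a \<Rightarrow> 'b::enc) \<Rightarrow> bool" where
  "polytime_on A f \<longleftrightarrow> (\<exists>P (q :: nat poly). \<forall>orc. \<forall>x\<in>A. \<exists>t.
     exec orc P (enc x) (enc (f x)) t {} \<and> t \<le> poly q (esize x))"

abbreviation polytime :: "('a::enc \<Rightarrow> 'b::enc) \<Rightarrow> bool" where "polytime \<equiv> polytime_on UNIV"

lemma polytime_onI:
  fixes q :: "nat poly"
  assumes "\<And>orc x. x \<in> A \<Longrightarrow> \<exists>t. exec orc P (enc x) (enc (f x)) t {} \<and> t \<le> poly q (esize x)"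
  shows "polytime_on A f"
  unfolding polytime_on_def using assms by blast

lemma polytime_onE:
  assumes "polytime_on A f"
  obtains P T and q :: "nat poly" where
    "\<And>orc x. x \<in> A \<Longrightarrow> exec orc P (enc x) (enc (f x)) (T orc x) {}"
    "\<And>orc x. x \<in> A \<Longrightarrow> T orc x \<le> poly q (esize x)"
    "\<And>x. x \<in> A \<Longrightarrow> esize (f x) \<le> poly q (esize x)"
proof -
  obtain P and q :: "nat poly"
    where *: "\<forall>orc. \<forall>x\<in>A. \<exists>t. exec orc P (enc x) (enc (f x)) t {} \<and> t \<le> poly q (esize x)"
    using assms unfolding polytime_on_def by blast
  then obtain T where T: "\<And>orc x. x \<in> A \<Longrightarrow>
      exec orc P (enc x) (enc (f x)) (T orc x) {} \<and> T orc x \<le> poly q (esize x)"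
    by metis
  moreover have "esize (f x) \<le> poly q (esize x)" if "x \<in> A" for x
    using T[OF that, of id] exec_size le_trans by blast
  ultimately show thesis using that by blast
qed

lemma polytimeI:
  fixes q :: "nat poly"
  assumes "\<And>orc x. \<exists>t. exec orc P (enc x) (enc (f x)) t {} \<and> t \<le> poly q (esize x)"
  shows "polytime f"
  using assms by (intro polytime_onI)

lemma polytimeE:
  assumes "polytime f"
  obtains P T and q :: "nat poly" where
    "\<And>orc x. exec orc P (enc x) (enc (f x)) (T orc x) {}"
    "\<And>orc x. T orc x \<le> poly q (esize x)"
    "\<And>x. esize (f x) \<le> poly q (esize x)"
  using polytime_onE[OF assms] by (metis UNIV_I)

named_theorems polytime_intros

lemma polytime_id [polytime_intros]: "polytime (\<lambda>x. x)"
  by (rule polytimeI[of PId _ "[:1, 1:]"]) (auto intro: exec.Id)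

text \<open>\<open>PNull\<close> costs 1 on every input, so a constant is built in time independent
  of the input.\<close>

lemma exec_const: "\<exists>P t. \<forall>orc x. exec orc P x c t {}"
proof (induction c)
  case Null
  show ?case using exec.Null by blast
next
  case (Dot a b)
  then obtain P t P' t' where "\<forall>orc x. exec orc P x a t {}" "\<forall>orc x. exec orc P' x b t' {}"
    by blast
  then have "\<forall>orc x. exec orc (PPair P P') x (Dot a b) (Suc (t + t')) {}"
    using exec.Pair by (metis Un_empty)
  then show ?case by blast
qed

lemma polytime_const [polytime_intros]: "polytime (\<lambda>x. c)"
proof -
  obtain P t where P: "\<forall>orc x. exec orc P x (enc c) t {}"
    using exec_const by blast
  show ?thesis by (rule polytimeI[of P _ "[:t:]"]) (use P in auto)
qed

lemma polytime_Pair [polytime_intros]: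
  assumes "polytime f" "polytime g"
  shows "polytime (\<lambda>x. (f x, g x))"
proof -
  obtain P T q where f: "\<And>orc x. exec orc P (enc x) (enc (f x)) (T orc x) {}"
    "\<And>orc x. T orc x \<le> poly q (esize x)" "\<And>x. esize (f x) \<le> poly q (esize x)"
    by (rule polytimeE[OF assms(1)]) blast
  obtain P' T' q' where g: "\<And>orc x. exec orc P' (enc x) (enc (g x)) (T' orc x) {}"
    "\<And>orc x. T' orc x \<le> poly q' (esize x)" "\<And>x. esize (g x) \<le> poly q' (esize x)"
    by (rule polytimeE[OF assms(2)]) blast
  show ?thesis
  proof (rule polytimeI[of "PPair P P'" _ "1 + q + q'"], intro exI conjI)
    fix orc and x :: 'a
    show "exec orc (PPair P P') (enc x) (enc (f x, g x)) (Suc (T orc x + T' orc x)) {}"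
      using exec.Pair[OF f(1) g(1)] by simp
    show "Suc (T orc x + T' orc x) \<le> poly (1 + q + q') (esize x)"
      using f(2)[of orc x] g(2)[of orc x] by simp
  qed
qed

lemma polytime_on_if:
  assumes b: "polytime b" and f: "polytime_on (A \<inter> Collect b) f" and g: "polytime_on (A - Collect b) f"
  shows "polytime_on A f"
proof -
  obtain P0 T0 q0 where b: "\<And>orc x. exec orc P0 (enc x) (enc (b x)) (T0 orc x) {}"
    "\<And>orc x. T0 orc x \<le> poly q0 (esize x)" "\<And>x. esize (b x) \<le> poly q0 (esize x)"
    by (rule polytimeE[OF b]) blast
  obtain P T q where f: "\<And>orc x. x \<in> A \<inter> Collect b \<Longrightarrow> exec orc P (enc x) (enc (f x)) (T orc x) {}"
    "\<And>orc x. x \<in> A \<inter> Collect b \<Longrightarrow> T orc x \<le> poly q (esize x)"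
    by (rule polytime_onE[OF f]) blast
  obtain P' T' q' where g: "\<And>orc x. x \<in> A - Collect b \<Longrightarrow> exec orc P' (enc x) (enc (f x)) (T' orc x) {}"
    "\<And>orc x. x \<in> A - Collect b \<Longrightarrow> T' orc x \<le> poly q' (esize x)"
    by (rule polytime_onE[OF g]) blast
  show ?thesis
  proof (rule polytime_onI[of _ "PIf P0 P P'" _ "1 + q0 + q + q'"])
    fix orc and x assume x: "x \<in> A"
    show "\<exists>t. exec orc (PIf P0 P P') (enc x) (enc (f x)) t {} \<and> t \<le> poly (1 + q0 + q + q') (esize x)"
    proof (cases "b x")
      case True
      then have x: "x \<in> A \<inter> Collect b" using x by simp
      have "exec orc (PIf P0 P P') (enc x) (enc (f x)) (Suc (T0 orc x + T orc x)) ({} \<union> {})"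
        by (rule exec.IfTrue[OF b(1) _ f(1)[OF x]]) (simp add: True)
      then show ?thesis using b(2)[of orc x] f(2)[OF x, of orc]
        by (intro exI[of _ "Suc (T0 orc x + T orc x)"]) simp
    next
      case False
      then have x: "x \<in> A - Collect b" using x by simp
      have "exec orc (PIf P0 P P') (enc x) (enc (f x)) (Suc (T0 orc x + T' orc x)) ({} \<union> {})"
        by (rule exec.IfFalse[OF b(1) _ g(1)[OF x]]) (simp add: False)
      then show ?thesis using b(2)[of orc x] g(2)[OF x, of orc]
        by (intro exI[of _ "Suc (T0 orc x + T' orc x)"]) simp
    qed
  qed
qed

text \<open>The auxiliary value \<open>k x\<close> may have another type than \<open>z\<close>; only the encodings have to agree.\<close>

lemma polytime_on_via:
  assumes "polytime g" "polytime k" "\<And>x. x \<in> A \<Longrightarrow> \<exists>z. enc z = enc (k x) \<and> enc (g z) = enc (f x)"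
  shows "polytime_on A f"
proof -
  obtain P T q where g: "\<And>orc x. exec orc P (enc x) (enc (g x)) (T orc x) {}"
    "\<And>orc x. T orc x \<le> poly q (esize x)"
    by (rule polytimeE[OF assms(1)]) blast
  obtain P' T' q' where k: "\<And>orc x. exec orc P' (enc x) (enc (k x)) (T' orc x) {}"
    "\<And>orc x. T' orc x \<le> poly q' (esize x)" "\<And>x. esize (k x) \<le> poly q' (esize x)"
    by (rule polytimeE[OF assms(2)]) blast
  show ?thesis
  proof (rule polytime_onI[of _ "PSeq P' P" _ "1 + q' + pcompose q q'"])
    fix orc x assume "x \<in> A"
    then obtain z where z: "enc z = enc (k x)" "enc (g z) = enc (f x)" using assms(3) by blast
    have "exec orc (PSeq P' P) (enc x) (enc (f x)) (Suc (T' orc x + T orc z)) ({} \<union> {})"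
      by (rule exec.Seq[OF k(1)]) (use g(1)[of orc z] z in simp)
    moreover have "T orc z \<le> poly q (poly q' (esize x))"
      using g(2) k(3)[of x] poly_nat_mono_trans z by metis
    ultimately show "\<exists>t. exec orc (PSeq P' P) (enc x) (enc (f x)) t {} \<and>
        t \<le> poly (1 + q' + pcompose q q') (esize x)"
      using k(2)[of orc x] by (intro exI[of _ "Suc (T' orc x + T orc z)"]) (simp add: poly_pcompose)
  qed
qed

lemma polytime_on_subset:
  assumes "polytime f" "\<And>x. x \<in> A \<Longrightarrow> f x = g x"
  shows "polytime_on A g"
  by (rule polytime_on_via[of f "\<lambda>x. x"]) (use assms in \<open>auto intro: polytime_id\<close>)

lemma polytime_comp:
  assumes "polytime g" "polytime f"
  shows "polytime (\<lambda>x. g (f x))"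
  by (rule polytime_on_via[OF assms]) auto

lemma polytime_if [polytime_intros]:
  assumes "polytime b" "polytime f" "polytime g"
  shows "polytime (\<lambda>x. if b x then f x else g x)"
  by (rule polytime_on_if[OF assms(1)]; rule polytime_on_subset, rule assms) auto

text \<open>A change of type that keeps the encoding is the identity program. Pairs read as nonempty
  lists, numbers read as lists of units and values replaced by their own encodings all come from
  this.\<close>

lemma polytime_same_enc: "(\<And>x. enc (f x) = enc x) \<Longrightarrow> polytime f"
  by (rule polytimeI[of PId _ "[:1, 1:]"]) (auto intro: exec.Id)

lemma polytime_dcar: "(\<And>x. enc (f x) = dcar (enc x)) \<Longrightarrow> polytime f"
  by (rule polytimeI[of PCar _ "[:1, 1:]"]) (auto intro: exec.Car)

lemma polytime_dcdr: "(\<And>x. enc (f x) = dcdr (enc x)) \<Longrightarrow> polytime f"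
  by (rule polytimeI[of PCdr _ "[:1, 1:]"]) (auto intro: exec.Cdr)

lemma polytime_fst [polytime_intros]: "polytime f \<Longrightarrow> polytime (\<lambda>x. fst (f x))"
  by (rule polytime_comp[of fst]) (auto intro!: polytime_dcar simp: enc_prod_def)

lemma polytime_snd [polytime_intros]: "polytime f \<Longrightarrow> polytime (\<lambda>x. snd (f x))"
  by (rule polytime_comp[of snd]) (auto intro!: polytime_dcdr simp: enc_prod_def)

text \<open>Bound variables are packed with the outer argument into one tuple
  \<open>(x, a, b)\<close>, so that the premise is again about a function of one argument. The rules
  for maps, filters and folds use the same convention.\<close>

lemma polytime_case_prod [polytime_intros]:
  assumes "polytime (\<lambda>p. f (fst p) (fst (snd p)) (snd (snd p)))" "polytime g"
  shows "polytime (\<lambda>x. case g x of (a, b) \<Rightarrow> f x a b)"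
proof -
  have "polytime (\<lambda>x. f (fst (x, g x)) (fst (snd (x, g x))) (snd (snd (x, g x))))"
    by (rule polytime_comp[OF assms(1)]) (intro polytime_intros assms)
  then show ?thesis by (simp add: case_prod_beta)
qed

lemma polytime_dat_eq [polytime_intros]:
  assumes "polytime f" "polytime g"
  shows "polytime (\<lambda>x. (f x :: dat) = g x)"
proof -
  have "polytime (\<lambda>p. fst p = (snd p :: dat))"
  proof (rule polytimeI[of PEq _ "[:1, 1:]"], intro exI conjI)
    fix orc and p :: "dat \<times> dat"
    show "exec orc PEq (enc p) (enc (fst p = snd p)) (Suc (esize p)) {}"
      using exec.Eq[of orc "enc p"] by (simp add: enc_prod_def enc_bool_def)
  qed simp
  from polytime_comp[OF this, of "\<lambda>x. (f x, g x)"] show ?thesis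
    using assms by (auto intro: polytime_intros)
qed

lemma polytime_Not [polytime_intros]: "polytime f \<Longrightarrow> polytime (\<lambda>x. \<not> f x)"
proof -
  have "(\<lambda>x. \<not> f x) = (\<lambda>x. if f x then False else True)" by auto
  then show "polytime f \<Longrightarrow> polytime (\<lambda>x. \<not> f x)" by (simp only: polytime_if polytime_const)
qed

lemma polytime_conj [polytime_intros]: "polytime f \<Longrightarrow> polytime g \<Longrightarrow> polytime (\<lambda>x. f x \<and> g x)"
proof -
  have "(\<lambda>x. f x \<and> g x) = (\<lambda>x. if f x then g x else False)" by auto
  then show "polytime f \<Longrightarrow> polytime g \<Longrightarrow> polytime (\<lambda>x. f x \<and> g x)" by (simp only: polytime_if polytime_const)
qed

lemma polytime_disj [polytime_intros]: "polytime f \<Longrightarrow> polytime g \<Longrightarrow> polytime (\<lambda>x. f x \<or> g x)"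
proof -
  have "(\<lambda>x. f x \<or> g x) = (\<lambda>x. if f x then True else g x)" by auto
  then show "polytime f \<Longrightarrow> polytime g \<Longrightarrow> polytime (\<lambda>x. f x \<or> g x)" by (simp only: polytime_if polytime_const)
qed

lemma polytime_Cons [polytime_intros]:
  assumes "polytime f" "polytime g"
  shows "polytime (\<lambda>x. f x # g x)"
proof -
  have "polytime (\<lambda>p. fst p # snd p :: 'b list)"
    by (rule polytime_same_enc) (simp add: enc_prod_def)
  from polytime_comp[OF this polytime_Pair[OF assms]] show ?thesis by simp
qed

lemma polytime_tl [polytime_intros]:
  assumes "polytime f"
  shows "polytime (\<lambda>x. tl (f x))"
proof -
  have "enc (tl xs) = dcdr (enc xs)" for xs :: "'b list"
    by (cases xs) auto
  from polytime_comp[OF polytime_dcdr[OF this] assms] show ?thesis .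
qed

lemma polytime_is_Nil [polytime_intros]:
  assumes "polytime f"
  shows "polytime (\<lambda>x. f x = [])"
proof -
  have "polytime (\<lambda>xs :: 'b list. xs = [])"
  proof (rule polytimeI[of "PIf PId PNull (PPair PNull PNull)" _ "[:5, 1:]"])
    fix orc and xs :: "'b list"
    show "\<exists>t. exec orc (PIf PId PNull (PPair PNull PNull)) (enc xs) (enc (xs = [])) t {} \<and>
      t \<le> poly [:5, 1:] (esize xs)"
    proof (cases xs)
      case Nil
      have "exec orc (PIf PId PNull (PPair PNull PNull)) Null (Dot Null Null)
          (Suc (Suc (size Null) + Suc (1 + 1))) ({} \<union> ({} \<union> {}))"
        by (intro exec.IfFalse[OF exec.Id] exec.Pair exec.Null) simp
      then show ?thesis using Nil by (intro exI[of _ 5]) (simp add: numeral_eq_Suc)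
    next
      case (Cons a list)
      have "exec orc (PIf PId PNull (PPair PNull PNull)) (enc xs) Null
          (Suc (Suc (esize xs) + 1)) ({} \<union> {})"
        by (intro exec.IfTrue[OF exec.Id] exec.Null) (simp add: Cons)
      then show ?thesis using Cons by (intro exI[of _ "Suc (Suc (esize xs) + 1)"]) simp
    qed
  qed
  from polytime_comp[OF this assms] show ?thesis .
qed

lemma polytime_enc [polytime_intros]: "polytime f \<Longrightarrow> polytime (\<lambda>x. enc (f x))"
  by (rule polytime_comp[of enc]) (auto intro: polytime_same_enc)

lemma polytime_enc_dcar: "polytime f \<Longrightarrow> polytime (\<lambda>x. dcar (enc (f x)))"
  by (rule polytime_comp[of "\<lambda>y. dcar (enc y)"]) (auto intro: polytime_dcar)

lemma polytime_enc_dcdr: "polytime f \<Longrightarrow> polytime (\<lambda>x. dcdr (enc (f x)))"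
  by (rule polytime_comp[of "\<lambda>y. dcdr (enc y)"]) (auto intro: polytime_dcdr)

text \<open>Once \<open>l x\<close> is known to be nonempty, \<open>(x, l x)\<close> and
  \<open>(x, y, ys)\<close> have the same encoding, so \<open>polytime_on_via\<close> yields the
  second branch without any destructuring.\<close>

lemma polytime_case_list [polytime_intros]:
  assumes "polytime l" "polytime f" "polytime (\<lambda>p. g (fst p) (fst (snd p)) (snd (snd p)))"
  shows "polytime (\<lambda>x. case l x of [] \<Rightarrow> f x | y # ys \<Rightarrow> g x y ys)" (is "polytime ?h")
proof (rule polytime_on_if[of "\<lambda>x. l x = []"])
  show "polytime (\<lambda>x. l x = [])" by (intro polytime_intros assms)
  show "polytime_on (UNIV \<inter> {x. l x = []}) ?h"
    by (rule polytime_on_subset[OF assms(2)]) simp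
  show "polytime_on (UNIV - {x. l x = []}) ?h"
  proof (rule polytime_on_via[OF assms(3), of "\<lambda>x. (x, l x)"])
    show "polytime (\<lambda>x. (x, l x))" by (intro polytime_intros assms)
    fix x assume "x \<in> UNIV - {x. l x = []}"
    then obtain y ys where "l x = y # ys" by (auto simp: neq_Nil_conv)
    then show "\<exists>z. enc z = enc (x, l x) \<and> enc (g (fst z) (fst (snd z)) (snd (snd z))) = enc (?h x)"
      by (intro exI[of _ "(x, y, ys)"]) simp
  qed
qed

lemma polytime_case_ntd [polytime_intros]:
  fixes l :: "'a::enc \<Rightarrow> 'b::enc ntd"
  assumes "polytime l" "polytime f"
    "polytime (\<lambda>p. g (fst p) (fst (snd p)) (snd (snd p)))"
    "polytime (\<lambda>p. h (fst p) (fst (snd p)) (snd (snd p)))"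
    "polytime (\<lambda>p. k (fst p) (fst (snd p)) (snd (snd p)))"
  shows "polytime (\<lambda>x. case l x of Leaf \<Rightarrow> f x | Introduce v t \<Rightarrow> g x v t | Forget v t \<Rightarrow> h x v t
    | Join t u \<Rightarrow> k x t u)" (is "polytime ?h")
proof -
  \<comment> \<open>The constructor tag: \<open>Null\<close> for \<open>Introduce\<close>,
    \<open>Dot Null Null\<close> for \<open>Forget\<close>, a third tree for \<open>Join\<close>.
    Since \<open>dcar Null = Null\<close>, a \<open>Leaf\<close> would look like an
    \<open>Introduce\<close>; it is therefore split off first.\<close>
  define tg where "tg = (\<lambda>x. dcar (enc (l x)))"
  define ar where "ar = (\<lambda>x. (x, dcdr (enc (l x))))"
  have tg: "polytime tg" and ar: "polytime ar"
    unfolding tg_def ar_def by (intro polytime_Pair polytime_enc_dcar polytime_enc_dcdr assms polytime_id)+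
  show ?thesis
  proof (rule polytime_on_if[of "\<lambda>x. enc (l x) = Null"])
    show "polytime (\<lambda>x. enc (l x) = Null)" by (intro polytime_intros assms)
    show "polytime_on (UNIV \<inter> {x. enc (l x) = Null}) ?h"
      by (rule polytime_on_subset[OF assms(2)]) (auto split: ntd.splits)
    show "polytime_on (UNIV - {x. enc (l x) = Null}) ?h" (is "polytime_on ?A _")
    proof (rule polytime_on_if[of "\<lambda>x. tg x = Null"])
      show "polytime (\<lambda>x. tg x = Null)" by (intro polytime_intros tg)
      show "polytime_on (?A \<inter> {x. tg x = Null}) ?h"
      proof (rule polytime_on_via[OF assms(3) ar])
        fix x assume "x \<in> ?A \<inter> {x. tg x = Null}"
        then obtain v t where "l x = Introduce v t"
          unfolding tg_def by (cases "l x") auto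
        then show "\<exists>z. enc z = enc (ar x) \<and> enc (g (fst z) (fst (snd z)) (snd (snd z))) = enc (?h x)"
          unfolding ar_def by (intro exI[of _ "(x, v, t)"]) simp
      qed
      show "polytime_on (?A - {x. tg x = Null}) ?h" (is "polytime_on ?B _")
      proof (rule polytime_on_if[of "\<lambda>x. tg x = Dot Null Null"])
        show "polytime (\<lambda>x. tg x = Dot Null Null)" by (intro polytime_intros tg)
        show "polytime_on (?B \<inter> {x. tg x = Dot Null Null}) ?h"
        proof (rule polytime_on_via[OF assms(4) ar])
          fix x assume "x \<in> ?B \<inter> {x. tg x = Dot Null Null}"
          then obtain v t where "l x = Forget v t"
            unfolding tg_def by (cases "l x") auto
          then show "\<exists>z. enc z = enc (ar x) \<and> enc (h (fst z) (fst (snd z)) (snd (snd z))) = enc (?h x)"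
            unfolding ar_def by (intro exI[of _ "(x, v, t)"]) simp
        qed
        show "polytime_on (?B - {x. tg x = Dot Null Null}) ?h"
        proof (rule polytime_on_via[OF assms(5) ar])
          fix x assume "x \<in> ?B - {x. tg x = Dot Null Null}"
          then obtain t u where "l x = Join t u"
            unfolding tg_def by (cases "l x") auto
          then show "\<exists>z. enc z = enc (ar x) \<and> enc (k (fst z) (fst (snd z)) (snd (snd z))) = enc (?h x)"
            unfolding ar_def by (intro exI[of _ "(x, t, u)"]) simp
        qed
      qed
    qed
  qed
qed

text \<open>A bound on the number of rounds is not enough, because a state might double in each
  round. So \<open>q\<close> also bounds every intermediate state, which gives all rounds a common
  cost bound.\<close>

lemma polytime_while:
  fixes q :: "nat poly" and f :: "'b::enc \<Rightarrow> 'b" and i :: "'a::enc \<Rightarrow> 'b"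
  assumes "polytime b" "polytime f" "polytime i"
    and run: "\<And>x. \<exists>n\<le>poly q (esize x). (\<forall>j<n. b ((f ^^ j) (i x))) \<and> \<not> b ((f ^^ n) (i x)) \<and>
      (\<forall>j\<le>n. esize ((f ^^ j) (i x)) \<le> poly q (esize x)) \<and> r x = (f ^^ n) (i x)"
  shows "polytime r"
proof -
  obtain P0 T0 q0 where b: "\<And>orc x. exec orc P0 (enc x) (enc (b x)) (T0 orc x) {}"
    "\<And>orc x. T0 orc x \<le> poly q0 (esize x)"
    by (rule polytimeE[OF assms(1)]) blast
  obtain P T q1 where f: "\<And>orc x. exec orc P (enc x) (enc (f x)) (T orc x) {}"
    "\<And>orc x. T orc x \<le> poly q1 (esize x)"
    by (rule polytimeE[OF assms(2)]) blast
  obtain P' T' q2 where i: "\<And>orc x. exec orc P' (enc x) (enc (i x)) (T' orc x) {}"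
    "\<And>orc x. T' orc x \<le> poly q2 (esize x)"
    by (rule polytimeE[OF assms(3)]) blast
  have loop: "\<exists>t. exec orc (PWhile P0 P) (enc y) (enc ((f ^^ n) y)) t {} \<and>
      t \<le> Suc n * (1 + poly q0 S + poly q1 S + S)"
    if "\<forall>j<n. b ((f ^^ j) y)" "\<not> b ((f ^^ n) y)" "\<forall>j\<le>n. esize ((f ^^ j) y) \<le> S" for orc n y S
    using that
  proof (induction n arbitrary: y)
    case 0
    have "exec orc (PWhile P0 P) (enc y) (enc y) (Suc (T0 orc y + esize y)) {}"
      by (rule exec.WhileFalse[OF b(1)]) (use 0 in simp)
    moreover have "T0 orc y \<le> poly q0 S" by (rule poly_nat_mono_trans[OF b(2)]) (use 0 in simp)
    ultimately show ?case using 0 by (intro exI[of _ "Suc (T0 orc y + esize y)"]) simp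
  next
    case (Suc n)
    have shift: "(f ^^ j) (f y) = (f ^^ Suc j) y" for j
      by (simp add: funpow_swap1)
    have "\<exists>t. exec orc (PWhile P0 P) (enc (f y)) (enc ((f ^^ n) (f y))) t {} \<and>
        t \<le> Suc n * (1 + poly q0 S + poly q1 S + S)"
      by (rule Suc.IH) (use Suc.prems in \<open>simp_all only: shift Suc_less_eq Suc_le_mono all_simps\<close>, auto)
    then obtain t where t: "exec orc (PWhile P0 P) (enc (f y)) (enc ((f ^^ n) (f y))) t {}"
      "t \<le> Suc n * (1 + poly q0 S + poly q1 S + S)" by blast
    have "b y" using spec[OF Suc.prems(1), of 0] by simp
    then have "exec orc (PWhile P0 P) (enc y) (enc ((f ^^ n) (f y))) (Suc (T0 orc y + T orc y + t)) ({} \<union> {} \<union> {})"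
      by (intro exec.WhileTrue[OF b(1) _ f(1) t(1)]) simp
    moreover have "esize y \<le> S" using spec[OF Suc.prems(3), of 0] by simp
    then have "T0 orc y \<le> poly q0 S" "T orc y \<le> poly q1 S"
      by (auto intro: poly_nat_mono_trans[OF b(2)] poly_nat_mono_trans[OF f(2)])
    ultimately show ?case using t(2)
      by (intro exI[of _ "Suc (T0 orc y + T orc y + t)"]) (simp add: shift)
  qed
  show ?thesis
  proof (rule polytimeI[of "PSeq P' (PWhile P0 P)" _
        "1 + q2 + (1 + q) * (1 + pcompose q0 q + pcompose q1 q + q)"])
    fix orc x
    obtain n where n: "n \<le> poly q (esize x)" "\<forall>j<n. b ((f ^^ j) (i x))" "\<not> b ((f ^^ n) (i x))"
      "\<forall>j\<le>n. esize ((f ^^ j) (i x)) \<le> poly q (esize x)" "r x = (f ^^ n) (i x)"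
      using run by blast
    define S where "S = poly q (esize x)"
    obtain t where t: "exec orc (PWhile P0 P) (enc (i x)) (enc (r x)) t {}"
      "t \<le> Suc n * (1 + poly q0 S + poly q1 S + S)"
      using loop[OF n(2-4), of orc] n(5) unfolding S_def by auto
    have "t \<le> (1 + S) * (1 + poly q0 S + poly q1 S + S)"
      by (rule order_trans[OF t(2)], rule mult_right_mono) (use n(1) S_def in auto)
    then show "\<exists>t. exec orc (PSeq P' (PWhile P0 P)) (enc x) (enc (r x)) t {} \<and>
        t \<le> poly (1 + q2 + (1 + q) * (1 + pcompose q0 q + pcompose q1 q + q)) (esize x)"
      using exec.Seq[OF i(1)[of orc x] t(1)] i(2)[of orc x]
      by (intro exI[of _ "Suc (T' orc x + t)"]) (simp add: poly_pcompose S_def)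
  qed
qed

section \<open>Folds over lists\<close>

lemma polytime_size:
  assumes "polytime f"
  obtains q :: "nat poly" where "\<And>x. esize (f x) \<le> poly q (esize x)"
  by (rule polytimeE[OF assms]) blast

lemma esize_append [simp]: "esize (xs @ ys) = esize xs + esize ys"
  by (induction xs) auto

lemma esize_rev [simp]: "esize (rev xs) = esize xs"
  by (induction xs) auto

lemma esize_nat [simp]: "esize (n :: nat) = n"
  by (induction n) auto

lemma esize_filter: "esize (filter P xs) \<le> esize xs"
  by (induction xs) auto

lemma length_le_esize: "length xs \<le> esize xs"
  by (induction xs) auto

lemma esize_mem: "e \<in> set xs \<Longrightarrow> esize e < esize xs"
  by (induction xs) auto

lemma esize_drop: "esize (drop n xs) \<le> esize xs"
  by (metis append_take_drop_id esize_append le_add2)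

lemma esize_tl: "esize (tl xs) \<le> esize xs"
  by (cases xs) auto

text \<open>The accumulators that occur are the folds over prefixes, hence the hypothesis on
  \<open>take n\<close>. The loop state carries \<open>x\<close> along because \<open>F\<close> may
  depend on it.\<close>

lemma polytime_foldl:
  fixes q :: "nat poly"
  assumes F: "polytime (\<lambda>p. F (fst p) (fst (snd p)) (snd (snd p)))" and "polytime a" "polytime l"
    and size: "\<And>x n. esize (foldl (F x) (a x) (take n (l x))) \<le> poly q (esize x)"
  shows "polytime (\<lambda>x. foldl (F x) (a x) (l x))"
proof -
  define b where "b = (\<lambda>s :: 'a \<times> 'b \<times> 'c list. snd (snd s) \<noteq> [])"
  define f where "f = (\<lambda>s. case snd (snd s) of [] \<Rightarrow> s
    | e # es \<Rightarrow> (fst s, F (fst s) (fst (snd s)) e, es))"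
  define i where "i = (\<lambda>x. (x, a x, l x))"
  obtain ql where ql: "\<And>x. esize (l x) \<le> poly ql (esize x)"
    by (rule polytime_size[OF assms(3)]) blast
  have F': "polytime (\<lambda>p. F (f p) (g p) (h p))" if "polytime f" "polytime g" "polytime h" for f g h
    using polytime_comp[OF F, of "\<lambda>p. (f p, g p, h p)"] that by (simp add: polytime_intros)
  have iter: "(f ^^ j) (x, c, es) = (x, foldl (F x) c (take j es), drop j es)" for j x c es
  proof (induction j arbitrary: c es)
    case (Suc j)
    have "(f ^^ Suc j) (x, c, es) = (f ^^ j) (f (x, c, es))" by (simp add: funpow_swap1)
    then show ?case using Suc by (cases es) (auto simp: f_def)
  qed simp
  have "polytime (\<lambda>x. (x, foldl (F x) (a x) (l x), [] :: 'c list))"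
  proof (rule polytime_while[of b f i "[:2, 1:] + q + ql"])
    show "polytime b" unfolding b_def by (intro polytime_intros)
    show "polytime f" unfolding f_def by (intro polytime_intros F')
    show "polytime i" unfolding i_def by (intro polytime_intros assms)
    show "\<exists>n\<le>poly ([:2, 1:] + q + ql) (esize x). (\<forall>j<n. b ((f ^^ j) (i x))) \<and> \<not> b ((f ^^ n) (i x)) \<and>
        (\<forall>j\<le>n. esize ((f ^^ j) (i x)) \<le> poly ([:2, 1:] + q + ql) (esize x)) \<and>
        (x, foldl (F x) (a x) (l x), []) = (f ^^ n) (i x)" for x
    proof (intro exI[of _ "length (l x)"] conjI)
      show "length (l x) \<le> poly ([:2, 1:] + q + ql) (esize x)"
        using length_le_esize[of "l x"] ql[of x] by simp
      show "\<forall>j\<le>length (l x). esize ((f ^^ j) (i x)) \<le> poly ([:2, 1:] + q + ql) (esize x)"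
      proof (intro allI impI)
        fix j
        show "esize ((f ^^ j) (i x)) \<le> poly ([:2, 1:] + q + ql) (esize x)"
          using ql[of x] esize_drop[of j "l x"] size[of x j] by (simp add: iter i_def)
      qed
    qed (auto simp: iter b_def i_def)
  qed
  from polytime_fst[OF polytime_snd[OF this]] show ?thesis by simp
qed

text \<open>If each step adds an amount that does not depend on the accumulator, sizes add up
  instead of compounding.\<close>

lemma polytime_foldl_additive:
  fixes q :: "nat poly"
  assumes F: "polytime (\<lambda>p. F (fst p) (fst (snd p)) (snd (snd p)))" and "polytime a" "polytime l"
    and size: "\<And>x c e. esize (F x c e) \<le> esize c + poly q (esize (x, e))"
  shows "polytime (\<lambda>x. foldl (F x) (a x) (l x))"
proof -
  obtain qa where qa: "\<And>x. esize (a x) \<le> poly qa (esize x)"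
    by (rule polytime_size[OF assms(2)]) blast
  obtain ql where ql: "\<And>x. esize (l x) \<le> poly ql (esize x)"
    by (rule polytime_size[OF assms(3)]) blast
  have *: "esize (foldl (F x) c es) \<le> esize c + length es * poly q M"
    if "\<And>e. e \<in> set es \<Longrightarrow> esize (x, e) \<le> M" for x c es M
    using that
  proof (induction es arbitrary: c)
    case (Cons e es)
    have "esize (foldl (F x) (F x c e) es) \<le> esize (F x c e) + length es * poly q M"
      using Cons by simp
    moreover have "poly q (esize (x, e)) \<le> poly q M"
      using Cons.prems poly_nat_mono by force
    ultimately show ?case using size[of x c e] by simp
  qed simp
  show ?thesis
  proof (rule polytime_foldl[OF assms(1-3), of "qa + ql * pcompose q ([:1, 1:] + ql)"])
    fix x n
    have "esize (foldl (F x) (a x) (take n (l x))) \<le> esize (a x) +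
        length (take n (l x)) * poly q (poly ([:1, 1:] + ql) (esize x))"
    proof (rule *)
      fix e assume "e \<in> set (take n (l x))"
      then have "esize e < esize (l x)" by (intro esize_mem) (rule in_set_takeD)
      then show "esize (x, e) \<le> poly ([:1, 1:] + ql) (esize x)" using ql[of x] by simp
    qed
    also have "length (take n (l x)) \<le> poly ql (esize x)"
      using ql[of x] length_le_esize[of "l x"] by simp
    finally show "esize (foldl (F x) (a x) (take n (l x))) \<le>
        poly (qa + ql * pcompose q ([:1, 1:] + ql)) (esize x)"
      using qa[of x] by (simp add: poly_pcompose algebra_simps add_mono)
  qed
qed

section \<open>Operations on lists and unary numbers\<close>

lemma polytime_rev [polytime_intros]:
  assumes "polytime l"
  shows "polytime (\<lambda>x. rev (l x))"
proof -
  have "polytime (\<lambda>x. foldl (\<lambda>c e. e # c) [] (l x))"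
    by (rule polytime_foldl_additive[where q = "[:1, 1:]"]) (intro polytime_intros assms | simp)+
  moreover have "foldl (\<lambda>c e. e # c) ys xs = rev xs @ ys" for xs ys :: "'b list"
    by (induction xs arbitrary: ys) auto
  ultimately show ?thesis by simp
qed

lemma polytime_map [polytime_intros]:
  assumes "polytime (\<lambda>p. h (fst p) (snd p))" "polytime l"
  shows "polytime (\<lambda>x. map (h x) (l x))"
proof -
  obtain q where q: "\<And>p. esize (h (fst p) (snd p)) \<le> poly q (esize p)"
    by (rule polytime_size[OF assms(1)]) blast
  have h: "polytime (\<lambda>p. h (f p) (g p))" if "polytime f" "polytime g" for f g
    using polytime_comp[OF assms(1), of "\<lambda>p. (f p, g p)"] that by (simp add: polytime_intros)
  have "polytime (\<lambda>x. foldl (\<lambda>c e. h x e # c) [] (l x))"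
  proof (rule polytime_foldl_additive[where q = "1 + q"])
    show "esize (h x e # c) \<le> esize c + poly (1 + q) (esize (x, e))" for x c e
      using q[of "(x, e)"] by simp
  qed (intro polytime_intros h assms)+
  moreover have "foldl (\<lambda>c e. h x e # c) ys xs = rev (map (h x) xs) @ ys" for x ys xs
    by (induction xs arbitrary: ys) auto
  ultimately have "polytime (\<lambda>x. rev (map (h x) (l x)))" by simp
  from polytime_rev[OF this] show ?thesis by (simp only: rev_rev_ident)
qed

lemma polytime_filter [polytime_intros]:
  assumes "polytime (\<lambda>p. h (fst p) (snd p))" "polytime l"
  shows "polytime (\<lambda>x. filter (h x) (l x))"
proof -
  have h: "polytime (\<lambda>p. h (f p) (g p))" if "polytime f" "polytime g" for f g
    using polytime_comp[OF assms(1), of "\<lambda>p. (f p, g p)"] that by (simp add: polytime_intros)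
  have "polytime (\<lambda>x. foldl (\<lambda>c e. if h x e then e # c else c) [] (l x))"
    by (rule polytime_foldl_additive[where q = "[:1, 1:]"]) (intro polytime_intros h assms | simp)+
  moreover have "foldl (\<lambda>c e. if h x e then e # c else c) ys xs = rev (filter (h x) xs) @ ys" for x ys xs
    by (induction xs arbitrary: ys) auto
  ultimately have "polytime (\<lambda>x. rev (filter (h x) (l x)))" by simp
  from polytime_rev[OF this] show ?thesis by (simp only: rev_rev_ident)
qed

lemma polytime_append [polytime_intros]:
  assumes "polytime f" "polytime g"
  shows "polytime (\<lambda>x. f x @ g x)"
proof -
  have "polytime (\<lambda>x. foldl (\<lambda>c e. e # c) (g x) (rev (f x)))"
    by (rule polytime_foldl_additive[where q = "[:1, 1:]"]) (intro polytime_intros assms | simp)+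
  moreover have "foldl (\<lambda>c e. e # c) ys xs = rev xs @ ys" for xs ys :: "'b list"
    by (induction xs arbitrary: ys) auto
  ultimately show ?thesis by simp
qed

lemma polytime_concat [polytime_intros]:
  assumes "polytime l"
  shows "polytime (\<lambda>x. concat (l x))"
proof -
  have "polytime (\<lambda>x. foldl (\<lambda>c e. c @ e) [] (l x))"
    by (rule polytime_foldl_additive[where q = "[:1, 1:]"]) (intro polytime_intros assms | simp)+
  moreover have "foldl (\<lambda>c e. c @ e) ys xs = ys @ concat xs" for xs and ys :: "'b list"
    by (induction xs arbitrary: ys) auto
  ultimately show ?thesis by simp
qed

lemma polytime_list_ex [polytime_intros]:
  assumes "polytime (\<lambda>p. h (fst p) (snd p))" "polytime l"
  shows "polytime (\<lambda>x. list_ex (h x) (l x))"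
proof -
  have "polytime (\<lambda>x. filter (h x) (l x) \<noteq> [])" by (intro polytime_intros assms)
  then show ?thesis by (simp add: filter_empty_conv list_ex_iff)
qed

lemma polytime_member [polytime_intros]:
  assumes "polytime f" "polytime l"
  shows "polytime (\<lambda>x. (f x :: dat) \<in> set (l x))"
proof -
  have f: "polytime (\<lambda>x. f (g x))" if "polytime g" for g
    by (rule polytime_comp[OF assms(1) that])
  have "polytime (\<lambda>x. list_ex (\<lambda>e. e = f x) (l x))" by (intro polytime_intros assms f)
  then show ?thesis by (simp add: list_ex_iff)
qed

lemma polytime_product [polytime_intros]:
  assumes "polytime f" "polytime g"
  shows "polytime (\<lambda>x. List.product (f x) (g x))"
proof -
  have g: "polytime (\<lambda>x. g (h x))" if "polytime h" for h
    by (rule polytime_comp[OF assms(2) that])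
  have "polytime (\<lambda>x. concat (map (\<lambda>e. map (\<lambda>e'. (e, e')) (g x)) (f x)))" by (intro polytime_intros assms g)
  then show ?thesis by (simp add: product_concat_map)
qed

text \<open>Numbers are encoded in unary, so \<open>n\<close> and the list of \<open>n\<close> units
  have the same encoding. Arithmetic thereby reduces to list operations.\<close>

lemma polytime_replicate_unit:
  assumes "polytime f"
  shows "polytime (\<lambda>x. replicate (f x) ())"
  by (rule polytime_comp[OF polytime_same_enc assms]) (simp add: enc_nat_def enc_list_def)

lemma polytime_Suc [polytime_intros]:
  assumes "polytime f"
  shows "polytime (\<lambda>x. Suc (f x))"
proof -
  have "polytime (\<lambda>x. () # replicate (f x) ())"
    by (intro polytime_intros polytime_replicate_unit assms)
  moreover have "polytime (length :: unit list \<Rightarrow> nat)"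
  proof (rule polytime_same_enc)
    show "enc (length xs) = enc xs" for xs :: "unit list" by (induction xs) auto
  qed
  ultimately have "polytime (\<lambda>x. length (() # replicate (f x) ()))" by (rule polytime_comp[rotated])
  then show ?thesis by simp
qed

lemma polytime_length [polytime_intros]:
  assumes "polytime l"
  shows "polytime (\<lambda>x. length (l x))"
proof -
  have "polytime (\<lambda>x. foldl (\<lambda>n e. Suc n) 0 (l x))"
    by (rule polytime_foldl_additive[where q = "1"]) (intro polytime_intros assms | simp)+
  moreover have "foldl (\<lambda>n e. Suc n) n xs = n + length xs" for n and xs :: "'b list"
    by (induction xs arbitrary: n) auto
  ultimately show ?thesis by simp
qed

lemma polytime_times [polytime_intros]:
  assumes "polytime f" "polytime g"
  shows "polytime (\<lambda>x. f x * g x :: nat)"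
proof -
  have "polytime (\<lambda>x. length (List.product (replicate (f x) ()) (replicate (g x) ())))"
    by (intro polytime_intros polytime_replicate_unit assms)
  then show ?thesis by simp
qed

lemma polytime_nat_le [polytime_intros]:
  assumes "polytime f" "polytime g"
  shows "polytime (\<lambda>x. (f x :: nat) \<le> g x)"
proof -
  \<comment> \<open>Truncated subtraction in unary: nothing is left after \<open>g x\<close>
    removals exactly if \<open>f x \<le> g x\<close>.\<close>
  have "polytime (\<lambda>x. foldl (\<lambda>c e. tl c) (replicate (f x) ()) (replicate (g x) ()) = [])"
    by (intro polytime_intros, rule polytime_foldl_additive[where q = "0"])
       (intro polytime_intros polytime_replicate_unit assms | simp add: esize_tl)+
  moreover have "foldl (\<lambda>c e. tl c) xs ys = drop (length ys) xs" for xs ys :: "unit list"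
    by (induction ys arbitrary: xs) (auto simp: drop_Suc)
  ultimately show ?thesis by simp
qed

lemma polytime_max [polytime_intros]:
  assumes "polytime f" "polytime g"
  shows "polytime (\<lambda>x. max (f x :: nat) (g x))"
  unfolding max_def by (intro polytime_intros assms)

section \<open>Recursion over nice tree decompositions\<close>

primrec ntd_fold :: "'b \<Rightarrow> ('a \<Rightarrow> 'b \<Rightarrow> 'b) \<Rightarrow> ('a \<Rightarrow> 'b \<Rightarrow> 'b) \<Rightarrow> ('b \<Rightarrow> 'b \<Rightarrow> 'b) \<Rightarrow> 'a ntd \<Rightarrow> 'b" where
  "ntd_fold l i f j Leaf = l"
| "ntd_fold l i f j (Introduce v t) = i v (ntd_fold l i f j t)"
| "ntd_fold l i f j (Forget v t) = f v (ntd_fold l i f j t)"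
| "ntd_fold l i f j (Join t u) = j (ntd_fold l i f j t) (ntd_fold l i f j u)"

text \<open>The instruction list of a stack machine that evaluates \<open>ntd_fold\<close>. Whole
  subtrees serve as instructions because they already have an encoding; only their root constructor
  is inspected. The right subtree comes first so that the value of the left one ends on top of the
  stack.\<close>

primrec postorder :: "'a ntd \<Rightarrow> 'a ntd list" where
  "postorder Leaf = [Leaf]"
| "postorder (Introduce v t) = postorder t @ [Introduce v t]"
| "postorder (Forget v t) = postorder t @ [Forget v t]"
| "postorder (Join l r) = postorder r @ postorder l @ [Join l r]"

lemma length_postorder: "length (postorder t) \<le> Suc (esize t)"
  by (induction t) auto

text \<open>A work list of pending subtrees is unfolded from the root. Each subtree taken off it is
  put in front of the output, so a root is emitted before its descendants and ends up behind them.
  \<open>res\<close> is the invariant and \<open>m\<close> the number of rounds left.\<close>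

lemma polytime_postorder:
  assumes "polytime t"
  shows "polytime (\<lambda>x. postorder (t x))"
proof -
  define b where "b = (\<lambda>s :: 'b ntd list \<times> 'b ntd list. fst s \<noteq> [])"
  define f :: "'b ntd list \<times> 'b ntd list \<Rightarrow> _" where
    "f = (\<lambda>s. case fst s of [] \<Rightarrow> s | t # ts \<Rightarrow>
      ((case t of Leaf \<Rightarrow> ts | Introduce v u \<Rightarrow> u # ts | Forget v u \<Rightarrow> u # ts | Join l r \<Rightarrow> l # r # ts),
       t # snd s))"
  define i where "i = (\<lambda>t :: 'b ntd. ([t], [] :: 'b ntd list))"
  define m where "m = (\<lambda>ts :: 'b ntd list. length (concat (map postorder ts)))"
  define res where "res = (\<lambda>s :: 'b ntd list \<times> 'b ntd list. concat (rev (map postorder (fst s))) @ snd s)"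
  have m: "m ts = 0 \<longleftrightarrow> ts = []" for ts
  proof (cases ts)
    case (Cons t us)
    then show ?thesis by (cases t) (auto simp: m_def)
  qed (simp add: m_def)
  \<comment> \<open>The work list never grows in size, and what a round outputs is no larger than
    it; this gives a quadratic bound on all states.\<close>
  have step: "m (fst (f s)) + 1 = m (fst s)" "esize (fst (f s)) \<le> esize (fst s)"
    "esize (snd (f s)) \<le> esize (snd s) + esize (fst s)" "res (f s) = res s" if "fst s \<noteq> []" for s
    using that by (cases s; auto simp: f_def m_def res_def neq_Nil_conv split: ntd.splits)+
  have iter: "m (fst ((f ^^ j) s)) + j = m (fst s) \<and> esize (fst ((f ^^ j) s)) \<le> esize (fst s) \<and>
      esize (snd ((f ^^ j) s)) \<le> esize (snd s) + j * esize (fst s) \<and> res ((f ^^ j) s) = res s"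
    if "j \<le> m (fst s)" for j s
    using that
  proof (induction j)
    case (Suc j)
    then have IH: "m (fst ((f ^^ j) s)) + j = m (fst s)" "esize (fst ((f ^^ j) s)) \<le> esize (fst s)"
      "esize (snd ((f ^^ j) s)) \<le> esize (snd s) + j * esize (fst s)" "res ((f ^^ j) s) = res s"
      by auto
    have "fst ((f ^^ j) s) \<noteq> []" using IH(1) Suc.prems m by (metis add_0 not_less_eq_eq order_refl)
    from step[OF this] IH show ?case by auto
  qed simp
  have "polytime (\<lambda>t :: 'b ntd. ([] :: 'b ntd list, postorder t))"
  proof (rule polytime_while[where b = b and f = f and i = i and q = "[:3, 1:] * [:2, 1:] + [:3, 1:]"])
    show "polytime b" unfolding b_def by (intro polytime_intros)
    show "polytime f" unfolding f_def by (intro polytime_intros)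
    show "polytime i" unfolding i_def by (intro polytime_intros)
    fix t :: "'b ntd"
    define N where "N = m [t]"
    have N: "N \<le> Suc (esize t)" unfolding N_def m_def using length_postorder by simp
    show "\<exists>n\<le>poly ([:3, 1:] * [:2, 1:] + [:3, 1:]) (esize t). (\<forall>j<n. b ((f ^^ j) (i t))) \<and>
        \<not> b ((f ^^ n) (i t)) \<and>
        (\<forall>j\<le>n. esize ((f ^^ j) (i t)) \<le> poly ([:3, 1:] * [:2, 1:] + [:3, 1:]) (esize t)) \<and>
        ([], postorder t) = (f ^^ n) (i t)"
    proof (intro exI[of _ N] conjI allI impI)
      show "N \<le> poly ([:3, 1:] * [:2, 1:] + [:3, 1:]) (esize t)"
        using N by (simp add: distrib_left)
      fix j assume "j < N"
      then show "b ((f ^^ j) (i t))"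
        using iter[of j "i t"] m[of "fst ((f ^^ j) (i t))"] by (auto simp: b_def N_def i_def)
    next
      have 0: "fst ((f ^^ N) (i t)) = []"
        using iter[of N "i t"] m[of "fst ((f ^^ N) (i t))"] by (simp add: N_def i_def)
      then show "\<not> b ((f ^^ N) (i t))" by (simp add: b_def)
      show "([], postorder t) = (f ^^ N) (i t)"
        using iter[of N "i t"] 0 by (simp add: N_def i_def res_def prod_eq_iff)
    next
      fix j assume j: "j \<le> N"
      have "esize (fst ((f ^^ j) (i t))) \<le> Suc (esize t)"
        "esize (snd ((f ^^ j) (i t))) \<le> j * Suc (esize t)"
        using iter[of j "i t"] j by (auto simp: N_def i_def)
      moreover have "j * Suc (esize t) \<le> Suc (esize t) * Suc (esize t)"
        using j N by (intro mult_right_mono) auto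
      ultimately show "esize ((f ^^ j) (i t)) \<le> poly ([:3, 1:] * [:2, 1:] + [:3, 1:]) (esize t)"
        by (simp add: enc_prod_def algebra_simps)
    qed
  qed
  from polytime_comp[OF polytime_snd[OF this] assms] show ?thesis by simp
qed

text \<open>The size hypothesis ranges over all trees \<open>u\<close> because the values at all
  subtrees pass over the stack.\<close>

lemma polytime_ntd_fold:
  fixes q :: "nat poly" and L :: "'x::enc \<Rightarrow> 'b::enc" and t :: "'x \<Rightarrow> 'a::enc ntd"
  assumes L: "polytime L" and I: "polytime (\<lambda>p. I (fst p) (fst (snd p)) (snd (snd p)))"
    and F: "polytime (\<lambda>p. F (fst p) (fst (snd p)) (snd (snd p)))"
    and J: "polytime (\<lambda>p. J (fst p) (fst (snd p)) (snd (snd p)))" and "polytime t"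
    and size: "\<And>x u. esize (ntd_fold (L x) (I x) (F x) (J x) u) \<le> poly q (esize (x, u))"
  shows "polytime (\<lambda>x. ntd_fold (L x) (I x) (F x) (J x) (t x))"
proof -
  define step where "step = (\<lambda>x st u. case u of Leaf \<Rightarrow> L x # st
    | Introduce v _ \<Rightarrow> (case st of [] \<Rightarrow> [] | a # st' \<Rightarrow> I x v a # st')
    | Forget v _ \<Rightarrow> (case st of [] \<Rightarrow> [] | a # st' \<Rightarrow> F x v a # st')
    | Join _ _ \<Rightarrow> (case st of [] \<Rightarrow> [] | a # st' \<Rightarrow> (case st' of [] \<Rightarrow> [] | b # st'' \<Rightarrow> J x a b # st'')))"
  define val where "val = (\<lambda>x. ntd_fold (L x) (I x) (F x) (J x))"
  have whole: "foldl (step x) st (postorder u) = val x u # st" for x st u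
    by (induction u arbitrary: st) (simp_all add: step_def val_def)
  \<comment> \<open>At any moment the stack holds the values of disjoint subtrees. Their total size
    is therefore at most that of the whole tree, which bounds the stack.\<close>
  have prefix: "\<exists>us. foldl (step x) st (take n (postorder u)) = map (val x) us @ st \<and>
      sum_list (map (\<lambda>u. Suc (esize u)) us) \<le> Suc (esize u)" for x st n u
  proof (induction u arbitrary: st n)
    case Leaf
    show ?case
      by (cases n) (auto simp: step_def val_def intro: exI[of _ "[]"] exI[of _ "[Leaf]"])
  next
    case (Introduce v u)
    show ?case
    proof (cases "n \<le> length (postorder u)")
      case True
      with Introduce[of st n] show ?thesis by force
    next
      case False
      then have "take n (postorder (Introduce v u)) = postorder (Introduce v u)" by simp
      then show ?thesis using whole by (intro exI[of _ "[Introduce v u]"]) (simp del: postorder.simps)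
    qed
  next
    case (Forget v u)
    show ?case
    proof (cases "n \<le> length (postorder u)")
      case True
      with Forget[of st n] show ?thesis by force
    next
      case False
      then have "take n (postorder (Forget v u)) = postorder (Forget v u)" by simp
      then show ?thesis using whole by (intro exI[of _ "[Forget v u]"]) (simp del: postorder.simps)
    qed
  next
    case (Join l r)
    consider "n \<le> length (postorder r)" | k where "n = length (postorder r) + k" "k \<le> length (postorder l)"
      | "n > length (postorder r) + length (postorder l)"
      by (metis le_add_diff_inverse linorder_not_le nat_add_left_cancel_less nat_le_linear)
    then show ?case
    proof cases
      case 1
      with Join(2)[of st n] show ?thesis by force
    next
      case 2
      obtain us where "foldl (step x) (val x r # st) (take k (postorder l)) = map (val x) us @ val x r # st"
        "sum_list (map (\<lambda>u. Suc (esize u)) us) \<le> Suc (esize l)"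
        using Join(1) by blast
      then show ?thesis using 2 whole by (intro exI[of _ "us @ [r]"]) simp
    next
      case 3
      then have "take n (postorder (Join l r)) = postorder (Join l r)" by simp
      then show ?thesis using whole by (intro exI[of _ "[Join l r]"]) (simp del: postorder.simps)
    qed
  qed
  have I': "polytime (\<lambda>p. I (f p) (g p) (h p))" if "polytime f" "polytime g" "polytime h" for f g h
    using polytime_comp[OF I, of "\<lambda>p. (f p, g p, h p)"] that by (simp add: polytime_intros)
  have F': "polytime (\<lambda>p. F (f p) (g p) (h p))" if "polytime f" "polytime g" "polytime h" for f g h
    using polytime_comp[OF F, of "\<lambda>p. (f p, g p, h p)"] that by (simp add: polytime_intros)
  have J': "polytime (\<lambda>p. J (f p) (g p) (h p))" if "polytime f" "polytime g" "polytime h" for f g h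
    using polytime_comp[OF J, of "\<lambda>p. (f p, g p, h p)"] that by (simp add: polytime_intros)
  have L': "polytime (\<lambda>p. L (f p))" if "polytime f" for f
    by (rule polytime_comp[OF L that])
  obtain qt where qt: "\<And>x. esize (t x) \<le> poly qt (esize x)"
    by (rule polytime_size[OF assms(5)]) blast
  have "polytime (\<lambda>x. foldl (step x) [] (postorder (t x)))"
  proof (rule polytime_foldl[where q = "(1 + qt) * (1 + pcompose q ([:1, 1:] + qt))"])
    show "polytime (\<lambda>p. step (fst p) (fst (snd p)) (snd (snd p)))"
      unfolding step_def by (intro polytime_intros I' F' J' L')
    show "polytime (\<lambda>x. postorder (t x))" by (intro polytime_postorder assms)
    fix x n
    obtain us where us: "foldl (step x) [] (take n (postorder (t x))) = map (val x) us"
      "sum_list (map (\<lambda>u. Suc (esize u)) us) \<le> Suc (esize (t x))"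
      using prefix[of x "[]" n "t x"] by auto
    have "esize (map (val x) us) \<le> sum_list (map (\<lambda>u. Suc (esize u)) us) * (1 + poly q (esize (x, t x)))"
      if "sum_list (map (\<lambda>u. Suc (esize u)) us) \<le> Suc (esize (t x))" for us
      using that
    proof (induction us)
      case (Cons u us)
      then have "esize (x, u) \<le> esize (x, t x)" by simp
      then have "poly q (esize (x, u)) \<le> poly q (esize (x, t x))" by (rule poly_nat_mono)
      with size[of x u] have "esize (val x u) \<le> poly q (esize (x, t x))"
        unfolding val_def by linarith
      moreover have "esize (map (val x) us) \<le> sum_list (map (\<lambda>u. Suc (esize u)) us) * (1 + poly q (esize (x, t x)))"
        using Cons by simp
      ultimately show ?case by (simp add: algebra_simps)
    qed simp
    moreover have "sum_list (map (\<lambda>u. Suc (esize u)) us) * (1 + poly q (esize (x, t x))) \<le>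
        (1 + poly qt (esize x)) * (1 + poly q (poly ([:1, 1:] + qt) (esize x)))"
    proof (intro mult_mono add_mono order_refl)
      show "sum_list (map (\<lambda>u. Suc (esize u)) us) \<le> 1 + poly qt (esize x)"
        using us(2) qt[of x] by simp
      show "poly q (esize (x, t x)) \<le> poly q (poly ([:1, 1:] + qt) (esize x))"
        by (rule poly_nat_mono) (use qt[of x] in simp)
    qed auto
    ultimately show "esize (foldl (step x) [] (take n (postorder (t x)))) \<le>
        poly ((1 + qt) * (1 + pcompose q ([:1, 1:] + qt))) (esize x)"
      using us by (fastforce simp add: poly_pcompose)
  qed (intro polytime_intros)
  then have "polytime (\<lambda>x. case foldl (step x) [] (postorder (t x)) of [] \<Rightarrow> L x | a # _ \<Rightarrow> a)"
    by (intro polytime_intros L)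
  then show ?thesis by (simp add: whole val_def)
qed

text \<open>The hypothesis on the oracle holds if it answers every query with a vertex subset of the queried
  graph.\<close>

lemma exec_map_query:
  obtains P and q :: "nat poly" where
    "\<And>orc c ds. (\<And>d. d \<in> set ds \<Longrightarrow> size (orc d) \<le> size d) \<Longrightarrow>
       \<exists>t. exec orc P (enc (c :: dat, ds)) (enc (c, rev (map orc ds))) t (set ds) \<and>
         t \<le> poly q (esize (c, ds))"
proof -
  let ?st = "\<lambda>(c :: dat) (ds :: dat list) (as :: dat list). (c, ds, as)"
  have "polytime (\<lambda>s :: dat \<times> dat list. (fst s, snd s, [] :: dat list))" by (intro polytime_intros)
  then obtain Pi Ti qi where i: "\<And>orc s. exec orc Pi (enc (s :: dat \<times> dat list)) (enc (fst s, snd s, [] :: dat list)) (Ti orc s) {}"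
    "\<And>orc s. Ti orc s \<le> poly qi (esize (s :: dat \<times> dat list))"
    "\<And>s. esize (fst s, snd s, [] :: dat list) \<le> poly qi (esize (s :: dat \<times> dat list))"
    by (rule polytimeE) blast
  have "polytime (\<lambda>s :: dat \<times> dat list \<times> dat list. fst (snd s) \<noteq> [])" by (intro polytime_intros)
  then obtain Pb Tb qb where b: "\<And>orc s. exec orc Pb (enc (s :: dat \<times> dat list \<times> dat list)) (enc (fst (snd s) \<noteq> [])) (Tb orc s) {}"
    "\<And>orc s. Tb orc s \<le> poly qb (esize (s :: dat \<times> dat list \<times> dat list))"
    by (rule polytimeE) blast
  have "polytime (\<lambda>s :: dat \<times> dat list \<times> dat list. fst s)" by (intro polytime_intros)
  then obtain Pc Tc qc where c: "\<And>orc s. exec orc Pc (enc (s :: dat \<times> dat list \<times> dat list)) (enc (fst s)) (Tc orc s) {}"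
    "\<And>orc s. Tc orc s \<le> poly qc (esize (s :: dat \<times> dat list \<times> dat list))"
    by (rule polytimeE) blast
  have "polytime (\<lambda>s :: dat \<times> dat list \<times> dat list. tl (fst (snd s)))" by (intro polytime_intros)
  then obtain Pt Tt qt where t: "\<And>orc s. exec orc Pt (enc (s :: dat \<times> dat list \<times> dat list)) (enc (tl (fst (snd s)))) (Tt orc s) {}"
    "\<And>orc s. Tt orc s \<le> poly qt (esize (s :: dat \<times> dat list \<times> dat list))"
    by (rule polytimeE) blast
  have "polytime (\<lambda>s :: dat \<times> dat list \<times> dat list. case fst (snd s) of [] \<Rightarrow> Null | d # _ \<Rightarrow> d)" by (intro polytime_intros)
  then obtain Ph Th qh where h: "\<And>orc s. exec orc Ph (enc (s :: dat \<times> dat list \<times> dat list)) (enc (case fst (snd s) of [] \<Rightarrow> Null | d # _ \<Rightarrow> d)) (Th orc s) {}"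
    "\<And>orc s. Th orc s \<le> poly qh (esize (s :: dat \<times> dat list \<times> dat list))"
    by (rule polytimeE) blast
  have "polytime (\<lambda>s :: dat \<times> dat list \<times> dat list. snd (snd s))" by (intro polytime_intros)
  then obtain Pa Ta qa where a: "\<And>orc s. exec orc Pa (enc (s :: dat \<times> dat list \<times> dat list)) (enc (snd (snd s))) (Ta orc s) {}"
    "\<And>orc s. Ta orc s \<le> poly qa (esize (s :: dat \<times> dat list \<times> dat list))"
    by (rule polytimeE) blast
  have "polytime (\<lambda>s :: dat \<times> dat list \<times> dat list. (fst s, snd (snd s)))" by (intro polytime_intros)
  then obtain Pf Tf qf where f: "\<And>orc s. exec orc Pf (enc (s :: dat \<times> dat list \<times> dat list)) (enc (fst s, snd (snd s))) (Tf orc s) {}"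
    "\<And>orc s. Tf orc s \<le> poly qf (esize (s :: dat \<times> dat list \<times> dat list))"
    by (rule polytimeE) blast
  \<comment> \<open>The state is \<open>(c, ds, as)\<close>: one round moves the head of
    \<open>ds\<close>, replaced by its answer, to the front of \<open>as\<close>. Hence the answers
    come out in reverse order.\<close>
  define body where "body = PPair Pc (PPair Pt (PPair (PSeq Ph PQuery) Pa))"
  define qq where "qq = [:7, 1:] + qb + qc + qt + qh + qa"
  have loop: "\<exists>k. exec orc (PWhile Pb body) (enc (c, ds, as)) (enc (c, [] :: dat list, rev (map orc ds) @ as)) k (set ds) \<and>
      k \<le> Suc (length ds) * poly qq S"
    if "\<And>d. d \<in> set ds \<Longrightarrow> size (orc d) \<le> size d" "esize (c, ds, as) \<le> S"
    for orc and c :: dat and ds as :: "dat list" and S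
    using that
  proof (induction ds arbitrary: as)
    case Nil
    let ?s = "(c, [] :: dat list, as)"
    have "exec orc (PWhile Pb body) (enc ?s) (enc ?s) (Suc (Tb orc ?s + esize ?s)) {}"
      by (rule exec.WhileFalse[OF b(1)]) simp
    moreover have "Tb orc ?s \<le> poly qb S"
      by (rule poly_nat_mono_trans[OF b(2)]) (use Nil in simp)
    ultimately show ?case using Nil
      by (intro exI[of _ "Suc (Tb orc ?s + esize ?s)"]) (simp add: qq_def)
  next
    case (Cons d ds)
    let ?s = "(c, d # ds, as)"
    have d: "size (orc d) \<le> size d" using Cons.prems by simp
    \<comment> \<open>An answer no larger than its query does not enlarge the state, so
      \<open>S\<close> bounds the whole run.\<close>
    then have "esize (c, ds, orc d # as) \<le> S" using Cons.prems(2) by simp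
    with Cons obtain k where k: "exec orc (PWhile Pb body) (enc (c, ds, orc d # as))
        (enc (c, [] :: dat list, rev (map orc ds) @ orc d # as)) k (set ds)"
      "k \<le> Suc (length ds) * poly qq S"
      by (metis list.set_intros(2))
    define T where "T = Suc (Tc orc ?s + Suc (Tt orc ?s + Suc (Suc (Th orc ?s + 1) + Ta orc ?s)))"
    have "exec orc body (enc ?s) (Dot (enc (fst ?s)) (Dot (enc (tl (fst (snd ?s))))
        (Dot (orc d) (enc (snd (snd ?s)))))) T ({} \<union> ({} \<union> (({} \<union> {d}) \<union> {})))"
      unfolding body_def T_def
      by (rule exec.Pair[OF c(1)], rule exec.Pair[OF t(1)], rule exec.Pair[OF _ a(1)],
          rule exec.Seq[OF _ exec.Query]) (use h(1)[of orc ?s] in simp)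
    then have body: "exec orc body (enc ?s) (enc (c, ds, orc d # as)) T {d}" by simp
    have "exec orc (PWhile Pb body) (enc ?s) (enc (c, [] :: dat list, rev (map orc ds) @ orc d # as))
        (Suc (Tb orc ?s + T + k)) ({} \<union> {d} \<union> set ds)"
      by (rule exec.WhileTrue[OF b(1) _ body k(1)]) simp
    moreover have "Tb orc ?s \<le> poly qb S" "Tc orc ?s \<le> poly qc S" "Tt orc ?s \<le> poly qt S"
      "Th orc ?s \<le> poly qh S" "Ta orc ?s \<le> poly qa S"
      using Cons.prems(2) b(2) c(2) t(2) h(2) a(2) poly_nat_mono_trans by blast+
    then have "Suc (Tb orc ?s + T) \<le> poly qq S" by (simp add: T_def qq_def)
    ultimately show ?case using k(2)
      by (intro exI[of _ "Suc (Tb orc ?s + T + k)"]) simp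
  qed
  show thesis
  proof (rule that[of "PSeq Pi (PSeq (PWhile Pb body) Pf)"
        "[:2:] + qi + ([:1, 1:]) * pcompose qq qi + pcompose qf (qi + [:2, 1:])"])
    fix orc :: "dat \<Rightarrow> dat" and c :: dat and ds :: "dat list"
    assume ds: "\<And>d. d \<in> set ds \<Longrightarrow> size (orc d) \<le> size d"
    define S where "S = esize (c, ds, [] :: dat list)"
    obtain k where k: "exec orc (PWhile Pb body) (enc (c, ds, [] :: dat list)) (enc (c, [] :: dat list, rev (map orc ds))) k (set ds)"
      "k \<le> Suc (length ds) * poly qq S"
      using loop[OF ds, where c = c and as = "[]" and S = S] S_def by auto
    let ?e = "(c, [] :: dat list, rev (map orc ds))"
    let ?T = "Suc (Ti orc (c, ds) + Suc (k + Tf orc ?e))"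
    have "exec orc (PSeq Pi (PSeq (PWhile Pb body) Pf)) (enc (c, ds)) (enc (fst ?e, snd (snd ?e)))
        ?T ({} \<union> (set ds \<union> {}))"
      by (rule exec.Seq[OF i(1)], rule exec.Seq[OF _ f(1)]) (use k(1) in simp)
    then have "exec orc (PSeq Pi (PSeq (PWhile Pb body) Pf)) (enc (c, ds)) (enc (c, rev (map orc ds)))
        ?T (set ds)"
      by simp
    moreover have "?T \<le> poly ([:2:] + qi + ([:1, 1:]) * pcompose qq qi + pcompose qf (qi + [:2, 1:])) (esize (c, ds))"
    proof -
      have S: "S \<le> poly qi (esize (c, ds))" using i(3)[of "(c, ds)"] by (simp add: S_def)
      have "k \<le> Suc (esize (c, ds)) * poly qq (poly qi (esize (c, ds)))"
        by (rule order_trans[OF k(2)], rule mult_mono)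
           (use length_le_esize[of ds] poly_nat_mono[OF S] in auto)
      moreover have "esize (map orc ds) \<le> esize ds" using ds
        by (induction ds) (auto intro: add_mono)
      then have "Tf orc ?e \<le> poly qf (poly (qi + [:2, 1:]) (esize (c, ds)))"
        by (intro poly_nat_mono_trans[OF f(2)]) simp
      ultimately show ?thesis using i(2)[of orc "(c, ds)"] by (simp add: poly_pcompose)
    qed
    ultimately show "\<exists>t. exec orc (PSeq Pi (PSeq (PWhile Pb body) Pf)) (enc (c, ds)) (enc (c, rev (map orc ds))) t (set ds) \<and>
        t \<le> poly ([:2:] + qi + ([:1, 1:]) * pcompose qq qi + pcompose qf (qi + [:2, 1:])) (esize (c, ds))"
      by blast
  qed
qed

section \<open>Recursive structure of nice tree decompositions\<close>

lemma rtranclp_imp: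
  assumes "r\<^sup>*\<^sup>* x y" "\<And>x y. r x y \<Longrightarrow> s x y"
  shows "s\<^sup>*\<^sup>* x y"
  using assms(1) by induction (auto intro: rtranclp.rtrancl_into_rtrancl assms(2))

lemma ntd_subtree_Join [simp]:
  "ntd_subtree (Join l r) (False # p) = ntd_subtree l p"
  "ntd_subtree (Join l r) (True # p) = ntd_subtree r p"
  by simp_all

declare ntd_subtree.simps(5) [simp del]

lemma ntd_bag_simps [simp]:
  "ntd_bag t [] = root_bag t"
  "ntd_bag (Introduce v t) (b # p) = ntd_bag t p"
  "ntd_bag (Forget v t) (b # p) = ntd_bag t p"
  "ntd_bag (Join l r) (False # p) = ntd_bag l p"
  "ntd_bag (Join l r) (True # p) = ntd_bag r p"
  by (cases t) (simp_all add: ntd_bag_def)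

lemma Nil_in_ntd_nodes [simp]: "[] \<in> ntd_nodes t"
  by (cases t) auto

lemma finite_ntd_nodes [simp]: "finite (ntd_nodes t)"
  by (induction t) auto

definition covered_set :: "'a ntd \<Rightarrow> 'a set" where
  "covered_set t = (\<Union>p\<in>ntd_nodes t. ntd_bag t p)"

lemma root_bag_subset: "root_bag t \<subseteq> covered_set t"
  unfolding covered_set_def by (metis Nil_in_ntd_nodes UN_upper ntd_bag_simps(1))

lemma covered_set_simps [simp]:
  "covered_set Leaf = {}"
  "covered_set (Introduce v t) = insert v (covered_set t)"
  "covered_set (Forget v t) = covered_set t"
  "ntd_wf (Join l r) \<Longrightarrow> covered_set (Join l r) = covered_set l \<union> covered_set r"
  using root_bag_subset[of t] root_bag_subset[of l] unfolding covered_set_def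
  by (auto simp: UN_Un image_iff)

lemma finite_root_bag [simp]: "finite (root_bag t)"
  by (induction t) auto

lemma finite_covered_set [simp]: "finite (covered_set t)"
  unfolding covered_set_def ntd_bag_def by simp

text \<open>A substitute for adjacency that depends on the decomposition alone: the ends of every
  edge share a bag. The invariant of the cutting procedure can thus be stated for subtrees without
  mentioning a graph.\<close>

definition share_bag :: "'a ntd \<Rightarrow> 'a \<Rightarrow> 'a \<Rightarrow> bool" where
  "share_bag t u v \<longleftrightarrow> (\<exists>p\<in>ntd_nodes t. u \<in> ntd_bag t p \<and> v \<in> ntd_bag t p)"

lemma share_bag_simps [simp]:
  "\<not> share_bag Leaf u v"
  "share_bag (Introduce x t) u v \<longleftrightarrow> share_bag t u v \<or> {u, v} \<subseteq> insert x (root_bag t)"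
  "share_bag (Forget x t) u v \<longleftrightarrow> share_bag t u v"
  "ntd_wf (Join l r) \<Longrightarrow> share_bag (Join l r) u v \<longleftrightarrow> share_bag l u v \<or> share_bag r u v"
proof -
  have *: "u \<in> root_bag t \<Longrightarrow> v \<in> root_bag t \<Longrightarrow> share_bag t u v" for t
    unfolding share_bag_def by (intro bexI[of _ "[]"]) auto
  show "\<not> share_bag Leaf u v" "share_bag (Forget x t) u v \<longleftrightarrow> share_bag t u v"
    using *[of t] by (auto simp: share_bag_def)
  show "share_bag (Introduce x t) u v \<longleftrightarrow> share_bag t u v \<or> {u, v} \<subseteq> insert x (root_bag t)"
    by (auto simp: share_bag_def)
  assume "ntd_wf (Join l r)"
  then show "share_bag (Join l r) u v \<longleftrightarrow> share_bag l u v \<or> share_bag r u v"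
    using *[of l] by (auto simp: share_bag_def bex_Un)
qed

lemma share_bag_covered: "share_bag t u v \<Longrightarrow> u \<in> covered_set t \<and> v \<in> covered_set t"
  unfolding share_bag_def covered_set_def by auto

text \<open>What remains of the connectedness condition of tree decompositions when only the recursive
  structure is kept.\<close>

primrec separating :: "'a ntd \<Rightarrow> bool" where
  "separating Leaf \<longleftrightarrow> True"
| "separating (Introduce v t) \<longleftrightarrow> v \<notin> covered_set t \<and> separating t"
| "separating (Forget v t) \<longleftrightarrow> separating t"
| "separating (Join l r) \<longleftrightarrow> covered_set l \<inter> covered_set r \<subseteq> root_bag l \<and> separating l \<and> separating r"

definition trace_connected :: "'a ntd \<Rightarrow> 'a \<Rightarrow> bool" where
  "trace_connected t v \<longleftrightarrow> (\<forall>p q. p \<in> ntd_nodes t \<longrightarrow> q \<in> ntd_nodes t \<longrightarrow> v \<in> ntd_bag t p \<longrightarrow> v \<in> ntd_bag t q \<longrightarrow>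
     (\<lambda>p q. adj (ntd_tree t) p q \<and> v \<in> ntd_bag t p \<and> v \<in> ntd_bag t q)\<^sup>*\<^sup>* p q)"

lemma adj_ntd_tree: "adj (ntd_tree t) p q \<longleftrightarrow>
    (\<exists>b. q = p @ [b] \<and> q \<in> ntd_nodes t) \<or> (\<exists>b. p = q @ [b] \<and> p \<in> ntd_nodes t)"
  unfolding adj_def ntd_tree_def by (auto simp: doubleton_eq_iff)

lemma trace_connectedI:
  assumes "connected_graph (induced (ntd_tree t) {p \<in> ntd_nodes t. v \<in> ntd_bag t p})"
  shows "trace_connected t v"
proof -
  have "(\<lambda>p q. adj (ntd_tree t) p q \<and> v \<in> ntd_bag t p \<and> v \<in> ntd_bag t q)\<^sup>*\<^sup>* p q"
    if "(adj (induced (ntd_tree t) {p \<in> ntd_nodes t. v \<in> ntd_bag t p}))\<^sup>*\<^sup>* p q" for p q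
    by (rule rtranclp_imp[OF that]) (auto simp: adj_def induced_def)
  then show ?thesis
    using assms unfolding trace_connected_def connected_graph_def by (auto simp: induced_def)
qed

text \<open>A path can leave the nodes below the child \<open>b\<close> of the root only through that child.\<close>

lemma trace_connected_child:
  assumes conn: "trace_connected t v"
    and nodes: "\<And>p. b # p \<in> ntd_nodes t \<longleftrightarrow> p \<in> ntd_nodes u"
    and bag: "\<And>p. ntd_bag t (b # p) = ntd_bag u p"
  shows "trace_connected u v"
  unfolding trace_connected_def
proof (intro allI impI)
  fix p q assume pq: "p \<in> ntd_nodes u" "q \<in> ntd_nodes u" "v \<in> ntd_bag u p" "v \<in> ntd_bag u q"
  let ?R = "\<lambda>t p q. adj (ntd_tree t) p q \<and> v \<in> ntd_bag t p \<and> v \<in> ntd_bag t q"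
  have "(?R t)\<^sup>*\<^sup>* (b # p) (b # q)"
    using conn pq nodes bag unfolding trace_connected_def by blast
  \<comment> \<open>Invariant along the walk: at a node below \<open>b\<close>, that node is
    reachable within the subtree; elsewhere, the root of the subtree is, since the walk must have
    left through it.\<close>
  then have "(case b # q of c # r \<Rightarrow> if c = b then (?R u)\<^sup>*\<^sup>* p r else (?R u)\<^sup>*\<^sup>* p []
      | [] \<Rightarrow> (?R u)\<^sup>*\<^sup>* p [])"
  proof (induction rule: rtranclp_induct)
    case (step y z)
    show ?case
    proof (cases "\<exists>y' z'. y = b # y' \<and> z = b # z'")
      case True
      then obtain y' z' where yz: "y = b # y'" "z = b # z'" by blast
      then have "?R u y' z'" using step(2) nodes bag by (auto simp: adj_ntd_tree)
      with step(3) yz show ?thesis by (simp add: rtranclp.rtrancl_into_rtrancl)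
    next
      case False
      have "(?R u)\<^sup>*\<^sup>* p []"
      proof (cases "\<exists>y'. y = b # y'")
        case True
        then obtain y' where "y = b # y'" by blast
        moreover from this have "y' = []" using step(2) False
          by (auto simp: adj_ntd_tree Cons_eq_append_conv)
        ultimately show ?thesis using step(3) by simp
      next
        case False
        then show ?thesis using step(3) by (auto split: list.splits if_splits)
      qed
      moreover have "z = b # z' \<Longrightarrow> z' = []" for z'
        using False step(2) by (auto simp: adj_ntd_tree Cons_eq_append_conv)
      ultimately show ?thesis by (auto split: list.splits)
    qed
  qed simp
  then show "(?R u)\<^sup>*\<^sup>* p q" by simp
qed

text \<open>A walk that leaves the part below child \<open>b\<close> uses the edge between that
  child and the root, so \<open>v\<close> lies in both bags. For \<open>Introduce\<close> this
  contradicts freshness, for \<open>Join\<close> it puts common vertices into the bag.\<close>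

lemma trace_connected_root:
  assumes conn: "trace_connected t v" and "b # p \<in> ntd_nodes t" "v \<in> ntd_bag t (b # p)"
    and "q \<in> ntd_nodes t" "v \<in> ntd_bag t q" "\<And>q'. q \<noteq> b # q'"
  shows "v \<in> ntd_bag t [] \<and> v \<in> ntd_bag t [b]"
proof -
  let ?R = "\<lambda>p q. adj (ntd_tree t) p q \<and> v \<in> ntd_bag t p \<and> v \<in> ntd_bag t q"
  have "?R\<^sup>*\<^sup>* (b # p) q" using assms unfolding trace_connected_def by blast
  then have "(\<exists>q'. q = b # q') \<or> v \<in> ntd_bag t [] \<and> v \<in> ntd_bag t [b]"
    by (induction rule: rtranclp_induct) (auto simp: adj_ntd_tree Cons_eq_append_conv)
  then show ?thesis using assms by blast
qed

lemma separating_if_trace_connected: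
  "ntd_wf t \<Longrightarrow> (\<And>v. trace_connected t v) \<Longrightarrow> separating t"
proof (induction t)
  case (Introduce x t)
  have "trace_connected t v" for v
    by (rule trace_connected_child[OF Introduce.prems(2), where b = False]) auto
  moreover have "x \<notin> covered_set t"
  proof
    assume "x \<in> covered_set t"
    then obtain p where "p \<in> ntd_nodes t" "x \<in> ntd_bag t p" unfolding covered_set_def by blast
    then have "x \<in> root_bag t"
      using trace_connected_root[OF Introduce.prems(2), of False p x "[]"] by simp
    then show False using Introduce.prems(1) by simp
  qed
  ultimately show ?case using Introduce by simp
next
  case (Forget x t)
  have "trace_connected t v" for v
    by (rule trace_connected_child[OF Forget.prems(2), where b = False]) auto
  then show ?case using Forget by simp
next
  case (Join l r)
  have "trace_connected l v" for v
    by (rule trace_connected_child[OF Join.prems(2), where b = False]) auto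
  moreover have "trace_connected r v" for v
    by (rule trace_connected_child[OF Join.prems(2), where b = True]) auto
  moreover have "v \<in> root_bag l" if v: "v \<in> covered_set l" "v \<in> covered_set r" for v
  proof -
    obtain p q where "p \<in> ntd_nodes l" "v \<in> ntd_bag l p" "q \<in> ntd_nodes r" "v \<in> ntd_bag r q"
      using v unfolding covered_set_def by blast
    then show ?thesis
      using trace_connected_root[OF Join.prems(2), of False p v "True # q"] by simp
  qed
  ultimately show ?case using Join by auto
qed simp

text \<open>The interface to what follows: the tree conditions are traded for
  \<open>separating\<close>, which fits induction over the decomposition.\<close>

lemma nice_tree_decompositionD:
  assumes "nice_tree_decomposition G t"
  shows "ntd_wf t" "root_bag t = {}" "separating t" "covered_set t = verts G"
    "\<And>u v. adj G u v \<Longrightarrow> share_bag t u v"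
proof -
  have td: "ntd_wf t" "root_bag t = {}" "tree_decomposition G (ntd_tree t) (ntd_bag t)"
    using assms unfolding nice_tree_decomposition_def by auto
  then show "ntd_wf t" "root_bag t = {}" by auto
  show cov: "covered_set t = verts G"
    using td(3) unfolding tree_decomposition_def covered_set_def ntd_tree_def by simp
  show "share_bag t u v" if "adj G u v" for u v
    using td(3) that unfolding tree_decomposition_def share_bag_def ntd_tree_def adj_def by fastforce
  have "trace_connected t v" for v
  proof (cases "v \<in> verts G")
    case True
    then show ?thesis
      using td(3) unfolding tree_decomposition_def
      by (intro trace_connectedI) (simp add: ntd_tree_def)
  next
    case False
    then show ?thesis unfolding trace_connected_def cov[symmetric] covered_set_def by blast
  qed
  then show "separating t" using td(1) separating_if_trace_connected by blast
qed

section \<open>Cutting a graph into pieces\<close>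

lemma share_bag_coveredD: "share_bag t u v \<Longrightarrow> u \<in> covered_set t"
  using share_bag_covered by metis

text \<open>The components \<open>(B, W, A, P)\<close> are the current bag, the vertices not yet
  retired, the bags of the cuts directly below, and the finished pieces, each with its
  boundary.\<close>

type_synonym 'a split_state = "'a list \<times> 'a list \<times> 'a list \<times> ('a list \<times> 'a list) list"

text \<open>After a cut the bag has three roles: it is still the current bag, it is all that is kept
  of \<open>W\<close>, and it starts the boundary of the next piece.\<close>

definition cut :: "nat \<Rightarrow> 'a split_state \<Rightarrow> 'a split_state" where
  "cut s = (\<lambda>(B, W, A, P). if s \<le> length W then (B, B, B, (W, A @ B) # P) else (B, W, A, P))"

definition split_introduce :: "nat \<Rightarrow> 'a \<Rightarrow> 'a split_state \<Rightarrow> 'a split_state" where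
  "split_introduce s v = (\<lambda>(B, W, A, P). cut s (v # B, v # W, A, P))"

definition split_forget :: "'a \<Rightarrow> 'a split_state \<Rightarrow> 'a split_state" where
  "split_forget v = (\<lambda>(B, W, A, P). (filter (\<lambda>u. u \<noteq> v) B, W, A, P))"

text \<open>Duplicates are removed from \<open>W\<close>, whose length is compared with
  \<open>s\<close> and must be the number of vertices. \<open>A\<close> may repeat vertices; its
  length only enters upper bounds.\<close>

definition split_join :: "nat \<Rightarrow> 'a split_state \<Rightarrow> 'a split_state \<Rightarrow> 'a split_state" where
  "split_join s st st' = (case st of (B, W, A, P) \<Rightarrow> case st' of (B', W', A', P') \<Rightarrow>
     cut s (B, W @ filter (\<lambda>u. u \<notin> set W) W', A @ A', P @ P'))"

definition split_ntd :: "nat \<Rightarrow> 'a ntd \<Rightarrow> 'a split_state" where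
  "split_ntd s = ntd_fold ([], [], [], []) (split_introduce s) split_forget (split_join s)"

text \<open>Here \<open>b\<close> bounds the bags, \<open>s\<close> is the threshold, and
  \<open>m\<close> is \<open>s\<close> between nodes and \<open>2 * s\<close> just before a possible
  cut. In \<open>count_pieces\<close> every piece accounts for \<open>s - b\<close> vertices because
  at most \<open>b\<close> of them survive its cut. In \<open>count_boundaries\<close> the factor 2
  is due to a bag being listed in its own piece and again in \<open>A\<close>. The cores, pieces
  minus boundaries, are pairwise disjoint and avoid \<open>W\<close>; since \<open>P\<close> is a
  list, \<open>cores_disjoint\<close> says this by counting inside an arbitrary finite
  \<open>Q\<close>.\<close>

locale split_inv =
  fixes t :: "'a ntd" and b s m :: nat and B W A :: "'a list" and P :: "('a list \<times> 'a list) list"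
  assumes distinct_bag: "distinct B" and set_bag: "set B = root_bag t"
    and distinct_rest: "distinct W" and bag_subset: "set B \<subseteq> set W"
    and boundary_subset: "set A \<subseteq> set W"
    and length_rest: "length W \<le> m"
    and count_pieces: "length P * (s - b) + length W \<le> card (covered_set t)"
    and count_boundaries: "sum_list (map (\<lambda>p. length (snd p)) P) + length A \<le> 2 * b * length P"
    and rest_closed: "u \<in> set W \<Longrightarrow> u \<notin> set A \<Longrightarrow> share_bag t u v \<Longrightarrow> v \<in> set W"
    and piece: "(V, X) \<in> set P \<Longrightarrow> set X \<subseteq> set V \<and> distinct V \<and> length V \<le> 2 * s"
    and piece_core: "(V, X) \<in> set P \<Longrightarrow> u \<in> set V \<Longrightarrow> u \<notin> set X \<Longrightarrow> u \<notin> set W"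
    and piece_closed: "(V, X) \<in> set P \<Longrightarrow> u \<in> set V \<Longrightarrow> u \<notin> set X \<Longrightarrow> share_bag t u v \<Longrightarrow> v \<in> set V"
    and covered: "covered_set t = set W \<union> (\<Union>p\<in>set P. set (fst p))"
    and cores_disjoint: "finite Q \<Longrightarrow>
      (\<Sum>(V, X)\<leftarrow>P. card (Q \<inter> (set V - set X))) \<le> card (Q \<inter> (covered_set t - set W))"
begin

lemma rest_covered: "set W \<subseteq> covered_set t"
  using covered by blast

lemma piece_covered: "(V, X) \<in> set P \<Longrightarrow> set V \<subseteq> covered_set t"
  using covered by force

text \<open>The new piece inherits its closedness from \<open>rest_closed\<close>. Its core
  \<open>W - A - B\<close> moves from inside \<open>W\<close> to outside, which makes room for it in
  \<open>cores_disjoint\<close>.\<close>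

lemma split_inv_cut:
  assumes "s \<le> length W" "m \<le> 2 * s" "b \<le> s" "card (root_bag t) \<le> b"
  shows "split_inv t b s s B B B ((W, A @ B) # P)"
proof
  have B: "length B \<le> b" using distinct_card[OF distinct_bag] set_bag assms(4) by simp
  show "distinct B" "set B = root_bag t"
    by (fact distinct_bag set_bag)+
  show "length B \<le> s" using B assms(3) by linarith
  have "s - b + length B \<le> length W" using B assms(1,3) by linarith
  then show "length ((W, A @ B) # P) * (s - b) + length B \<le> card (covered_set t)"
    using count_pieces by simp
  show "sum_list (map (\<lambda>p. length (snd p)) ((W, A @ B) # P)) + length B \<le> 2 * b * length ((W, A @ B) # P)"
    using count_boundaries B by simp
  show "set X \<subseteq> set V \<and> distinct V \<and> length V \<le> 2 * s" if "(V, X) \<in> set ((W, A @ B) # P)" for V X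
    using that piece[of V X] distinct_rest length_rest assms bag_subset boundary_subset by auto
  show "u \<notin> set B" if "(V, X) \<in> set ((W, A @ B) # P)" "u \<in> set V" "u \<notin> set X" for u V X
    using that piece_core[of V X u] bag_subset by auto
  show "v \<in> set V" if "(V, X) \<in> set ((W, A @ B) # P)" "u \<in> set V" "u \<notin> set X" "share_bag t u v" for u v V X
    using that piece_closed[of V X u v] rest_closed[of u v] by auto
  show "covered_set t = set B \<union> (\<Union>p\<in>set ((W, A @ B) # P). set (fst p))"
    using covered bag_subset by auto
  fix Q :: "'a set" assume Q: "finite Q"
  have "card (Q \<inter> (set W - (set A \<union> set B))) + card (Q \<inter> (covered_set t - set W)) =
      card (Q \<inter> (set W - (set A \<union> set B)) \<union> Q \<inter> (covered_set t - set W))"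
    by (rule card_Un_disjoint[symmetric]) (use Q in auto)
  also have "\<dots> \<le> card (Q \<inter> (covered_set t - set B))"
    by (rule card_mono) (use Q bag_subset rest_covered in auto)
  finally show "(\<Sum>(V, X)\<leftarrow>(W, A @ B) # P. card (Q \<inter> (set V - set X))) \<le> card (Q \<inter> (covered_set t - set B))"
    using cores_disjoint[OF Q] by simp
qed auto

text \<open>The new vertex shares a bag only with the current bag. That bag lies in
  \<open>W\<close>, which no core meets, so the finished pieces stay closed.\<close>

lemma split_inv_introduce:
  assumes "v \<notin> covered_set t" "m < 2 * s"
  shows "split_inv (Introduce v t) b s (2 * s) (v # B) (v # W) A P"
proof
  have v: "v \<notin> set W" "\<not> share_bag t v w" for w
    using assms(1) rest_covered by (auto dest: share_bag_coveredD)
  show "distinct (v # B)" "distinct (v # W)"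
    using distinct_bag distinct_rest v bag_subset by auto
  show "set (v # B) = root_bag (Introduce v t)" "set (v # B) \<subseteq> set (v # W)" "set A \<subseteq> set (v # W)"
    using set_bag bag_subset boundary_subset by auto
  show "length (v # W) \<le> 2 * s" using length_rest assms(2) by simp
  show "length P * (s - b) + length (v # W) \<le> card (covered_set (Introduce v t))"
    using count_pieces assms(1) by simp
  show "w \<in> set (v # W)" if "u \<in> set (v # W)" "u \<notin> set A" "share_bag (Introduce v t) u w" for u w
    using that v rest_closed[of u w] bag_subset set_bag by auto
  show "u \<notin> set (v # W)" if "(V, X) \<in> set P" "u \<in> set V" "u \<notin> set X" for u V X
    using that piece_core[of V X u] piece_covered[of V X] assms(1) by auto
  show "w \<in> set V" if "(V, X) \<in> set P" "u \<in> set V" "u \<notin> set X" "share_bag (Introduce v t) u w" for u w V X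
    using that piece_core[of V X u] piece_closed[of V X u w] piece_covered[of V X] assms(1) bag_subset set_bag by auto
  show "covered_set (Introduce v t) = set (v # W) \<union> (\<Union>p\<in>set P. set (fst p))"
    using covered by simp
  have "covered_set (Introduce v t) - set (v # W) = covered_set t - set W"
    using assms(1) by auto
  then show "(\<Sum>(V, X)\<leftarrow>P. card (Q \<inter> (set V - set X))) \<le> card (Q \<inter> (covered_set (Introduce v t) - set (v # W)))"
    if "finite Q" for Q
    using cores_disjoint[OF that] by simp
qed (use piece count_boundaries in auto)

lemma split_inv_forget: "split_inv (Forget v t) b s m (filter (\<lambda>u. u \<noteq> v) B) W A P"
proof
  show "set (filter (\<lambda>u. u \<noteq> v) B) = root_bag (Forget v t)" using set_bag by auto
  show "set (filter (\<lambda>u. u \<noteq> v) B) \<subseteq> set W" using bag_subset by auto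
  show "v' \<in> set V" if "(V, X) \<in> set P" "u \<in> set V" "u \<notin> set X" "share_bag (Forget v t) u v'" for u v' V X
    using that piece_closed by simp
  show "covered_set (Forget v t) = set W \<union> (\<Union>p\<in>set P. set (fst p))" using covered by simp
  show "length P * (s - b) + length W \<le> card (covered_set (Forget v t))" using count_pieces by simp
  show "w \<in> set W" if "u \<in> set W" "u \<notin> set A" "share_bag (Forget v t) u w" for u w
    using that rest_closed by simp
  show "(\<Sum>(V, X)\<leftarrow>P. card (Q \<inter> (set V - set X))) \<le> card (Q \<inter> (covered_set (Forget v t) - set W))"
    if "finite Q" for Q
    using cores_disjoint[OF that] by simp
qed (fact distinct_rest boundary_subset length_rest count_boundaries piece piece_core
    | simp add: distinct_bag)+

end

text \<open>The two sides meet only in the bag, which is contained in \<open>W\<close> and in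
  \<open>W'\<close>. Hence a core vertex of one side does not occur on the other side at
  all.\<close>

lemma split_inv_join:
  assumes "split_inv l b s s B W A P" and "split_inv r b s s B' W' A' P'"
    and wf: "ntd_wf (Join l r)" and sep: "covered_set l \<inter> covered_set r \<subseteq> root_bag l"
  shows "split_inv (Join l r) b s (2 * s) B (W @ filter (\<lambda>u. u \<notin> set W) W') (A @ A') (P @ P')"
proof -
  interpret L: split_inv l b s s B W A P by fact
  interpret R: split_inv r b s s B' W' A' P' by fact
  have bags: "root_bag l = root_bag r" using wf by simp
  have cov: "covered_set (Join l r) = covered_set l \<union> covered_set r" using wf by simp
  define W'' where "W'' = W @ filter (\<lambda>u. u \<notin> set W) W'"
  have W'': "set W'' = set W \<union> set W'" unfolding W''_def by auto
  have both: "u \<in> set W \<and> u \<in> set W'" if "u \<in> covered_set l" "u \<in> covered_set r" for u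
    using that sep L.set_bag L.bag_subset R.set_bag R.bag_subset bags by auto
  have dist: "distinct W''" using L.distinct_rest R.distinct_rest unfolding W''_def by auto
  have left: "u \<notin> set W''" "\<not> share_bag r u v" if "(V, X) \<in> set P" "u \<in> set V" "u \<notin> set X" for u v V X
  proof -
    have "u \<notin> covered_set r"
      using that L.piece_core[OF that] L.piece_covered[OF that(1)] both by blast
    then show "u \<notin> set W''" "\<not> share_bag r u v"
      using L.piece_core[OF that] W'' R.rest_covered by (auto dest: share_bag_coveredD)
  qed
  have right: "u \<notin> set W''" "\<not> share_bag l u v" if "(V, X) \<in> set P'" "u \<in> set V" "u \<notin> set X" for u v V X
  proof -
    have "u \<notin> covered_set l"
      using that R.piece_core[OF that] R.piece_covered[OF that(1)] both by blast
    then show "u \<notin> set W''" "\<not> share_bag l u v"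
      using R.piece_core[OF that] W'' L.rest_covered by (auto dest: share_bag_coveredD)
  qed
  show ?thesis
    unfolding W''_def[symmetric]
  proof
    show "distinct B" "set B = root_bag (Join l r)" by (simp_all add: L.distinct_bag L.set_bag)
    show "distinct W''" by fact
    show "set B \<subseteq> set W''" "set (A @ A') \<subseteq> set W''"
      using L.bag_subset L.boundary_subset R.boundary_subset W'' by auto
    show "length W'' \<le> 2 * s"
      using L.length_rest R.length_rest length_filter_le[of "\<lambda>u. u \<notin> set W" W'] unfolding W''_def
      by (simp del: length_filter_le)
    \<comment> \<open>\<open>W\<close> and \<open>W'\<close> overlap exactly as the covered sets do,
      so the vertices counted twice cancel in \<open>count_pieces\<close>.\<close>
    have "set W \<inter> set W' = covered_set l \<inter> covered_set r"
      using both L.rest_covered R.rest_covered by blast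
    then have "card (set W \<inter> set W') = card (covered_set l \<inter> covered_set r)" by simp
    moreover have "card (set W \<union> set W') + card (set W \<inter> set W') = card (set W) + card (set W')"
      by (rule card_Un_Int[symmetric]) auto
    moreover have "card (covered_set l \<union> covered_set r) + card (covered_set l \<inter> covered_set r) =
        card (covered_set l) + card (covered_set r)"
      by (rule card_Un_Int[symmetric]) auto
    moreover have "length W'' = card (set W \<union> set W')"
      using distinct_card[OF dist] W'' by simp
    moreover have "length W = card (set W)" "length W' = card (set W')"
      using distinct_card[OF L.distinct_rest] distinct_card[OF R.distinct_rest] by auto
    moreover have "length (P @ P') * (s - b) = length P * (s - b) + length P' * (s - b)"
      by (simp add: algebra_simps)
    ultimately show "length (P @ P') * (s - b) + length W'' \<le> card (covered_set (Join l r))"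
      using L.count_pieces R.count_pieces unfolding cov by linarith
    show "sum_list (map (\<lambda>p. length (snd p)) (P @ P')) + length (A @ A') \<le> 2 * b * length (P @ P')"
      using L.count_boundaries R.count_boundaries by (simp add: algebra_simps)
    show "v \<in> set W''" if u: "u \<in> set W''" "u \<notin> set (A @ A')" and uv: "share_bag (Join l r) u v" for u v
    proof -
      have "share_bag l u v \<or> share_bag r u v" using uv wf by simp
      then show ?thesis
      proof
        assume l: "share_bag l u v"
        then have "u \<in> set W" using u both[OF share_bag_coveredD[OF l]] R.rest_covered W'' by auto
        then show ?thesis using L.rest_closed[OF _ _ l] u W'' by auto
      next
        assume r: "share_bag r u v"
        then have "u \<in> set W'" using u both[OF _ share_bag_coveredD[OF r]] L.rest_covered W'' by auto
        then show ?thesis using R.rest_closed[OF _ _ r] u W'' by auto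
      qed
    qed
    show "set X \<subseteq> set V \<and> distinct V \<and> length V \<le> 2 * s" if "(V, X) \<in> set (P @ P')" for V X
      using that L.piece[of V X] R.piece[of V X] by auto
    show "u \<notin> set W''" if "(V, X) \<in> set (P @ P')" "u \<in> set V" "u \<notin> set X" for u V X
      using that left(1) right(1) by auto
    show "v \<in> set V" if "(V, X) \<in> set (P @ P')" "u \<in> set V" "u \<notin> set X" "share_bag (Join l r) u v" for u v V X
    proof -
      have "share_bag l u v \<or> share_bag r u v" using that(4) wf by simp
      then show ?thesis
        using that(1-3) left(2) right(2) L.piece_closed R.piece_closed by (metis Un_iff set_append)
    qed
    show "covered_set (Join l r) = set W'' \<union> (\<Union>p\<in>set (P @ P'). set (fst p))"
      using cov L.covered R.covered W'' by (simp add: Un_ac)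
    fix Q :: "'a set" assume Q: "finite Q"
    have "(\<Sum>(V, X)\<leftarrow>P @ P'. card (Q \<inter> (set V - set X))) \<le>
        card (Q \<inter> (covered_set l - set W)) + card (Q \<inter> (covered_set r - set W'))"
      using L.cores_disjoint[OF Q] R.cores_disjoint[OF Q] by simp
    also have "\<dots> = card (Q \<inter> (covered_set l - set W) \<union> Q \<inter> (covered_set r - set W'))"
      by (rule card_Un_disjoint[symmetric]) (use Q both in auto)
    also have "\<dots> \<le> card (Q \<inter> (covered_set (Join l r) - set W''))"
    proof (rule card_mono)
      show "Q \<inter> (covered_set l - set W) \<union> Q \<inter> (covered_set r - set W') \<subseteq> Q \<inter> (covered_set (Join l r) - set W'')"
        using both cov W'' L.rest_covered R.rest_covered by blast
    qed (use Q in auto)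
    finally show "(\<Sum>(V, X)\<leftarrow>P @ P'. card (Q \<inter> (set V - set X))) \<le> card (Q \<inter> (covered_set (Join l r) - set W''))" .
  qed
qed

definition split_invs :: "'a ntd \<Rightarrow> nat \<Rightarrow> nat \<Rightarrow> nat \<Rightarrow> 'a split_state \<Rightarrow> bool" where
  "split_invs t b s m = (\<lambda>(B, W, A, P). split_inv t b s m B W A P)"

text \<open>Cutting or not, the bound on \<open>W\<close> drops from \<open>2 * s\<close> back to
  \<open>s\<close>.\<close>

lemma split_invs_cut:
  assumes inv: "split_inv t b s (2 * s) B W A P" and "b \<le> s" "card (root_bag t) \<le> b"
  shows "split_invs t b s s (cut s (B, W, A, P))"
proof -
  interpret split_inv t b s "2 * s" B W A P by fact
  show ?thesis
  proof (cases "s \<le> length W")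
    case True
    then show ?thesis using split_inv_cut assms(2,3) by (simp add: cut_def split_invs_def)
  next
    case False
    then have "split_inv t b s s B W A P"
      using split_inv_axioms unfolding split_inv_def by (elim conjE, intro conjI) (assumption | simp)+
    then show ?thesis using False by (simp add: cut_def split_invs_def)
  qed
qed

lemma split_invs_split_ntd:
  assumes "ntd_wf t" "separating t" "\<And>p. p \<in> ntd_nodes t \<Longrightarrow> card (ntd_bag t p) \<le> b" "b \<le> s" "1 \<le> s"
  shows "split_invs t b s s (split_ntd s t)"
  using assms(1-3)
proof (induction t)
  case Leaf
  show ?case by (simp add: split_invs_def split_inv_def split_ntd_def)
next
  case (Introduce v t)
  have bag: "card (root_bag (Introduce v t)) \<le> b" using Introduce.prems(3)[of "[]"] by simp
  have "split_invs t b s s (split_ntd s t)"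
    using Introduce.prems(1,2) Introduce.prems(3)[of "False # _"] by (intro Introduce.IH) auto
  then obtain B W A P where st: "split_ntd s t = (B, W, A, P)" "split_inv t b s s B W A P"
    by (cases "split_ntd s t") (auto simp: split_invs_def)
  have "split_inv (Introduce v t) b s (2 * s) (v # B) (v # W) A P"
    by (rule split_inv.split_inv_introduce[OF st(2)]) (use Introduce.prems(2) assms(5) in auto)
  from split_invs_cut[OF this assms(4) bag] show ?case
    using st(1) by (simp add: split_ntd_def split_introduce_def)
next
  case (Forget v t)
  have "split_invs t b s s (split_ntd s t)"
    using Forget.prems(1,2) Forget.prems(3)[of "False # _"] by (intro Forget.IH) auto
  then obtain B W A P where st: "split_ntd s t = (B, W, A, P)" "split_inv t b s s B W A P"
    by (cases "split_ntd s t") (auto simp: split_invs_def)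
  from split_inv.split_inv_forget[OF st(2)] show ?case
    using st(1) by (simp add: split_ntd_def split_forget_def split_invs_def)
next
  case (Join l r)
  have bag: "card (root_bag (Join l r)) \<le> b" using Join.prems(3)[of "[]"] by simp
  have "split_invs l b s s (split_ntd s l)"
    using Join.prems(1,2) Join.prems(3)[of "False # _"] by (intro Join.IH) auto
  then obtain B W A P where l: "split_ntd s l = (B, W, A, P)" "split_inv l b s s B W A P"
    by (cases "split_ntd s l") (auto simp: split_invs_def)
  have "split_invs r b s s (split_ntd s r)"
    using Join.prems(1,2) Join.prems(3)[of "True # _"] by (intro Join.IH) auto
  then obtain B' W' A' P' where r: "split_ntd s r = (B', W', A', P')" "split_inv r b s s B' W' A' P'"
    by (cases "split_ntd s r") (auto simp: split_invs_def)
  have "split_inv (Join l r) b s (2 * s) B (W @ filter (\<lambda>u. u \<notin> set W) W') (A @ A') (P @ P')"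
    by (rule split_inv_join[OF l(2) r(2) Join.prems(1)]) (use Join.prems(2) in simp)
  from split_invs_cut[OF this assms(4) bag] show ?case
    using l(1) r(1) by (simp add: split_ntd_def split_join_def)
qed

section \<open>Connected dominating sets\<close>

lemma adj_sym: "adj G u v \<longleftrightarrow> adj G v u"
  by (simp add: adj_def insert_commute)

text \<open>Walks inside a varying set \<open>S\<close>. The relation is reflexive also outside
  \<open>S\<close>, which is why \<open>reach_mem\<close> needs its second premise.\<close>

definition reach :: "'a graph \<Rightarrow> 'a set \<Rightarrow> 'a \<Rightarrow> 'a \<Rightarrow> bool" where
  "reach G S = (\<lambda>x y. adj G x y \<and> x \<in> S \<and> y \<in> S)\<^sup>*\<^sup>*"

lemma adj_induced: "adj (induced G S) x y \<longleftrightarrow> adj G x y \<and> x \<in> S \<and> y \<in> S"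
  by (auto simp: adj_def induced_def)

lemma connected_induced_iff:
  "connected_graph (induced G S) \<longleftrightarrow> (\<forall>u\<in>S. \<forall>v\<in>S. reach G S u v)"
proof -
  have "adj (induced G S) = (\<lambda>x y. adj G x y \<and> x \<in> S \<and> y \<in> S)"
    by (simp add: fun_eq_iff adj_induced)
  then show ?thesis by (simp add: connected_graph_def reach_def) (simp add: induced_def)
qed

lemma reach_refl [simp]: "reach G S u u"
  by (simp add: reach_def)

lemma reach_step: "adj G u v \<Longrightarrow> u \<in> S \<Longrightarrow> v \<in> S \<Longrightarrow> reach G S u v"
  unfolding reach_def by blast

lemma reach_trans [trans]: "reach G S u v \<Longrightarrow> reach G S v w \<Longrightarrow> reach G S u w"
  unfolding reach_def by (rule rtranclp_trans)

lemma reach_mono: "reach G S u v \<Longrightarrow> S \<subseteq> S' \<Longrightarrow> reach G S' u v"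
  unfolding reach_def by (erule rtranclp_imp) auto

lemma reach_sym: "reach G S u v \<Longrightarrow> reach G S v u"
proof -
  have "symp (\<lambda>x y. adj G x y \<and> x \<in> S \<and> y \<in> S)" by (auto simp: symp_def adj_sym[of G])
  from sympD[OF symp_rtranclp[OF this]] show "reach G S u v \<Longrightarrow> reach G S v u"
    unfolding reach_def by blast
qed

lemma reach_mem: "reach G S u v \<Longrightarrow> u \<in> S \<Longrightarrow> v \<in> S"
  unfolding reach_def by (induction rule: rtranclp_induct) auto

lemma connected_inducedI:
  assumes "\<And>u. u \<in> S \<Longrightarrow> reach G S u r"
  shows "connected_graph (induced G S)"
  unfolding connected_induced_iff by (auto intro: reach_trans[OF assms reach_sym[OF assms]])

lemma cds_iff:
  "connected_dominating_set G Y \<longleftrightarrow> Y \<subseteq> verts G \<and> (\<forall>v\<in>verts G. v \<in> Y \<or> (\<exists>u\<in>Y. adj G u v)) \<and>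
     (\<forall>u\<in>Y. \<forall>v\<in>Y. reach G Y u v)"
  unfolding connected_dominating_set_def connected_induced_iff closed_nbhd_def by auto

text \<open>Every vertex is attached to the connected set \<open>Y\<close>, so feasibility makes the
  whole graph connected. This is what the repair step uses.\<close>

lemma cds_reach:
  assumes "connected_dominating_set G Y" "u \<in> verts G" "v \<in> verts G"
  shows "reach G (verts G) u v"
proof -
  have Y: "Y \<subseteq> verts G" using assms(1) by (simp add: cds_iff)
  have *: "\<exists>y\<in>Y. reach G (verts G) w y" if w: "w \<in> verts G" for w
  proof -
    have "w \<in> Y \<or> (\<exists>y\<in>Y. adj G y w)" using assms(1) w by (simp add: cds_iff)
    then show ?thesis
    proof
      assume "\<exists>y\<in>Y. adj G y w"
      then obtain y where "y \<in> Y" "adj G y w" by blast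
      then show ?thesis using reach_step[of G w y "verts G"] w Y adj_sym[of G w y] by blast
    qed (auto intro: reach_refl)
  qed
  obtain y z where yz: "y \<in> Y" "reach G (verts G) u y" "z \<in> Y" "reach G (verts G) v z"
    using *[OF assms(2)] *[OF assms(3)] by blast
  have "reach G Y y z" using assms(1) yz by (simp add: cds_iff)
  then have "reach G (verts G) y z" using Y by (rule reach_mono)
  with yz(2) have "reach G (verts G) u z" by (rule reach_trans)
  from this reach_sym[OF yz(4)] show ?thesis by (rule reach_trans)
qed

lemma finite_cds: "simple_graph G \<Longrightarrow> finite {Y. connected_dominating_set G Y}"
  by (rule finite_subset[of _ "Pow (verts G)"]) (auto simp: cds_iff simple_graph_def)

lemma cds_opt_le: "simple_graph G \<Longrightarrow> connected_dominating_set G Y \<Longrightarrow> cds_opt G \<le> card Y"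
  unfolding cds_opt_def by (rule Min_le) (auto intro: finite_cds)

lemma cds_opt_attained:
  assumes "simple_graph G" "connected_dominating_set G Y"
  obtains Z where "connected_dominating_set G Z" "card Z = cds_opt G"
proof -
  have "cds_opt G \<in> card ` {Y. connected_dominating_set G Y}"
    unfolding cds_opt_def by (rule Min_in) (use assms finite_cds[OF assms(1)] in auto)
  then show thesis using that by auto
qed

lemma degree_le_max_degree: "simple_graph G \<Longrightarrow> u \<in> verts G \<Longrightarrow> degree_of G u \<le> max_degree G"
  unfolding max_degree_def by (rule Max_ge) (auto simp: simple_graph_def)

text \<open>The closed neighbourhoods of the members of \<open>Y\<close> cover the graph, and each
  has at most \<open>max_degree G + 1\<close> vertices.\<close>

lemma card_verts_le:
  assumes G: "simple_graph G" and Y: "connected_dominating_set G Y"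
  shows "card (verts G) \<le> (max_degree G + 1) * card Y"
proof -
  have fin: "finite (verts G)" "finite Y"
    using G Y by (auto simp: simple_graph_def cds_iff intro: finite_subset)
  have "verts G \<subseteq> (\<Union>y\<in>Y. insert y {v \<in> verts G. adj G y v})"
    using Y by (auto simp: cds_iff)
  then have "card (verts G) \<le> card (\<Union>y\<in>Y. insert y {v \<in> verts G. adj G y v})"
    by (intro card_mono) (use fin in auto)
  also have "\<dots> \<le> (\<Sum>y\<in>Y. card (insert y {v \<in> verts G. adj G y v}))"
    by (rule card_UN_le[OF fin(2)])
  also have "\<dots> \<le> (\<Sum>y\<in>Y. max_degree G + 1)"
  proof (rule sum_mono)
    fix y assume "y \<in> Y"
    then have "degree_of G y \<le> max_degree G" using degree_le_max_degree[OF G] Y by (auto simp: cds_iff)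
    then show "card (insert y {v \<in> verts G. adj G y v}) \<le> max_degree G + 1"
      using card_insert_le_m1[of "max_degree G + 1" "{v \<in> verts G. adj G y v}" y]
      unfolding degree_of_def by simp
  qed
  finally show ?thesis by (simp add: mult.commute)
qed

section \<open>Queries\<close>

definition query_graph :: "'a graph \<Rightarrow> 'a set \<Rightarrow> 'a set \<Rightarrow> 'a graph" where
  "query_graph G V X = (V, {e \<in> edges G. e \<subseteq> V} \<union> {{u, v} | u v. u \<in> X \<and> v \<in> X \<and> u \<noteq> v})"

lemma verts_query_graph [simp]: "verts (query_graph G V X) = V"
  by (simp add: query_graph_def)

lemma adj_query_graph: "adj (query_graph G V X) u v \<longleftrightarrow>
    adj G u v \<and> u \<in> V \<and> v \<in> V \<or> u \<in> X \<and> v \<in> X \<and> u \<noteq> v"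
  by (auto simp: query_graph_def adj_def doubleton_eq_iff)

lemma simple_query_graph:
  assumes "simple_graph G" "V \<subseteq> verts G" "X \<subseteq> V"
  shows "simple_graph (query_graph G V X)"
  using assms unfolding simple_graph_def query_graph_def by (auto intro: finite_subset)

lemma cds_query_graph:
  assumes Y: "connected_dominating_set G Y" and V: "X \<subseteq> V" "V \<subseteq> verts G" "X \<noteq> {}"
    and closed: "\<And>u v. u \<in> V \<Longrightarrow> u \<notin> X \<Longrightarrow> adj G u v \<Longrightarrow> v \<in> V"
  shows "connected_dominating_set (query_graph G V X) (Y \<inter> V \<union> X)"
proof -
  let ?Q = "query_graph G V X" and ?S = "Y \<inter> V \<union> X"
  obtain x where x: "x \<in> X" using V by blast
  have to_x: "reach ?Q ?S u x" if "u \<in> X" for u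
    using that x by (cases "u = x") (auto intro: reach_step simp: adj_query_graph)
  have Y': "\<And>v. v \<in> verts G \<Longrightarrow> v \<in> Y \<or> (\<exists>u\<in>Y. adj G u v)" "\<And>u v. u \<in> Y \<Longrightarrow> v \<in> Y \<Longrightarrow> reach G Y u v"
    using Y by (auto simp: cds_iff)
  \<comment> \<open>A member of \<open>Y\<close> next to \<open>x\<close>, or \<open>x\<close>
    itself; it extends walks inside \<open>Y\<close> to the chosen boundary vertex.\<close>
  obtain y where y: "y \<in> Y" "y = x \<or> adj G y x" using Y'(1)[of x] x V by blast
  have walk: "reach ?Q ?S u x" if "reach G (Y \<union> X) u x" "u \<in> V" "u \<in> Y \<union> X" for u
    using that unfolding reach_def[of G]
  proof (induction rule: converse_rtranclp_induct)
    case (step u v)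
    show ?case
    proof (cases "u \<in> X")
      case False
      then have "v \<in> V" using closed step by blast
      then have "reach ?Q ?S u v" "reach ?Q ?S v x"
        using step by (auto intro!: reach_step simp: adj_query_graph)
      then show ?thesis by (rule reach_trans)
    qed (use to_x in simp)
  qed simp
  have "reach ?Q ?S u x" if "u \<in> ?S" for u
  proof (cases "u \<in> X")
    case False
    then have u: "u \<in> Y" "u \<in> V" using that by auto
    have "reach G (Y \<union> X) u y" using Y'(2)[OF u(1) y(1)] by (rule reach_mono) auto
    moreover have "reach G (Y \<union> X) y x" using y x by (cases "y = x") (auto intro: reach_step)
    ultimately have "reach G (Y \<union> X) u x" by (rule reach_trans)
    then show ?thesis using walk u by simp
  qed (use to_x in simp)
  then have "connected_graph (induced ?Q ?S)" by (rule connected_inducedI)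
  moreover have "v \<in> ?S \<or> (\<exists>u\<in>?S. adj ?Q u v)" if v: "v \<in> V" for v
  proof (rule disjCI)
    assume no: "\<not> (\<exists>u\<in>?S. adj ?Q u v)"
    show "v \<in> ?S"
    proof (rule ccontr)
      assume nv: "v \<notin> ?S"
      then obtain u where u: "u \<in> Y" "adj G u v" using Y'(1)[of v] v V by blast
      then have "u \<in> V" using closed[of v u] nv v adj_sym[of G u v] by simp
      then show False using no u v by (auto simp: adj_query_graph)
    qed
  qed
  ultimately show ?thesis
    using V by (auto simp: cds_iff connected_induced_iff)
qed

text \<open>Stop a walk towards \<open>x\<close> at its first vertex in \<open>X\<close>. Every step
  before it starts off the clique and is therefore an edge of \<open>G\<close>. So each component of
  an answer meets the boundary.\<close>

lemma query_graph_reach: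
  assumes S: "connected_dominating_set (query_graph G V X) S" and X: "X \<subseteq> V" "X \<noteq> {}" and s: "s \<in> S"
  shows "\<exists>x\<in>X. reach G (S \<union> X) s x"
proof -
  let ?Q = "query_graph G V X"
  obtain x where x: "x \<in> X" using X by blast
  have S': "S \<subseteq> V" "\<And>v. v \<in> V \<Longrightarrow> v \<in> S \<or> (\<exists>u\<in>S. adj ?Q u v)" "\<And>u v. u \<in> S \<Longrightarrow> v \<in> S \<Longrightarrow> reach ?Q S u v"
    using S by (auto simp: cds_iff)
  obtain y where y: "y \<in> S" "y = x \<or> adj ?Q y x" using S'(2)[of x] x X by blast
  have "reach ?Q (S \<union> X) s y" using S'(3)[OF s y(1)] by (rule reach_mono) auto
  moreover have "reach ?Q (S \<union> X) y x" using y x by (cases "y = x") (auto intro: reach_step)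
  ultimately have "reach ?Q (S \<union> X) s x" by (rule reach_trans)
  then show ?thesis
    unfolding reach_def[of ?Q]
  proof (induction rule: converse_rtranclp_induct)
    case base
    show ?case by (rule bexI[rotated], rule x, rule reach_refl)
  next
    case (step u v)
    show ?case
    proof (cases "u \<in> X")
      case True
      show ?thesis by (rule bexI[rotated], rule True, rule reach_refl)
    next
      case False
      then have "reach G (S \<union> X) u v" using step(1) by (auto intro: reach_step simp: adj_query_graph)
      then show ?thesis using step(3) reach_trans[OF \<open>reach G (S \<union> X) u v\<close>] by blast
    qed
  qed
qed

text \<open>A clique edge can only dominate a vertex of \<open>X\<close>, and all of
  \<open>X\<close> is added to the union.\<close>

lemma query_graph_dominated:
  assumes "connected_dominating_set (query_graph G V X) S" "v \<in> V"
  shows "v \<in> S \<union> X \<or> (\<exists>u\<in>S. adj G u v)"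
  using assms unfolding cds_iff by (auto simp: adj_query_graph)

section \<open>Connecting a dominating set\<close>

text \<open>Leave the closed neighbourhood of the component of \<open>r\<close> along an edge
  \<open>x y\<close>. The vertex that dominates \<open>y\<close> lies in another component, whose
  anchor is then reached through \<open>x\<close> and \<open>y\<close>.\<close>

lemma augmenting_pair:
  assumes conn: "\<And>u v. u \<in> verts G \<Longrightarrow> v \<in> verts G \<Longrightarrow> reach G (verts G) u v"
    and R: "r \<in> D" "D \<subseteq> R" "R \<subseteq> verts G"
    and dom: "\<And>v. v \<in> verts G \<Longrightarrow> v \<in> D \<or> (\<exists>u\<in>D. adj G u v)"
    and anchor: "\<And>d. d \<in> D \<Longrightarrow> \<exists>a\<in>A. reach G D d a"
    and a: "a \<in> A" "A \<subseteq> D" "\<not> reach G R r a"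
  shows "\<exists>u\<in>verts G. \<exists>v\<in>verts G. \<exists>a\<in>A. \<not> reach G R r a \<and> reach G (insert u (insert v R)) r a"
proof -
  \<comment> \<open>The component of \<open>r\<close> in \<open>R\<close> together with all its
    neighbours.\<close>
  define N where "N = {v \<in> verts G. \<exists>u\<in>R. reach G R r u \<and> (u = v \<or> adj G u v)}"
  have rN: "r \<in> N" using R by (auto simp: N_def intro!: bexI[of _ r])
  have aN: "a \<notin> N"
  proof
    assume "a \<in> N"
    then obtain u where u: "u \<in> R" "reach G R r u" "u = a \<or> adj G u a" unfolding N_def by blast
    have "reach G R u a" using u a R by (cases "u = a") (auto intro: reach_step)
    from reach_trans[OF u(2) this] show False using a(3) by blast
  qed
  have "reach G (verts G) r a" using conn R a by blast
  then have "\<exists>x y. x \<in> N \<and> y \<in> verts G \<and> y \<notin> N \<and> adj G x y"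
    using aN unfolding reach_def
  proof (induction rule: rtranclp_induct)
    case base
    then show ?case using rN by blast
  next
    case (step y z)
    then show ?case by blast
  qed
  then obtain x y where xy: "x \<in> N" "y \<in> verts G" "y \<notin> N" "adj G x y" by blast
  obtain d where d: "d \<in> D" "d = y \<or> adj G d y" using dom[OF xy(2)] by blast
  \<comment> \<open>Otherwise \<open>y\<close>, which is \<open>d\<close> or adjacent to it, would
    belong to \<open>N\<close>.\<close>
  have nd: "\<not> reach G R r d" using d xy R unfolding N_def by blast
  obtain b where b: "b \<in> A" "reach G D d b" using anchor[OF d(1)] by blast
  have db: "reach G R d b" using b(2) R(2) by (rule reach_mono)
  have "\<not> reach G R r b" using nd reach_trans[OF _ reach_sym[OF db]] by blast
  moreover have "reach G (insert x (insert y R)) r b"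
  proof -
    let ?R = "insert x (insert y R)"
    obtain u where u: "u \<in> R" "reach G R r u" "u = x \<or> adj G u x" using xy(1) unfolding N_def by blast
    have "reach G ?R r u" using u(2) by (rule reach_mono) auto
    also have "reach G ?R u x" using u by (cases "u = x") (auto intro: reach_step)
    also have "reach G ?R x y" using xy by (auto intro: reach_step)
    also have "reach G ?R y d" using d R adj_sym[of G d y] by (cases "d = y") (auto intro: reach_step)
    also have "reach G ?R d b" using db by (rule reach_mono) auto
    finally show ?thesis .
  qed
  moreover have "x \<in> verts G" using xy(1) unfolding N_def by blast
  ultimately show ?thesis using xy(2) b(1) by blast
qed

definition adj_list :: "('a \<times> 'a) list \<Rightarrow> 'a \<Rightarrow> 'a \<Rightarrow> bool" where
  "adj_list es u v \<longleftrightarrow> list_ex (\<lambda>e. fst e = u \<and> snd e = v \<or> fst e = v \<and> snd e = u) es"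

lemma adj_list_iff:
  assumes "(\<lambda>(u, v). {u, v}) ` set es = edges G"
  shows "adj_list es u v \<longleftrightarrow> adj G u v"
  unfolding adj_def assms[symmetric] adj_list_def list_ex_iff
  by (auto simp: doubleton_eq_iff image_iff Bex_def)

text \<open>Breadth-first search in which the last \<open>vs\<close> merely counts rounds;
  \<open>length vs\<close> rounds suffice. Filtering \<open>vs\<close> makes the result free of
  repetitions and contained in \<open>vs\<close>.\<close>

definition component :: "('a \<times> 'a) list \<Rightarrow> 'a list \<Rightarrow> 'a list \<Rightarrow> 'a \<Rightarrow> 'a list" where
  "component es vs R r = foldl (\<lambda>C _. filter (\<lambda>v. v \<in> set C \<or> v \<in> set R \<and> list_ex (\<lambda>u. adj_list es u v) C) vs) [r] vs"

lemma set_component: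
  assumes es: "(\<lambda>(u, v). {u, v}) ` set es = edges G" and r: "r \<in> set R" "set R \<subseteq> set vs"
  shows "set (component es vs R r) = {v. reach G (set R) r v}"
proof -
  define f where "f = (\<lambda>C. C \<union> {v \<in> set R. \<exists>u\<in>C. adj G u v})"
  have sub: "(f ^^ n) {r} \<subseteq> set R" for n
    by (induction n) (use r in \<open>auto simp: f_def\<close>)
  have fold: "set (foldl (\<lambda>C _. filter (\<lambda>v. v \<in> set C \<or> v \<in> set R \<and> list_ex (\<lambda>u. adj_list es u v) C) vs) C xs)
      = (f ^^ length xs) (set C)" if "set C \<subseteq> set R" for C and xs :: "'b list"
    using that
  proof (induction xs arbitrary: C)
    case (Cons x xs)
    let ?C = "filter (\<lambda>v. v \<in> set C \<or> v \<in> set R \<and> list_ex (\<lambda>u. adj_list es u v) C) vs"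
    have "set ?C = f (set C)"
      using Cons.prems r(2) by (auto simp: f_def adj_list_iff[OF es] list_ex_iff)
    moreover have "set ?C \<subseteq> set R" using Cons.prems by auto
    ultimately show ?case using Cons.IH[of ?C] by (simp add: funpow_swap1)
  qed simp
  have inc: "(f ^^ n) {r} \<subseteq> (f ^^ Suc n) {r}" for n by (auto simp: f_def)
  have stable: "(f ^^ (n + k)) {r} = (f ^^ n) {r}" if "(f ^^ Suc n) {r} = (f ^^ n) {r}" for n k
    by (induction k) (use that in auto)
  \<comment> \<open>The iteration starts with one vertex and gains one in every round until it is
    stable. After \<open>length vs\<close> rounds the first alternative exceeds the number of
    available vertices.\<close>
  have "n < card ((f ^^ n) {r}) \<or> (f ^^ Suc n) {r} = (f ^^ n) {r}" for n
  proof (induction n)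
    case (Suc n)
    show ?case
    proof (cases "(f ^^ Suc n) {r} = (f ^^ n) {r}")
      case True
      then show ?thesis using stable[OF True, of 2] by (simp add: numeral_2_eq_2)
    next
      case False
      then have "(f ^^ n) {r} \<subset> (f ^^ Suc n) {r}" using inc by blast
      then have "card ((f ^^ n) {r}) < card ((f ^^ Suc n) {r})"
        by (rule psubset_card_mono[rotated]) (meson List.finite_set finite_subset sub)
      then show ?thesis using Suc False by auto
    qed
  qed simp
  moreover have "card ((f ^^ length vs) {r}) \<le> length vs"
    using sub[of "length vs"] r(2) by (meson List.finite_set card_length card_mono le_trans subset_trans)
  ultimately have fixed: "f ((f ^^ length vs) {r}) = (f ^^ length vs) {r}"
    by (metis (no_types) funpow.simps(2) comp_apply linorder_not_less)
  define C where "C = (f ^^ length vs) {r}"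
  have "set (component es vs R r) = C"
    unfolding component_def C_def using fold[of "[r]" vs] r by simp
  moreover have "reach G (set R) r v" if "v \<in> (f ^^ n) {r}" for v n
    using that
  proof (induction n arbitrary: v)
    case (Suc n)
    then consider "v \<in> (f ^^ n) {r}" | u where "v \<in> set R" "u \<in> (f ^^ n) {r}" "adj G u v"
      by (auto simp: f_def)
    then show ?case
    proof cases
      case 2
      then have "reach G (set R) u v" using sub[of n] by (auto intro: reach_step)
      with Suc.IH[OF 2(2)] show ?thesis by (rule reach_trans)
    qed (use Suc.IH in simp)
  qed simp
  moreover have "v \<in> C" if "reach G (set R) r v" for v
    using that unfolding reach_def
  proof (induction rule: rtranclp_induct)
    case base
    have "r \<in> (f ^^ n) {r}" for n by (induction n) (auto simp: f_def)
    then show ?case unfolding C_def .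
  next
    case (step y z)
    then have "z \<in> f C" by (auto simp: f_def)
    then show ?case using fixed unfolding C_def by simp
  qed
  ultimately show ?thesis unfolding C_def by blast
qed

text \<open>Exhaustive search over all pairs for one that brings a new anchor into the component of
  \<open>r\<close>. In a connected graph with the preconditions of \<open>augmenting_pair\<close>,
  failure means that all anchors are reached.\<close>

definition augment :: "('a \<times> 'a) list \<Rightarrow> 'a list \<Rightarrow> 'a list \<Rightarrow> 'a \<Rightarrow> 'a list \<Rightarrow> 'a list" where
  "augment es vs A r R = (case filter (\<lambda>p. list_ex (\<lambda>a. a \<notin> set (component es vs R r) \<and>
       a \<in> set (component es vs (fst p # snd p # R) r)) A) (List.product vs vs) of
     [] \<Rightarrow> R | p # _ \<Rightarrow> fst p # snd p # R)"

text \<open>One round per anchor. The final restriction to the component of \<open>r\<close> removes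
  duplicates, and it returns vertices of the graph even when repair is impossible.\<close>

definition connect :: "('a \<times> 'a) list \<Rightarrow> 'a list \<Rightarrow> 'a list \<Rightarrow> 'a \<Rightarrow> 'a list \<Rightarrow> 'a list" where
  "connect es vs A r D = component es vs (foldl (\<lambda>R _. augment es vs A r R) D A) r"

lemma connect_correct:
  assumes G: "simple_graph G" "set vs = verts G" "(\<lambda>(u, v). {u, v}) ` set es = edges G"
    and conn: "\<And>u v. u \<in> verts G \<Longrightarrow> v \<in> verts G \<Longrightarrow> reach G (verts G) u v"
    and R: "r \<in> set D" "set D \<subseteq> verts G"
    and dom: "\<And>v. v \<in> verts G \<Longrightarrow> v \<in> set D \<or> (\<exists>u\<in>set D. adj G u v)"
    and anchor: "\<And>d. d \<in> set D \<Longrightarrow> \<exists>a\<in>set A. reach G (set D) d a"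
    and A: "set A \<subseteq> set D"
  shows "connected_dominating_set G (set (connect es vs A r D))"
    and "card (set (connect es vs A r D)) \<le> length D + 2 * length A"
proof -
  \<comment> \<open>The anchors still missing; their number measures progress. The truncated
    \<open>- 1\<close> below also covers rounds in which none is missing.\<close>
  define left where "left = (\<lambda>R. {a \<in> set A. \<not> reach G (set R) r a})"
  have step: "length (augment es vs A r R) \<le> length R + 2 \<and> set R \<subseteq> set (augment es vs A r R) \<and>
      set (augment es vs A r R) \<subseteq> verts G \<and> card (left (augment es vs A r R)) \<le> card (left R) - 1"
    if R': "set D \<subseteq> set R" "set R \<subseteq> verts G" for R
  proof -
    have comp: "set (component es vs R' r) = {v. reach G (set R') r v}"
      if "set D \<subseteq> set R'" "set R' \<subseteq> verts G" for R'
      by (rule set_component[OF G(3)]) (use that R G(2) in auto)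
    define cands where "cands = filter (\<lambda>p. list_ex (\<lambda>a. a \<notin> set (component es vs R r) \<and>
       a \<in> set (component es vs (fst p # snd p # R) r)) A) (List.product vs vs)"
    have cand: "(u, v) \<in> set cands \<longleftrightarrow> u \<in> verts G \<and> v \<in> verts G \<and>
        (\<exists>a\<in>set A. \<not> reach G (set R) r a \<and> reach G (insert u (insert v (set R))) r a)" for u v
    proof (cases "u \<in> verts G \<and> v \<in> verts G")
      case True
      then have "set (component es vs (u # v # R) r) = {w. reach G (insert u (insert v (set R))) r w}"
        using comp[of "u # v # R"] R' by auto
      then show ?thesis using True comp[OF R'] G(2) by (auto simp: cands_def list_ex_iff)
    next
      case False
      then show ?thesis using G(2) by (auto simp: cands_def)
    qed
    have aug: "augment es vs A r R = (case cands of [] \<Rightarrow> R | p # _ \<Rightarrow> fst p # snd p # R)"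
      unfolding augment_def cands_def ..
    show ?thesis
    proof (cases cands)
      case Nil
      have "left R = {}"
      proof (rule ccontr)
        assume "left R \<noteq> {}"
        then obtain a where a: "a \<in> set A" "\<not> reach G (set R) r a" unfolding left_def by blast
        have "\<exists>u\<in>verts G. \<exists>v\<in>verts G. \<exists>a\<in>set A. \<not> reach G (set R) r a \<and>
            reach G (insert u (insert v (set R))) r a"
          by (rule augmenting_pair[OF conn R(1) R' dom anchor a(1) A a(2)])
        then show False using cand Nil by fastforce
      qed
      then show ?thesis using aug Nil R' by simp
    next
      case (Cons p ps)
      obtain u v where p: "p = (u, v)" by (cases p)
      then have uv: "u \<in> verts G" "v \<in> verts G" "\<exists>a\<in>set A. \<not> reach G (set R) r a \<and>
          reach G (insert u (insert v (set R))) r a"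
        using cand[of u v] Cons by auto
      have "left (u # v # R) \<subset> left R"
      proof
        show "left (u # v # R) \<subseteq> left R"
          unfolding left_def by (auto intro: reach_mono)
        show "left (u # v # R) \<noteq> left R"
          using uv(3) unfolding left_def by auto
      qed
      then have "card (left (u # v # R)) < card (left R)"
        by (rule psubset_card_mono[rotated]) (simp add: left_def)
      then show ?thesis using aug Cons p uv R' by auto
    qed
  qed
  define R where "R = foldl (\<lambda>R _. augment es vs A r R) D A"
  have "set D \<subseteq> set (foldl (\<lambda>R _. augment es vs A r R) R0 xs) \<and>
      set (foldl (\<lambda>R _. augment es vs A r R) R0 xs) \<subseteq> verts G \<and>
      length (foldl (\<lambda>R _. augment es vs A r R) R0 xs) \<le> length R0 + 2 * length xs \<and>
      card (left (foldl (\<lambda>R _. augment es vs A r R) R0 xs)) \<le> card (left R0) - length xs"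
    if "set D \<subseteq> set R0" "set R0 \<subseteq> verts G" for R0 and xs :: "'a list"
    using that
  proof (induction xs arbitrary: R0)
    case (Cons x xs)
    have "set D \<subseteq> set (augment es vs A r R0)" using step[OF Cons.prems] Cons.prems by blast
    from Cons.IH[OF this] show ?case using step[OF Cons.prems] by simp linarith
  qed simp
  from this[of D A] have RR: "set D \<subseteq> set R" "set R \<subseteq> verts G" "length R \<le> length D + 2 * length A"
    "card (left R) \<le> card (left D) - length A"
    using R unfolding R_def by auto
  have "card (left D) \<le> card (set A)" by (rule card_mono) (auto simp: left_def)
  then have "card (left R) = 0" using RR(4) card_length[of A] by simp
  then have "left R = {}" by (simp add: left_def)
  then have all: "reach G (set R) r a" if "a \<in> set A" for a using that unfolding left_def by blast
  define C where "C = set (connect es vs A r D)"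
  have C: "C = {v. reach G (set R) r v}"
    unfolding C_def connect_def R_def[symmetric]
    by (rule set_component[OF G(3)]) (use R RR G(2) in auto)
  have CR: "C \<subseteq> set R" using C R(1) RR(1) by (auto dest: reach_mem)
  \<comment> \<open>Restricting to the component of \<open>r\<close> loses nothing of
    \<open>D\<close>: each of its vertices hangs on an anchor, and all anchors are reached. Hence
    domination survives.\<close>
  have DC: "set D \<subseteq> C"
  proof
    fix d assume "d \<in> set D"
    then obtain a where "a \<in> set A" "reach G (set D) d a" using anchor by blast
    then have "reach G (set R) r d"
      using reach_trans[OF all reach_sym[OF reach_mono[OF _ RR(1)]]] by blast
    then show "d \<in> C" using C by simp
  qed
  have "reach G C u r" if "u \<in> C" for u
  proof -
    have "reach G (set R) r u" using that C by simp
    then have "reach G C r u"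
      unfolding reach_def
    proof (induction rule: rtranclp_induct)
      case (step y z)
      have "reach G (set R) r y" using step(1) unfolding reach_def .
      moreover from this have "reach G (set R) r z"
        using step(2) by (auto intro: reach_trans reach_step)
      ultimately have "y \<in> C" "z \<in> C" using C by auto
      then show ?case using step by (auto intro: rtranclp.rtrancl_into_rtrancl)
    qed simp
    then show ?thesis by (rule reach_sym)
  qed
  then have "connected_graph (induced G C)" by (rule connected_inducedI)
  then show "connected_dominating_set G (set (connect es vs A r D))"
    using CR RR(2) DC dom unfolding C_def[symmetric] cds_iff connected_induced_iff by blast
  have "card C \<le> card (set R)" by (rule card_mono[OF _ CR]) simp
  then show "card (set (connect es vs A r D)) \<le> length D + 2 * length A"
    using RR(3) card_length[of R] unfolding C_def by simp
qed

section \<open>The kernelization\<close>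

text \<open>The treewidth is not part of the input; the program reads it off the decomposition as
  the largest bag size minus one. The root bag is carried along only to measure it.\<close>

definition max_bag :: "'a ntd \<Rightarrow> 'a list \<times> nat" where
  "max_bag = ntd_fold ([], 0) (\<lambda>v (B, b). (v # B, max b (length (v # B))))
     (\<lambda>v (B, b). (filter (\<lambda>u. u \<noteq> v) B, b)) (\<lambda>m m'. (fst m, max (snd m) (snd m')))"

lemma max_bag:
  assumes "ntd_wf t"
  shows "distinct (fst (max_bag t)) \<and> set (fst (max_bag t)) = root_bag t \<and>
    (\<forall>p\<in>ntd_nodes t. card (ntd_bag t p) \<le> snd (max_bag t)) \<and>
    (\<exists>p\<in>ntd_nodes t. card (ntd_bag t p) = snd (max_bag t))"
  using assms
proof (induction t)
  case Leaf
  then show ?case by (simp add: max_bag_def)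
next
  case (Introduce v t)
  obtain B b where m: "max_bag t = (B, b)" by (cases "max_bag t")
  have m': "max_bag (Introduce v t) = (v # B, max b (length (v # B)))"
    using m by (simp add: max_bag_def)
  have IH: "distinct B" "set B = root_bag t" "\<And>p. p \<in> ntd_nodes t \<Longrightarrow> card (ntd_bag t p) \<le> b"
    "\<exists>p\<in>ntd_nodes t. card (ntd_bag t p) = b"
    using Introduce m by auto
  then have root: "card (ntd_bag (Introduce v t) []) = length (v # B)"
    using Introduce.prems distinct_card[of B] by simp
  have "\<exists>p\<in>ntd_nodes (Introduce v t). card (ntd_bag (Introduce v t) p) = max b (length (v # B))"
  proof (cases "b \<le> length (v # B)")
    case True
    then show ?thesis by (intro bexI[of _ "[]"]) (use root in \<open>simp_all del: ntd_bag_simps\<close>)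
  next
    case False
    obtain p where "p \<in> ntd_nodes t" "card (ntd_bag t p) = b" using IH(4) by blast
    then show ?thesis using False by (intro bexI[of _ "False # p"]) auto
  qed
  moreover have "\<forall>p\<in>ntd_nodes (Introduce v t). card (ntd_bag (Introduce v t) p) \<le> max b (length (v # B))"
    using IH(3) root by (auto simp: le_max_iff_disj simp del: list.size)
  ultimately show ?case using IH(1,2) Introduce.prems by (simp add: m')
next
  case (Forget v t)
  obtain B b where m: "max_bag t = (B, b)" by (cases "max_bag t")
  have m': "max_bag (Forget v t) = (filter (\<lambda>u. u \<noteq> v) B, b)"
    using m by (simp add: max_bag_def)
  have IH: "distinct B" "set B = root_bag t" "\<And>p. p \<in> ntd_nodes t \<Longrightarrow> card (ntd_bag t p) \<le> b"
    "\<exists>p\<in>ntd_nodes t. card (ntd_bag t p) = b"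
    using Forget m by auto
  have "card (root_bag t - {v}) \<le> b"
    by (rule le_trans[OF card_Diff1_le]) (use IH(3)[of "[]"] in simp)
  moreover have "\<exists>p\<in>ntd_nodes (Forget v t). card (ntd_bag (Forget v t) p) = b"
    using IH(4) by auto
  ultimately show ?case using IH by (auto simp: m')
next
  case (Join l r)
  obtain B b where m: "max_bag l = (B, b)" by (cases "max_bag l")
  obtain B' b' where n: "max_bag r = (B', b')" by (cases "max_bag r")
  have m': "max_bag (Join l r) = (B, max b b')"
    using m n by (simp add: max_bag_def)
  have IH: "distinct B" "set B = root_bag l" "\<And>p. p \<in> ntd_nodes l \<Longrightarrow> card (ntd_bag l p) \<le> b"
    "\<exists>p\<in>ntd_nodes l. card (ntd_bag l p) = b"
    "\<And>p. p \<in> ntd_nodes r \<Longrightarrow> card (ntd_bag r p) \<le> b'"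
    "\<exists>p\<in>ntd_nodes r. card (ntd_bag r p) = b'"
    using Join m n by auto
  have "\<exists>p\<in>ntd_nodes (Join l r). card (ntd_bag (Join l r) p) = max b b'"
  proof -
    obtain p q where "p \<in> ntd_nodes l" "card (ntd_bag l p) = b" "q \<in> ntd_nodes r" "card (ntd_bag r q) = b'"
      using IH(4,6) by blast
    then show ?thesis
      by (cases "b \<le> b'") (auto intro: bexI[of _ "True # q"] bexI[of _ "False # p"])
  qed
  moreover have "\<forall>p\<in>ntd_nodes (Join l r). card (ntd_bag (Join l r) p) \<le> max b b'"
    using IH(3)[of "[]"] IH(3,5) by (auto simp: le_max_iff_disj)
  ultimately show ?case using IH(1,2) by (simp add: m')
qed

lemma ntd_width_eq:
  assumes "ntd_wf t"
  shows "ntd_width t = snd (max_bag t) - 1"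
proof -
  have "Max ((\<lambda>p. card (ntd_bag t p)) ` ntd_nodes t) = snd (max_bag t)"
  proof (rule Max_eqI)
    show "snd (max_bag t) \<in> (\<lambda>p. card (ntd_bag t p)) ` ntd_nodes t"
      using max_bag[OF assms] by (metis imageI)
  qed (use max_bag[OF assms] in auto)
  then show ?thesis unfolding ntd_width_def td_width_def ntd_tree_def by simp
qed

definition max_degree_list :: "('a \<times> 'a) list \<Rightarrow> 'a list \<Rightarrow> nat" where
  "max_degree_list es vs = foldl max 0 (map (\<lambda>v. length (filter (adj_list es v) vs)) vs)"

lemma max_degree_list_eq:
  assumes "set vs = verts G" "distinct vs" "(\<lambda>(u, v). {u, v}) ` set es = edges G"
  shows "max_degree_list es vs = max_degree G"
proof -
  have "length (filter (adj_list es v) vs) = degree_of G v" for v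
    using assms distinct_card[of "filter (adj_list es v) vs"]
    by (simp add: degree_of_def adj_list_iff[OF assms(3)])
  then have "max_degree_list es vs = foldl max 0 (map (degree_of G) vs)"
    by (simp add: max_degree_list_def)
  also have "\<dots> = fold max (map (degree_of G) vs) 0"
    by (simp add: foldl_conv_fold max.commute fun_eq_iff cong: fold_cong)
  also have "\<dots> = Max (set (0 # map (degree_of G) vs))" by (simp only: Max.set_eq_fold)
  finally show ?thesis using assms(1) by (simp add: max_degree_def)
qed

definition query_list :: "('a \<times> 'a) list \<Rightarrow> 'a list \<times> 'a list \<Rightarrow> 'a list \<times> ('a \<times> 'a) list" where
  "query_list es p = (fst p, filter (\<lambda>e. fst e \<in> set (fst p) \<and> snd e \<in> set (fst p)) es @
     filter (\<lambda>e. fst e \<noteq> snd e) (List.product (snd p) (snd p)))"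

definition graph_of :: "'a list \<times> ('a \<times> 'a) list \<Rightarrow> 'a graph" where
  "graph_of q = (set (fst q), (\<lambda>(u, v). {u, v}) ` set (snd q))"

lemma graph_of_query_list:
  assumes "(\<lambda>(u, v). {u, v}) ` set es = edges G"
  shows "graph_of (query_list es (V, X)) = query_graph G (set V) (set X)"
proof -
  have "(\<lambda>(u, v). {u, v}) ` {e \<in> set es. fst e \<in> set V \<and> snd e \<in> set V} = {e \<in> edges G. e \<subseteq> set V}"
    unfolding assms[symmetric] by auto
  moreover have "(\<lambda>(u, v). {u, v}) ` {e \<in> set X \<times> set X. fst e \<noteq> snd e} =
      {{u, v} | u v. u \<in> set X \<and> v \<in> set X \<and> u \<noteq> v}"
    by (rule set_eqI) (simp add: image_iff Bex_def, blast)
  ultimately show ?thesis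
    by (simp add: graph_of_def query_list_def query_graph_def image_Un)
qed

text \<open>Without edges the allowed query size is 0, so nothing is asked. If no cut happens, the
  graph has at most \<open>s\<close> vertices and is queried whole, with an empty anchor list.
  Otherwise the leftover \<open>(W, A)\<close> at the root counts as one more piece, and
  \<open>r\<close> joins every piece and every boundary.\<close>

definition plan :: "nat \<Rightarrow> ('a list \<times> ('a \<times> 'a) list) \<times> 'a ntd \<Rightarrow>
    'a list \<times> ('a list \<times> ('a \<times> 'a) list) list" where
  "plan K x = (case x of ((vs, es), T) \<Rightarrow> if es = [] then ([], []) else (case vs of [] \<Rightarrow> ([], []) | r # _ \<Rightarrow>
     (case split_ntd (K * (snd (max_bag T) * max_degree_list es vs)) T of (B, W, A, P) \<Rightarrow>
       if P = [] then ([], [(vs, es)])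
       else (concat (map (\<lambda>p. r # snd p) ((W, A) # P)),
         map (\<lambda>p. query_list es (if r \<in> set (fst p) then fst p else r # fst p, r # snd p)) ((W, A) # P)))))"

text \<open>The three outcomes of \<open>plan\<close> are told apart by its data: no answers means
  no edges, and no anchors means that the single answer is already a solution for the whole
  graph.\<close>

definition assemble :: "(('a list \<times> ('a \<times> 'a) list) \<times> 'a ntd) \<times> 'a list \<Rightarrow> 'a list list \<Rightarrow> 'a list" where
  "assemble c as = (case c of (((vs, es), T), A) \<Rightarrow> if as = [] then vs else (case A of [] \<Rightarrow> concat as
     | r # _ \<Rightarrow> connect es vs A r (A @ concat as)))"

text \<open>This does not presuppose a connected graph: for infeasible inputs it already gives
  everything that \<open>cds_approx\<close> demands.\<close>

lemma component_subset:
  assumes "r \<in> set vs" "distinct vs"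
  shows "set (component es vs R r) \<subseteq> set vs \<and> distinct (component es vs R r)"
proof -
  have "set (foldl (\<lambda>C _. filter (h C) vs) C xs) \<subseteq> set vs \<and> distinct (foldl (\<lambda>C _. filter (h C) vs) C xs)"
    if "set C \<subseteq> set vs" "distinct C" for C h and xs :: "'b list"
    using that assms(2) by (induction xs arbitrary: C) auto
  from this[of "[r]"] show ?thesis using assms unfolding component_def by simp
qed

section \<open>Correctness for graphs with at least one edge\<close>

locale kernel_input =
  fixes G :: "'a graph" and T :: "'a ntd" and vs :: "'a list" and es :: "('a \<times> 'a) list" and K :: nat
  assumes G: "simple_graph G" and T: "nice_tree_decomposition G T" "ntd_width T = treewidth G"
    and vs: "set vs = verts G" "distinct vs" and es: "(\<lambda>(u, v). {u, v}) ` set es = edges G"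
    and K: "2 \<le> K" and nonempty: "es \<noteq> []"
begin

definition "\<Delta> = max_degree G"
definition "b = snd (max_bag T)"
definition "s = K * (b * \<Delta>)"

lemma edge: "\<exists>u v. adj G u v \<and> u \<noteq> v \<and> u \<in> verts G \<and> v \<in> verts G"
proof -
  obtain u v where "(u, v) \<in> set es" using nonempty by (cases es) auto
  then have "{u, v} \<in> edges G" unfolding es[symmetric] by force
  moreover from this have "card {u, v} = 2" "{u, v} \<subseteq> verts G" using G by (auto simp: simple_graph_def)
  then have "u \<noteq> v" by auto
  ultimately show ?thesis using \<open>{u, v} \<subseteq> verts G\<close> unfolding adj_def by blast
qed

lemma \<Delta>_pos: "1 \<le> \<Delta>"
proof -
  obtain u v where "adj G u v" "u \<in> verts G" "v \<in> verts G" using edge by blast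
  then have "{w \<in> verts G. adj G u w} \<noteq> {}" by blast
  then have "1 \<le> degree_of G u" using G unfolding degree_of_def
    by (simp add: Suc_le_eq card_gt_0_iff simple_graph_def)
  then show ?thesis using degree_le_max_degree[OF G \<open>u \<in> verts G\<close>] unfolding \<Delta>_def by simp
qed

lemmas decomposition = nice_tree_decompositionD[OF T(1)]

lemma bag_le: "p \<in> ntd_nodes T \<Longrightarrow> card (ntd_bag T p) \<le> b"
  using max_bag[OF decomposition(1)] unfolding b_def by blast

text \<open>Some bag contains both ends of an edge. Consequently the treewidth is at least 1, and
  \<open>b = tw + 1\<close> is at most twice the treewidth.\<close>

lemma b_ge_2: "2 \<le> b"
proof -
  obtain u v where uv: "adj G u v" "u \<noteq> v" using edge by blast
  then obtain p where p: "p \<in> ntd_nodes T" "{u, v} \<subseteq> ntd_bag T p"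
    using decomposition(5) unfolding share_bag_def by blast
  have "card {u, v} \<le> card (ntd_bag T p)" by (rule card_mono[OF _ p(2)]) (simp add: ntd_bag_def)
  then show ?thesis using bag_le[OF p(1)] uv(2) by simp
qed

lemma b_eq: "b = treewidth G + 1"
  using T(2) ntd_width_eq[OF decomposition(1)] b_ge_2 unfolding b_def by simp

text \<open>The role of \<open>K \<ge> 2\<close>: since a cut keeps at most \<open>b\<close>
  vertices, it retires at least half of \<open>s\<close>.\<close>

lemma b_le_s: "2 * b \<le> s"
proof -
  have "2 * (b * 1) \<le> K * (b * \<Delta>)" by (intro mult_mono K \<Delta>_pos) auto
  then show ?thesis by (simp add: s_def)
qed

lemma split: "split_invs T b s s (split_ntd s T)"
  by (rule split_invs_split_ntd[OF decomposition(1) decomposition(3) bag_le]) (use b_le_s b_ge_2 in auto)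

definition "r = hd vs"

lemma vs_Cons: "vs = r # tl vs"
proof -
  have "vs \<noteq> []" using edge vs by auto
  then show ?thesis by (simp add: r_def)
qed

lemma plan_eq: "plan K ((vs, es), T) = (case split_ntd s T of (B, W, A, P) \<Rightarrow>
       if P = [] then ([], [(vs, es)])
       else (concat (map (\<lambda>p. r # snd p) ((W, A) # P)),
         map (\<lambda>p. query_list es (if r \<in> set (fst p) then fst p else r # fst p, r # snd p)) ((W, A) # P)))"
  using nonempty vs_Cons
  unfolding plan_def s_def b_def \<Delta>_def max_degree_list_eq[OF vs es, symmetric]
  by (cases vs) auto

end

text \<open>All pieces of the decomposition, the one left over at the root included, with the
  vertex \<open>r\<close> added to both parts: it makes the second parts nonempty.\<close>

locale kernel_split = kernel_input +
  fixes B W A P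
  assumes split_eq: "split_ntd s T = (B, W, A, P)"
begin

sublocale split_inv T b s s B W A P
  using split unfolding split_eq split_invs_def by simp

definition "vpart p = (if r \<in> set (fst p) then fst p else r # fst p)"
definition "query p = query_list es (vpart p, r # snd p)"
definition "pieces = (W, A) # P"
definition "anchors = concat (map (\<lambda>p. r # snd p) pieces)"

lemma r_in: "r \<in> verts G"
  using vs_Cons vs(1) by (metis list.set_intros(1))

lemma pieces_props:
  assumes "p \<in> set pieces"
  shows "set (snd p) \<subseteq> set (fst p)" "distinct (fst p)" "length (fst p) \<le> 2 * s" "set (fst p) \<subseteq> verts G"
    "\<And>u v. u \<in> set (fst p) \<Longrightarrow> u \<notin> set (snd p) \<Longrightarrow> adj G u v \<Longrightarrow> v \<in> set (fst p)"
proof -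
  have *: "p = (W, A) \<or> (fst p, snd p) \<in> set P" using assms unfolding pieces_def by auto
  then show "set (snd p) \<subseteq> set (fst p)" "distinct (fst p)" "length (fst p) \<le> 2 * s"
    using piece[of "fst p" "snd p"] boundary_subset distinct_rest length_rest by auto
  show "set (fst p) \<subseteq> verts G"
    using * piece_covered[of "fst p" "snd p"] rest_covered decomposition(4) by auto
  show "v \<in> set (fst p)" if "u \<in> set (fst p)" "u \<notin> set (snd p)" "adj G u v" for u v
    using * that(1,2) decomposition(5)[OF that(3)] rest_closed piece_closed[of "fst p" "snd p"] by auto
qed

lemma vpart: "set (vpart p) = insert r (set (fst p))"
  by (auto simp: vpart_def)

lemma graph_of_query: "graph_of (query p) = query_graph G (insert r (set (fst p))) (insert r (set (snd p)))"
  unfolding query_def by (simp add: graph_of_query_list[OF es] vpart)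

lemma query_props:
  assumes "p \<in> set pieces"
  shows "distinct (fst (query p))" "simple_graph (graph_of (query p))"
    "card (verts (graph_of (query p))) \<le> 2 * s + 1"
proof -
  show "distinct (fst (query p))"
    using pieces_props(2)[OF assms] by (simp add: query_def query_list_def vpart_def)
  show "simple_graph (graph_of (query p))"
    unfolding graph_of_query
    by (rule simple_query_graph[OF G]) (use pieces_props(1,4)[OF assms] r_in in auto)
  have "card (insert r (set (fst p))) \<le> length (r # fst p)"
    using card_length[of "r # fst p"] by simp
  then show "card (verts (graph_of (query p))) \<le> 2 * s + 1"
    using pieces_props(3)[OF assms] by (simp add: graph_of_query)
qed

lemma cds_query_part:
  assumes "connected_dominating_set G Y" "p \<in> set pieces"
  shows "connected_dominating_set (graph_of (query p)) (Y \<inter> insert r (set (fst p)) \<union> insert r (set (snd p)))"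
  unfolding graph_of_query
  by (rule cds_query_graph[OF assms(1)]) (use pieces_props[OF assms(2)] r_in in auto)

text \<open>The constant is 4 times 4: there are at most \<open>4 * b * length P\<close> anchors,
  and \<open>K * b * length P\<close> is at most \<open>4 * card Y\<close>.\<close>

lemma anchors_length:
  assumes "P \<noteq> []" "connected_dominating_set G Y"
  shows "K * length anchors \<le> 16 * card Y"
proof -
  \<comment> \<open>The summand \<open>length P + 1\<close> counts the copies of \<open>r\<close>,
    one per piece and one for the leftover.\<close>
  have "length anchors = sum_list (map (\<lambda>p. length (snd p)) P) + length A + length P + 1"
    unfolding anchors_def pieces_def by (simp add: length_concat comp_def sum_list_Suc)
  also have "\<dots> \<le> 2 * b * length P + length P + 1" using count_boundaries by simp
  also have "\<dots> \<le> 4 * b * length P"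
  proof -
    have "1 \<le> length P" using assms(1) by (cases P) auto
    moreover have "2 * length P \<le> b * length P" using b_ge_2 by (rule mult_right_mono) simp
    moreover have "2 * b * length P = 2 * (b * length P)" "4 * b * length P = 4 * (b * length P)"
      by simp_all
    ultimately show ?thesis by linarith
  qed
  finally have a: "length anchors \<le> 4 * b * length P" .
  have "\<Delta> * (K * b * length P) \<le> 2 * (length P * (s - b))"
  proof -
    \<comment> \<open>\<open>s\<close> is at most twice \<open>s - b\<close>; this is the first
      factor 2.\<close>
    have "length P * s \<le> length P * (2 * (s - b))" using b_le_s by (intro mult_left_mono) auto
    then show ?thesis unfolding s_def by (simp add: algebra_simps)
  qed
  also have "length P * (s - b) \<le> card (verts G)"
    using count_pieces decomposition(4) by simp
  also have "card (verts G) \<le> (\<Delta> + 1) * card Y"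
    using card_verts_le[OF G assms(2)] by (simp add: \<Delta>_def)
  \<comment> \<open>The second factor 2; it lets \<Delta> cancel against the \<Delta> contained in
    \<open>s\<close>.\<close>
  also have "\<Delta> + 1 \<le> 2 * \<Delta>" using \<Delta>_pos by simp
  finally have "\<Delta> * (K * b * length P) \<le> \<Delta> * (4 * card Y)" by (simp add: algebra_simps)
  then have "K * b * length P \<le> 4 * card Y" using \<Delta>_pos by simp
  moreover have "K * length anchors \<le> K * (4 * b * length P)" using a by (rule mult_left_mono) simp
  moreover have "K * (4 * b * length P) = 4 * (K * b * length P)" by simp
  ultimately show ?thesis by linarith
qed

text \<open>A vertex of \<open>Y\<close> is paid for in at most one piece, apart from the
  boundaries; this keeps the optimum with coefficient 1 in the total cost.\<close>

lemma core_sum: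
  assumes "finite Y" "Y \<subseteq> verts G"
  shows "(\<Sum>p\<leftarrow>pieces. card (Y \<inter> (set (fst p) - set (snd p)))) \<le> card Y"
proof -
  have "(\<Sum>p\<leftarrow>P. card (Y \<inter> (set (fst p) - set (snd p)))) \<le> card (Y \<inter> (covered_set T - set W))"
    using cores_disjoint[OF assms(1)] by (simp add: case_prod_unfold)
  moreover have "card (Y \<inter> (set W - set A)) + card (Y \<inter> (covered_set T - set W)) =
      card (Y \<inter> (set W - set A) \<union> Y \<inter> (covered_set T - set W))"
    by (rule card_Un_disjoint[symmetric]) (use assms in auto)
  moreover have "\<dots> \<le> card Y" by (rule card_mono) (use assms in auto)
  ultimately show ?thesis by (simp add: pieces_def)
qed

text \<open>With \<open>a\<close> anchors and optimum \<open>n\<close>, the answers cost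
  \<open>c * (n + a)\<close>, the anchors themselves \<open>a\<close> and the repair
  \<open>2 * a\<close>. As \<open>c \<ge> 1\<close>, the total is at most
  \<open>c * (n + 4 * a)\<close>, and \<open>K * a \<le> 16 * n\<close> produces the 64.\<close>

lemma connect_answers:
  fixes c :: real
  assumes P: "P \<noteq> []" and Y: "connected_dominating_set G Y" and c: "1 \<le> c"
    and ans: "\<And>p. p \<in> set pieces \<Longrightarrow> distinct (ans (query p)) \<and>
      cds_approx c (graph_of (query p)) (set (ans (query p)))"
    and D: "D = anchors @ concat (rev (map ans (map query pieces)))"
  shows "connected_dominating_set G (set (connect es vs anchors r D))"
    and "real K * real (card (set (connect es vs anchors r D))) \<le> c * (real K + 64) * real (cds_opt G)"
proof -
  have cds: "connected_dominating_set (graph_of (query p)) (set (ans (query p)))"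
    and opt: "real (card (set (ans (query p)))) \<le> c * real (cds_opt (graph_of (query p)))"
    if "p \<in> set pieces" for p
    using ans[OF that] cds_query_part[OF Y that] unfolding cds_approx_def by blast+
  have sub: "set (ans (query p)) \<subseteq> insert r (set (fst p))" if "p \<in> set pieces" for p
    using cds[OF that] by (simp add: cds_iff graph_of_query)
  have setD: "set D = set anchors \<union> (\<Union>p\<in>set pieces. set (ans (query p)))"
    unfolding D by auto
  have anch: "set anchors = (\<Union>p\<in>set pieces. insert r (set (snd p)))"
    unfolding anchors_def by auto
  have r: "r \<in> set anchors" unfolding anch pieces_def by auto
  have DG: "set D \<subseteq> verts G"
    unfolding setD anch using sub r_in pieces_props(1,4) by blast
  have dom: "v \<in> set D \<or> (\<exists>u\<in>set D. adj G u v)" if "v \<in> verts G" for v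
  proof -
    have "v \<in> set W \<union> (\<Union>p\<in>set P. set (fst p))" using that covered decomposition(4) by simp
    then obtain p where p: "p \<in> set pieces" "v \<in> set (fst p)" unfolding pieces_def by fastforce
    have "v \<in> set (ans (query p)) \<union> insert r (set (snd p)) \<or> (\<exists>u\<in>set (ans (query p)). adj G u v)"
      by (rule query_graph_dominated[OF cds[OF p(1), unfolded graph_of_query]]) (use p in simp)
    then show ?thesis unfolding setD anch using p(1) by blast
  qed
  have anchor: "\<exists>a\<in>set anchors. reach G (set D) d a" if d: "d \<in> set D" for d
  proof (cases "d \<in> set anchors")
    case True
    then show ?thesis by (rule bexI[rotated]) (rule reach_refl)
  next
    case False
    then obtain p where p: "p \<in> set pieces" "d \<in> set (ans (query p))" using d unfolding setD by blast
    have "\<exists>x\<in>insert r (set (snd p)). reach G (set (ans (query p)) \<union> insert r (set (snd p))) d x"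
      by (rule query_graph_reach[OF cds[OF p(1), unfolded graph_of_query] _ _ p(2)])
         (use pieces_props(1)[OF p(1)] in auto)
    then obtain x where x: "x \<in> insert r (set (snd p))"
      "reach G (set (ans (query p)) \<union> insert r (set (snd p))) d x" by blast
    have "reach G (set D) d x" using x(2) by (rule reach_mono) (use p(1) in \<open>auto simp: setD anch\<close>)
    then show ?thesis using x(1) p(1) unfolding anch by blast
  qed
  have AD: "set anchors \<subseteq> set D" unfolding setD by blast
  have rD: "r \<in> set D" using r AD by blast
  note result = connect_correct[OF G vs(1) es cds_reach[OF Y] rD DG dom anchor AD]
  show "connected_dominating_set G (set (connect es vs anchors r D))" by (rule result(1))
  \<comment> \<open>\<open>Y\<close> only witnesses feasibility; costs are compared with an optimal
    \<open>Z\<close>.\<close>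
  obtain Z where Z: "connected_dominating_set G Z" "card Z = cds_opt G"
    using cds_opt_attained[OF G Y] by blast
  have Z': "Z \<subseteq> verts G" "finite Z"
    using Z(1) G by (auto simp: cds_iff simple_graph_def intro: finite_subset)
  have one: "real (length (ans (query p))) \<le>
      c * (real (card (Z \<inter> (set (fst p) - set (snd p)))) + real (length (r # snd p)))"
    if p: "p \<in> set pieces" for p
  proof -
    have "cds_opt (graph_of (query p)) \<le> card (Z \<inter> insert r (set (fst p)) \<union> insert r (set (snd p)))"
      by (rule cds_opt_le[OF query_props(2)[OF p] cds_query_part[OF Z(1) p]])
    also have "Z \<inter> insert r (set (fst p)) \<union> insert r (set (snd p)) \<subseteq>
        Z \<inter> (set (fst p) - set (snd p)) \<union> set (r # snd p)" by auto
    then have "card (Z \<inter> insert r (set (fst p)) \<union> insert r (set (snd p))) \<le>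
        card (Z \<inter> (set (fst p) - set (snd p)) \<union> set (r # snd p))"
      by (rule card_mono[rotated]) (use Z'(2) in simp)
    also have "\<dots> \<le> card (Z \<inter> (set (fst p) - set (snd p))) + card (set (r # snd p))"
      by (rule card_Un_le)
    also have "card (set (r # snd p)) \<le> length (r # snd p)" by (rule card_length)
    finally have "real (cds_opt (graph_of (query p))) \<le>
        real (card (Z \<inter> (set (fst p) - set (snd p)))) + real (length (r # snd p))" by linarith
    then have "c * real (cds_opt (graph_of (query p))) \<le>
        c * (real (card (Z \<inter> (set (fst p) - set (snd p)))) + real (length (r # snd p)))"
      using c by (intro mult_left_mono) auto
    moreover have "length (ans (query p)) = card (set (ans (query p)))"
      using ans[OF p] distinct_card by metis
    ultimately show ?thesis using opt[OF p] by simp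
  qed
  have sum: "real (sum_list (map (\<lambda>p. length (ans (query p))) ps)) \<le>
      c * (real (\<Sum>p\<leftarrow>ps. card (Z \<inter> (set (fst p) - set (snd p)))) +
        real (sum_list (map (\<lambda>p. length (r # snd p)) ps)))"
    if "set ps \<subseteq> set pieces" for ps
    using that
  proof (induction ps)
    case (Cons p ps)
    then show ?case using one[of p] by (simp add: algebra_simps)
  qed simp
  have len: "length (concat (rev (map ans (map query pieces)))) = sum_list (map (\<lambda>p. length (ans (query p))) pieces)"
    by (simp add: length_concat rev_map[symmetric] sum_list_rev comp_def)
  have lena: "sum_list (map (\<lambda>p. length (r # snd p)) pieces) = length anchors"
    unfolding anchors_def by (simp add: length_concat comp_def)
  let ?a = "real (length anchors)" and ?n = "real (cds_opt G)"
  have "real (length (concat (rev (map ans (map query pieces))))) \<le> c * (?n + ?a)"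
  proof -
    have "c * (real (\<Sum>p\<leftarrow>pieces. card (Z \<inter> (set (fst p) - set (snd p)))) + ?a) \<le> c * (?n + ?a)"
      using c core_sum[OF Z'(2,1)] Z(2) by (intro mult_left_mono add_mono) auto
    then show ?thesis using sum[of pieces] len lena by simp
  qed
  moreover have "real (card (set (connect es vs anchors r D))) \<le> real (length D + 2 * length anchors)"
    using result(2) by (simp only: of_nat_le_iff)
  ultimately have "real (card (set (connect es vs anchors r D))) \<le> c * (?n + ?a) + 3 * ?a"
    unfolding D by simp
  also have "\<dots> \<le> c * (?n + 4 * ?a)"
    using mult_right_mono[OF c, of "3 * ?a"] by (simp add: algebra_simps)
  finally have "real K * real (card (set (connect es vs anchors r D))) \<le> real K * (c * (?n + 4 * ?a))"
    by (rule mult_left_mono) simp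
  also have "\<dots> = c * (real K * ?n + 4 * (real K * ?a))" by (simp add: algebra_simps)
  also have "\<dots> \<le> c * (real K * ?n + 4 * (16 * ?n))"
  proof -
    have "real (K * length anchors) \<le> real (16 * cds_opt G)"
      using anchors_length[OF P Z(1)] Z(2) by (simp only: of_nat_le_iff)
    then show ?thesis using c by (intro mult_left_mono add_left_mono) auto
  qed
  also have "\<dots> = c * (real K + 64) * ?n" by (simp add: algebra_simps)
  finally show "real K * real (card (set (connect es vs anchors r D))) \<le> c * (real K + 64) * ?n" .
qed

end

context kernel_input
begin

lemma plan_queries:
  assumes "plan K ((vs, es), T) = (A, qs)" "q \<in> set qs"
  shows "distinct (fst q)" "simple_graph (graph_of q)" "card (verts (graph_of q)) \<le> 2 * s + 1"
proof -
  obtain B W A' P where split_eq: "split_ntd s T = (B, W, A', P)" by (cases "split_ntd s T")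
  interpret kernel_split G T vs es K B W A' P by unfold_locales (fact split_eq)
  have *: "distinct (fst q) \<and> simple_graph (graph_of q) \<and> card (verts (graph_of q)) \<le> 2 * s + 1"
  proof (cases "P = []")
    case True
    then have q: "q = (vs, es)" using assms by (auto simp: plan_eq split_eq)
    have "graph_of q = G" using vs es by (simp add: graph_of_def q prod_eq_iff)
    \<comment> \<open>Nothing was cut off, so \<open>W\<close> still holds every vertex, and it is
      shorter than the threshold allows.\<close>
    moreover have "verts G = set W" using covered decomposition(4) True by simp
    then have "card (verts G) \<le> s" using length_rest card_length[of W] by simp
    ultimately show ?thesis using q vs G by simp
  next
    case False
    then have "q \<in> query ` set pieces"
      using assms by (auto simp: plan_eq split_eq pieces_def query_def vpart_def)
    then show ?thesis using query_props by blast
  qed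
  then show "distinct (fst q)" "simple_graph (graph_of q)" "card (verts (graph_of q)) \<le> 2 * s + 1"
    by auto
qed

lemma assemble_approx:
  fixes c :: real
  assumes plan: "plan K ((vs, es), T) = (A, qs)" and c: "1 \<le> c"
    and ans: "\<And>q. q \<in> set qs \<Longrightarrow> distinct (ans q) \<and> cds_approx c (graph_of q) (set (ans q))"
  shows "distinct (assemble (((vs, es), T), A) (rev (map ans qs)))"
    and "cds_approx (c * (1 + 64 / real K)) G (set (assemble (((vs, es), T), A) (rev (map ans qs))))"
proof -
  obtain B W A' P where split_eq: "split_ntd s T = (B, W, A', P)" by (cases "split_ntd s T")
  interpret kernel_split G T vs es K B W A' P by unfold_locales (fact split_eq)
  have "distinct (assemble (((vs, es), T), A) (rev (map ans qs))) \<and>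
      cds_approx (c * (1 + 64 / real K)) G (set (assemble (((vs, es), T), A) (rev (map ans qs))))"
  proof (cases "P = []")
    case True
    then have q: "qs = [(vs, es)]" "A = []" using plan by (simp_all add: plan_eq split_eq)
    have "graph_of (vs, es) = G" using vs es by (simp add: graph_of_def prod_eq_iff)
    then have a: "distinct (ans (vs, es))" "cds_approx c G (set (ans (vs, es)))"
      using ans[of "(vs, es)"] q by auto
    have "c * real (cds_opt G) \<le> c * (1 + 64 / real K) * real (cds_opt G)"
      using c by (intro mult_right_mono) auto
    then have "cds_approx (c * (1 + 64 / real K)) G (set (ans (vs, es)))"
      using a(2) unfolding cds_approx_def by (meson order_trans)
    then show ?thesis using q a(1) by (simp add: assemble_def)
  next
    case False
    then have q: "qs = map query pieces" "A = anchors"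
      using plan unfolding plan_eq split_eq pieces_def anchors_def query_def[abs_def] vpart_def
      by simp_all
    have A: "anchors \<noteq> []" "hd anchors = r" by (simp_all add: anchors_def pieces_def)
    have out: "assemble (((vs, es), T), A) (rev (map ans qs)) =
        connect es vs anchors r (anchors @ concat (rev (map ans (map query pieces))))"
      using A by (simp add: assemble_def q list.case_eq_if) (simp add: pieces_def)
    have "r \<in> set vs" using r_in vs(1) by simp
    from component_subset[OF this vs(2)] have sub: "set (connect es vs anchors r D) \<subseteq> verts G"
      "distinct (connect es vs anchors r D)" for D
      unfolding connect_def vs(1) by blast+
    have "connected_dominating_set G (set (connect es vs anchors r D)) \<and>
        real (card (set (connect es vs anchors r D))) \<le> c * (1 + 64 / real K) * real (cds_opt G)"
      if Y: "connected_dominating_set G Y" and D: "D = anchors @ concat (rev (map ans (map query pieces)))"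
      for Y D
    proof
      have ans': "distinct (ans (query p)) \<and> cds_approx c (graph_of (query p)) (set (ans (query p)))"
        if "p \<in> set pieces" for p
        using ans that q(1) by simp
      note res = connect_answers[OF False Y c ans' D]
      show "connected_dominating_set G (set (connect es vs anchors r D))" by (rule res(1))
      have "real K > 0" using K by simp
      then show "real (card (set (connect es vs anchors r D))) \<le> c * (1 + 64 / real K) * real (cds_opt G)"
        using res(2) by (simp add: field_simps)
    qed
    then show ?thesis using sub out unfolding cds_approx_def by metis
  qed
  then show "distinct (assemble (((vs, es), T), A) (rev (map ans qs)))"
    "cds_approx (c * (1 + 64 / real K)) G (set (assemble (((vs, es), T), A) (rev (map ans qs))))"
    by auto
qed

end

section \<open>Polynomial running time\<close>

lemma polytime_comp2:
  assumes "polytime (\<lambda>z. f (fst z) (snd z))" "polytime g" "polytime h"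
  shows "polytime (\<lambda>x. f (g x) (h x))"
  using polytime_comp[OF assms(1) polytime_Pair[OF assms(2,3)]] by simp

lemma polytime_comp3:
  assumes "polytime (\<lambda>z. f (fst z) (fst (snd z)) (snd (snd z)))" "polytime g" "polytime h" "polytime i"
  shows "polytime (\<lambda>x. f (g x) (h x) (i x))"
  using polytime_comp[OF assms(1), of "\<lambda>x. (g x, h x, i x)"] assms(2-4) by (simp add: polytime_intros)

lemma polytime_comp4:
  assumes "polytime (\<lambda>z. f (fst z) (fst (snd z)) (fst (snd (snd z))) (snd (snd (snd z))))" "polytime g" "polytime h" "polytime i" "polytime j"
  shows "polytime (\<lambda>x. f (g x) (h x) (i x) (j x))"
  using polytime_comp[OF assms(1), of "\<lambda>x. (g x, h x, i x, j x)"] assms(2-5) by (simp add: polytime_intros)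

lemma polytime_comp5:
  assumes "polytime (\<lambda>z. f (fst z) (fst (snd z)) (fst (snd (snd z))) (fst (snd (snd (snd z)))) (snd (snd (snd (snd z)))))"
    "polytime g" "polytime h" "polytime i" "polytime j" "polytime k"
  shows "polytime (\<lambda>x. f (g x) (h x) (i x) (j x) (k x))"
  using polytime_comp[OF assms(1), of "\<lambda>x. (g x, h x, i x, j x, k x)"] assms(2-6) by (simp add: polytime_intros)

lemma polytime_adj_list [polytime_intros]:
  assumes "polytime f" "polytime g" "polytime h"
  shows "polytime (\<lambda>x. adj_list (f x :: (dat \<times> dat) list) (g x) (h x))"
proof (rule polytime_comp3[OF _ assms])
  show "polytime (\<lambda>z. adj_list (fst z :: (dat \<times> dat) list) (fst (snd z)) (snd (snd z)))"
    unfolding adj_list_def by (intro polytime_intros)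
qed

lemma polytime_component [polytime_intros]:
  assumes "polytime f" "polytime g" "polytime h" "polytime k"
  shows "polytime (\<lambda>x. component (f x :: (dat \<times> dat) list) (g x) (h x) (k x))"
proof (rule polytime_comp4[OF _ assms])
  let ?v = "\<lambda>z :: (dat \<times> dat) list \<times> dat list \<times> dat list \<times> dat. fst (snd z)"
  let ?r = "\<lambda>z :: (dat \<times> dat) list \<times> dat list \<times> dat list \<times> dat. snd (snd (snd z))"
  \<comment> \<open>Every round returns a sublist of \<open>vs\<close>, so sizes do not
    accumulate.\<close>
  have size: "esize (foldl (\<lambda>C _. filter (h C) vs) C xs) \<le> esize C + esize vs"
    for h and vs C :: "dat list" and xs :: "dat list"
    by (induction xs rule: rev_induct) (auto intro: le_trans[OF esize_filter])
  show "polytime (\<lambda>z. component (fst z :: (dat \<times> dat) list) (fst (snd z)) (fst (snd (snd z))) (snd (snd (snd z))))"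
    unfolding component_def
  proof (rule polytime_foldl[where q = "[:0, 1:]"])
    fix z :: "(dat \<times> dat) list \<times> dat list \<times> dat list \<times> dat" and n
    have "esize [?r z] + esize (?v z) \<le> poly [:0, 1:] (esize z)"
      by (cases z) simp
    from le_trans[OF size this] show "esize (foldl (\<lambda>C _. filter (\<lambda>v. v \<in> set C \<or> v \<in> set (fst (snd (snd z))) \<and>
        list_ex (\<lambda>u. adj_list (fst z) u v) C) (?v z)) [?r z] (take n (?v z))) \<le> poly [:0, 1:] (esize z)"
      .
  qed (intro polytime_intros)+
qed

lemma polytime_augment [polytime_intros]:
  assumes "polytime f" "polytime g" "polytime h" "polytime k" "polytime l"
  shows "polytime (\<lambda>x. augment (f x :: (dat \<times> dat) list) (g x) (h x) (k x) (l x))"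
proof (rule polytime_comp5[OF _ assms])
  show "polytime (\<lambda>z. augment (fst z :: (dat \<times> dat) list) (fst (snd z)) (fst (snd (snd z)))
      (fst (snd (snd (snd z)))) (snd (snd (snd (snd z)))))"
    unfolding augment_def by (intro polytime_intros)
qed

text \<open>Two members of \<open>vs\<close> are added at most, so the fold in
  \<open>connect\<close> grows additively.\<close>

lemma esize_augment:
  fixes es :: "(dat \<times> dat) list"
  shows "esize (augment es vs A r R) \<le> esize R + 2 * esize vs"
proof -
  let ?f = "filter (\<lambda>p. list_ex (\<lambda>a. a \<notin> set (component es vs R r) \<and>
       a \<in> set (component es vs (fst p # snd p # R) r)) A) (List.product vs vs)"
  show ?thesis
  proof (cases ?f)
    case (Cons p ps)
    then have "p \<in> set ?f" by simp
    then have "fst p \<in> set vs" "snd p \<in> set vs" by auto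
    then have "esize (fst p) < esize vs" "esize (snd p) < esize vs" using esize_mem[of "fst p" vs] esize_mem[of "snd p" vs] by simp_all
    then show ?thesis unfolding augment_def Cons by simp
  qed (simp add: augment_def)
qed

lemma polytime_connect [polytime_intros]:
  assumes "polytime f" "polytime g" "polytime h" "polytime k" "polytime l"
  shows "polytime (\<lambda>x. connect (f x :: (dat \<times> dat) list) (g x) (h x) (k x) (l x))"
proof (rule polytime_comp5[OF _ assms])
  show "polytime (\<lambda>z. connect (fst z :: (dat \<times> dat) list) (fst (snd z)) (fst (snd (snd z)))
      (fst (snd (snd (snd z)))) (snd (snd (snd (snd z)))))"
    unfolding connect_def
  proof (intro polytime_component, goal_cases)
    case 3
    show ?case
    proof (rule polytime_foldl_additive[where q = "[:0, 2:]"])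
      fix z :: "(dat \<times> dat) list \<times> dat list \<times> dat list \<times> dat \<times> dat list" and R and e :: dat
      have "2 * esize (fst (snd z)) \<le> poly [:0, 2:] (esize (z, e))"
        by (cases z) simp
      from le_trans[OF esize_augment add_left_mono[OF this]] show "esize (augment (fst z) (fst (snd z)) (fst (snd (snd z))) (fst (snd (snd (snd z)))) R)
          \<le> esize R + poly [:0, 2:] (esize (z, e))"
        .
    qed (intro polytime_intros)+
  qed (intro polytime_intros)+
qed

section \<open>Size bounds for evaluating the decomposition\<close>

lemma esize_max_bag: "esize (fst (max_bag u)) \<le> esize u \<and> snd (max_bag u) \<le> esize u"
proof (induction u)
  case (Introduce v u)
  have "max_bag (Introduce v u) = (v # fst (max_bag u), max (snd (max_bag u)) (Suc (length (fst (max_bag u)))))"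
    by (simp add: max_bag_def case_prod_unfold)
  moreover have "length (fst (max_bag u)) \<le> esize (fst (max_bag u))" by (rule length_le_esize)
  ultimately show ?case using Introduce by simp
next
  case (Forget v u)
  have "max_bag (Forget v u) = (filter (\<lambda>u. u \<noteq> v) (fst (max_bag u)), snd (max_bag u))"
    by (simp add: max_bag_def case_prod_unfold)
  moreover have "esize (filter (\<lambda>u. u \<noteq> v) (fst (max_bag u))) \<le> esize (fst (max_bag u))"
    by (rule esize_filter)
  ultimately show ?case using Forget by simp
next
  case (Join l r)
  have "max_bag (Join l r) = (fst (max_bag l), max (snd (max_bag l)) (snd (max_bag r)))"
    by (simp add: max_bag_def case_prod_unfold)
  then show ?case using Join by simp
qed (simp add: max_bag_def)

lemma polytime_max_bag [polytime_intros]: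
  assumes "polytime f"
  shows "polytime (\<lambda>x. max_bag (f x :: dat ntd))"
proof -
  have "esize (max_bag u) \<le> poly [:1, 2:] (esize (x, u))" for x :: 'a and u :: "dat ntd"
    using esize_max_bag[of u] by (simp add: enc_prod_def[of "max_bag u"])
  then show ?thesis
    unfolding max_bag_def
    by (intro polytime_ntd_fold[OF _ _ _ _ assms, where q = "[:1, 2:]"] polytime_intros)
qed

lemma polytime_cut: "polytime (\<lambda>z. cut (fst z) (snd z :: dat split_state))"
  unfolding cut_def by (intro polytime_intros)

lemmas polytime_cut' [polytime_intros] = polytime_comp2[OF polytime_cut]

lemma polytime_split_introduce: "polytime (\<lambda>z. split_introduce (fst z) (fst (snd z)) (snd (snd z) :: dat split_state))"
  unfolding split_introduce_def by (intro polytime_intros)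

lemma polytime_split_forget: "polytime (\<lambda>z. split_forget (fst z) (snd z :: dat split_state))"
  unfolding split_forget_def by (intro polytime_intros)

lemma polytime_split_join: "polytime (\<lambda>z. split_join (fst z) (fst (snd z)) (snd (snd z) :: dat split_state))"
  unfolding split_join_def by (intro polytime_intros)

text \<open>The three working lists are bounded separately from \<open>P\<close>, because a cut
  copies \<open>B\<close> several times; a bound on the total size alone would be multiplied at
  every cut.\<close>

definition split_size :: "nat \<Rightarrow> nat \<Rightarrow> dat split_state \<Rightarrow> bool" where
  "split_size m k = (\<lambda>(B, W, A, P). esize B \<le> m \<and> esize W \<le> m \<and> esize A \<le> m \<and> esize P \<le> k)"

text \<open>The added entry contains \<open>W\<close>, \<open>A\<close> and \<open>B\<close>, hence
  \<open>3 * m\<close>, plus one constructor each for the pair and the list.\<close>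

lemma split_size_cut: "split_size m k st \<Longrightarrow> split_size m (k + (3 * m + 2)) (cut s st)"
  by (cases st) (auto simp: split_size_def cut_def)

text \<open>\<open>m\<close> stays fixed during the induction, so that each node pays the same
  \<open>3 * m + 2\<close> for a possible cut and the charges add up to a multiple of the tree
  size.\<close>

lemma split_size_split_ntd:
  "esize u \<le> m \<Longrightarrow> split_size (esize u) (esize u * (3 * m + 2)) (split_ntd s u)"
proof (induction u)
  case Leaf
  then show ?case by (simp add: split_ntd_def split_size_def)
next
  case (Introduce v u)
  let ?n = "esize (Introduce v u)"
  obtain B W A P where st: "split_ntd s u = (B, W, A, P)" by (cases "split_ntd s u")
  have "split_size (esize u) (esize u * (3 * m + 2)) (B, W, A, P)" using Introduce st by simp
  then have "split_size ?n (esize u * (3 * m + 2)) (v # B, v # W, A, P)"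
    by (auto simp: split_size_def)
  from split_size_cut[OF this, of s]
  have "split_size ?n (esize u * (3 * m + 2) + (3 * ?n + 2)) (split_ntd s (Introduce v u))"
    using st by (simp add: split_ntd_def split_introduce_def)
  moreover have "esize u * (3 * m + 2) + (3 * ?n + 2) \<le> (esize u + 1) * (3 * m + 2)"
    using Introduce.prems by simp
  moreover have "(esize u + 1) * (3 * m + 2) \<le> ?n * (3 * m + 2)" by (rule mult_right_mono) auto
  ultimately show ?case unfolding split_size_def by (fastforce simp: split_def)
next
  case (Forget v u)
  obtain B W A P where st: "split_ntd s u = (B, W, A, P)" by (cases "split_ntd s u")
  have "split_size (esize u) (esize u * (3 * m + 2)) (B, W, A, P)" using Forget st by simp
  moreover have "esize u * (3 * m + 2) \<le> esize (Forget v u) * (3 * m + 2)"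
    by (rule mult_right_mono) auto
  moreover have "split_ntd s (Forget v u) = (filter (\<lambda>u. u \<noteq> v) B, W, A, P)"
    using st by (simp add: split_ntd_def split_forget_def)
  moreover have "esize (filter (\<lambda>u. u \<noteq> v) B) \<le> esize B" by (rule esize_filter)
  ultimately show ?case unfolding split_size_def by simp
next
  case (Join l r)
  let ?n = "esize (Join l r)"
  obtain B W A P where st: "split_ntd s l = (B, W, A, P)" by (cases "split_ntd s l")
  obtain B' W' A' P' where st': "split_ntd s r = (B', W', A', P')" by (cases "split_ntd s r")
  have "split_size (esize l) (esize l * (3 * m + 2)) (B, W, A, P)"
    "split_size (esize r) (esize r * (3 * m + 2)) (B', W', A', P')" using Join st st' by simp_all
  then have "split_size ?n (esize l * (3 * m + 2) + esize r * (3 * m + 2))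
      (B, W @ filter (\<lambda>u. u \<notin> set W) W', A @ A', P @ P')"
    using esize_filter[of "\<lambda>u. u \<notin> set W" W'] by (simp add: split_size_def)
  from split_size_cut[OF this, of s]
  have "split_size ?n (esize l * (3 * m + 2) + esize r * (3 * m + 2) + (3 * ?n + 2)) (split_ntd s (Join l r))"
    using st st' by (simp add: split_ntd_def split_join_def)
  moreover have "esize l * (3 * m + 2) + esize r * (3 * m + 2) + (3 * ?n + 2) \<le>
      (esize l + esize r + 1) * (3 * m + 2)"
    using Join.prems by (simp add: add_mult_distrib)
  moreover have "(esize l + esize r + 1) * (3 * m + 2) \<le> ?n * (3 * m + 2)"
    by (rule mult_right_mono) auto
  ultimately show ?case unfolding split_size_def by (fastforce simp: split_def)
qed

lemma polytime_split_ntd [polytime_intros]: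
  assumes "polytime f" "polytime g"
  shows "polytime (\<lambda>x. split_ntd (f x) (g x :: dat ntd))"
  unfolding split_ntd_def
proof (rule polytime_ntd_fold[OF _ _ _ _ assms(2), where q = "[:3, 3:] + [:0, 1:] * [:2, 3:]"])
  show "polytime (\<lambda>p. split_introduce (f (fst p)) (fst (snd p)) (snd (snd p) :: dat split_state))"
    by (intro polytime_comp3[OF polytime_split_introduce] polytime_comp[OF assms(1)] polytime_intros)
  show "polytime (\<lambda>p :: 'a \<times> dat \<times> dat split_state. split_forget (fst (snd p)) (snd (snd p)))"
    by (intro polytime_comp2[OF polytime_split_forget] polytime_intros)
  show "polytime (\<lambda>p. split_join (f (fst p)) (fst (snd p)) (snd (snd p) :: dat split_state))"
    by (intro polytime_comp3[OF polytime_split_join] polytime_comp[OF assms(1)] polytime_intros)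
  fix x and u :: "dat ntd"
  obtain B W A P where st: "split_ntd (f x) u = (B, W, A, P)" by (cases "split_ntd (f x) u")
  have "split_size (esize u) (esize u * (3 * esize u + 2)) (B, W, A, P)"
    using split_size_split_ntd[of u "esize u" "f x"] st by simp
  then have "esize (split_ntd (f x) u) \<le> 3 + 3 * esize u + esize u * (3 * esize u + 2)"
    unfolding st by (simp add: split_size_def)
  also have "\<dots> = poly ([:3, 3:] + [:0, 1:] * [:2, 3:]) (esize u)" by (simp add: algebra_simps)
  also have "\<dots> \<le> poly ([:3, 3:] + [:0, 1:] * [:2, 3:]) (esize (x, u))"
    by (rule poly_nat_mono) simp
  finally show "esize (ntd_fold ([], [], [], []) (split_introduce (f x)) split_forget (split_join (f x)) u)
      \<le> poly ([:3, 3:] + [:0, 1:] * [:2, 3:]) (esize (x, u))"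
    by (simp add: split_ntd_def)
qed (intro polytime_intros)

lemma polytime_max_degree_list [polytime_intros]:
  assumes "polytime f" "polytime g"
  shows "polytime (\<lambda>x. max_degree_list (f x :: (dat \<times> dat) list) (g x))"
proof (rule polytime_comp2[OF _ assms])
  show "polytime (\<lambda>z. max_degree_list (fst z :: (dat \<times> dat) list) (snd z))"
    unfolding max_degree_list_def
    by (rule polytime_foldl_additive[where q = "[:0, 1:]"]) (intro polytime_intros | simp)+
qed

lemma polytime_query_list [polytime_intros]:
  assumes "polytime f" "polytime g"
  shows "polytime (\<lambda>x. query_list (f x :: (dat \<times> dat) list) (g x))"
proof (rule polytime_comp2[OF _ assms])
  show "polytime (\<lambda>z. query_list (fst z :: (dat \<times> dat) list) (snd z))"
    unfolding query_list_def by (intro polytime_intros)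
qed

lemma polytime_plan: "polytime (plan K :: _ \<Rightarrow> dat list \<times> (dat list \<times> (dat \<times> dat) list) list)"
  unfolding plan_def[abs_def] by (intro polytime_intros)

lemma polytime_assemble: "polytime (\<lambda>z. assemble (fst z) (snd z :: dat list list))"
  unfolding assemble_def by (intro polytime_intros)

text \<open>The encoding size of a list without repetitions depends only on its set. This bounds an
  oracle answer by its query, as \<open>exec_map_query\<close> requires.\<close>

lemma esize_subset:
  fixes xs ys :: "dat list"
  assumes "distinct xs" "distinct ys" "set xs \<subseteq> set ys"
  shows "esize xs \<le> esize ys"
proof -
  have *: "esize zs = (\<Sum>z\<in>set zs. Suc (size z))" if "distinct zs" for zs :: "dat list"
    using that by (induction zs) auto
  show ?thesis
    unfolding *[OF assms(1)] *[OF assms(2)] by (rule sum_mono2) (use assms(3) in auto)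
qed

lemma enc_dat_list: "enc (xs :: dat list) = enc_list xs"
  by (induction xs) auto

lemma encodes_graph_of:
  fixes q :: "dat list \<times> (dat \<times> dat) list"
  assumes "distinct (fst q)"
  shows "encodes_graph (enc q) (graph_of q)"
proof -
  have "enc (snd q) = enc_list (map (\<lambda>(u, v). Dot u v) (snd q))"
    by (simp add: enc_list_def enc_prod_def[abs_def] case_prod_unfold)
  then show ?thesis
    using assms unfolding encodes_graph_def encodes_set_def graph_of_def
    by (intro exI[of _ "enc (fst q)"] exI[of _ "snd q"]) (auto simp: enc_prod_def enc_dat_list)
qed

lemma cds_approx_mono:
  assumes "cds_approx \<alpha> G X" "\<alpha> \<le> \<beta>"
  shows "cds_approx \<beta> G X"
  using assms(1) mult_right_mono[OF assms(2), of "real (cds_opt G)"]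
  unfolding cds_approx_def by auto

text \<open>Without edges a vertex dominates only itself, so a feasible solution, if there is one,
  consists of all vertices.\<close>

lemma edgeless_approx:
  assumes "simple_graph G" "edges G = {}" "1 \<le> c"
  shows "cds_approx c G (verts G)"
proof -
  have Y: "Y = verts G" if "connected_dominating_set G Y" for Y
    using that assms(2) by (auto simp: cds_iff adj_def)
  have "cds_opt G = card (verts G)" if "connected_dominating_set G (verts G)"
    using cds_opt_attained[OF assms(1) that] Y by metis
  then show ?thesis
    using Y mult_right_mono[OF assms(3), of "real (card (verts G))"]
    unfolding cds_approx_def by fastforce
qed

lemma kernel_correct:
  fixes \<epsilon> c :: real
  assumes "simple_graph G" "nice_tree_decomposition G T" "ntd_width T = treewidth G"
    and vs: "set vs = verts G" "distinct vs" and es: "(\<lambda>(u, v). {u, v}) ` set es = edges G"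
    and plan: "plan K ((vs, es), T) = (A, qs)"
    and \<epsilon>: "\<epsilon> > 0" and K: "K = nat \<lceil>64 / \<epsilon>\<rceil> + 2" and c: "1 \<le> c"
  shows "\<forall>q\<in>set qs. distinct (fst q) \<and> simple_graph (graph_of q) \<and>
      real (card (verts (graph_of q))) \<le> 402 * ((1 + \<epsilon>) / \<epsilon> * real (treewidth G) * real (max_degree G))"
    and "\<And>ans. (\<And>q. q \<in> set qs \<Longrightarrow> distinct (ans q) \<and> cds_approx c (graph_of q) (set (ans q))) \<Longrightarrow>
      distinct (assemble (((vs, es), T), A) (rev (map ans qs))) \<and>
      cds_approx (c * (1 + \<epsilon>)) G (set (assemble (((vs, es), T), A) (rev (map ans qs))))"
proof -
  \<comment> \<open>The summand 2 in \<open>K\<close> secures \<open>K \<ge> 2\<close>; rounding up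
    costs at most 1 more, hence the 3.\<close>
  have K1: "64 / \<epsilon> \<le> real K" "real K \<le> 64 / \<epsilon> + 3" proof -
    have "real (nat \<lceil>64 / \<epsilon>\<rceil>) = of_int \<lceil>64 / \<epsilon>\<rceil>" using \<epsilon> by simp
    then show "64 / \<epsilon> \<le> real K" "real K \<le> 64 / \<epsilon> + 3" unfolding K by linarith+
  qed
  have K2: "64 / real K \<le> \<epsilon>"
  proof -
    have "64 \<le> real K * \<epsilon>" using K1(1) \<epsilon> by (simp add: field_simps)
    moreover have "real K > 0" unfolding K by simp
    ultimately show ?thesis by (simp add: field_simps)
  qed
  \<comment> \<open>67 = 64 + 3, since both \<open>1 / \<epsilon>\<close> and 1 are at most
    \<open>(1 + \<epsilon>) / \<epsilon>\<close>.\<close>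
  have K3: "real K \<le> 67 * ((1 + \<epsilon>) / \<epsilon>)"
  proof -
    have "64 / \<epsilon> + 3 \<le> 67 * ((1 + \<epsilon>) / \<epsilon>)" using \<epsilon> by (simp add: field_simps)
    then show ?thesis using K1(2) by linarith
  qed
  show "\<forall>q\<in>set qs. distinct (fst q) \<and> simple_graph (graph_of q) \<and>
      real (card (verts (graph_of q))) \<le> 402 * ((1 + \<epsilon>) / \<epsilon> * real (treewidth G) * real (max_degree G))"
  proof (cases "es = []")
    case True
    then show ?thesis using plan by (simp add: plan_def)
  next
    case False
    interpret kernel_input G T vs es K
      by unfold_locales (use assms(1-3) vs es False in \<open>auto simp: K\<close>)
    have "real (2 * s + 1) \<le> 402 * ((1 + \<epsilon>) / \<epsilon> * real (treewidth G) * real (max_degree G))"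
    proof -
      \<comment> \<open>The factor 3 absorbs the extra vertex \<open>r\<close>, and \<open>b\<close>
        is at most twice the treewidth; together with 67 this gives 402 = 3 * 2 * 67.\<close>
      have "2 * s + 1 \<le> 3 * s" using b_le_s b_ge_2 by simp
      also have "\<dots> \<le> 3 * (K * (2 * treewidth G * \<Delta>))"
        unfolding s_def using b_eq b_ge_2 by (intro mult_left_mono mult_right_mono) auto
      finally have "real (2 * s + 1) \<le> real (3 * (K * (2 * treewidth G * \<Delta>)))"
        by (simp only: of_nat_le_iff)
      also have "\<dots> = real K * (6 * (real (treewidth G) * real \<Delta>))" by simp
      also have "\<dots> \<le> 67 * ((1 + \<epsilon>) / \<epsilon>) * (6 * (real (treewidth G) * real \<Delta>))"
        by (rule mult_right_mono[OF K3]) simp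
      also have "\<dots> = 402 * ((1 + \<epsilon>) / \<epsilon> * real (treewidth G) * real (max_degree G))"
        by (simp add: \<Delta>_def algebra_simps add_divide_distrib)
      finally show ?thesis .
    qed
    then show ?thesis using plan_queries[OF plan] by fastforce
  qed
  show "distinct (assemble (((vs, es), T), A) (rev (map ans qs))) \<and>
      cds_approx (c * (1 + \<epsilon>)) G (set (assemble (((vs, es), T), A) (rev (map ans qs))))"
    if ans: "\<And>q. q \<in> set qs \<Longrightarrow> distinct (ans q) \<and> cds_approx c (graph_of q) (set (ans q))" for ans
  proof (cases "es = []")
    case True
    then have "edges G = {}" using es by simp
    moreover have "1 \<le> c * (1 + \<epsilon>)" using c \<epsilon> mult_mono[of 1 c 1 "1 + \<epsilon>"] by simp
    ultimately have "cds_approx (c * (1 + \<epsilon>)) G (verts G)" by (intro edgeless_approx assms(1))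
    then show ?thesis using True plan vs by (simp add: plan_def assemble_def)
  next
    case False
    interpret kernel_input G T vs es K
      by unfold_locales (use assms(1-3) vs es False in \<open>auto simp: K\<close>)
    have "c * (1 + 64 / real K) \<le> c * (1 + \<epsilon>)" using K2 c by (intro mult_left_mono) auto
    then show ?thesis
      using assemble_approx[OF plan c ans] cds_approx_mono by blast
  qed
qed

lemma polytime_plan_queries:
  "polytime (\<lambda>x :: (dat list \<times> (dat \<times> dat) list) \<times> dat ntd.
     (enc (x, fst (plan K x)), map enc (snd (plan K x))))"
proof -
  have "polytime (\<lambda>x :: (dat list \<times> (dat \<times> dat) list) \<times> dat ntd. plan K x)" by (rule polytime_plan)
  then show ?thesis by (intro polytime_intros)
qed

theorem theorem14:
  shows "\<exists>C>0. \<forall>\<epsilon>>0. \<exists>P. cds_turing_kernelization (1 + \<epsilon>)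
    (\<lambda>G. C * ((1 + \<epsilon>) / \<epsilon> * real (treewidth G) * real (max_degree G))) P"
proof (intro exI[of _ 402] conjI allI impI)
  fix \<epsilon> :: real assume \<epsilon>: "\<epsilon> > 0"
  define K where "K = nat \<lceil>64 / \<epsilon>\<rceil> + 2"
  define f where "f = (\<lambda>G :: dat graph. 402 * ((1 + \<epsilon>) / \<epsilon> * real (treewidth G) * real (max_degree G)))"
  obtain P1 T1 q1 where
    P1: "\<And>orc (x :: (dat list \<times> (dat \<times> dat) list) \<times> dat ntd). exec orc P1 (enc x) (enc (enc (x, fst (plan K x)), map enc (snd (plan K x)))) (T1 orc x) {}"
      "\<And>orc (x :: (dat list \<times> (dat \<times> dat) list) \<times> dat ntd). T1 orc x \<le> poly q1 (esize x)"
      "\<And>x :: (dat list \<times> (dat \<times> dat) list) \<times> dat ntd. esize (enc (x, fst (plan K x)), map enc (snd (plan K x))) \<le> poly q1 (esize x)"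
    by (rule polytimeE[OF polytime_plan_queries[of K]]) blast
  obtain P2 and q2 :: "nat poly" where
    P2: "\<And>orc c ds. (\<And>d. d \<in> set ds \<Longrightarrow> size (orc d) \<le> size d) \<Longrightarrow>
       \<exists>t. exec orc P2 (enc (c :: dat, ds)) (enc (c, rev (map orc ds))) t (set ds) \<and>
         t \<le> poly q2 (esize (c, ds))"
    by (rule exec_map_query) blast
  obtain P3 T3 q3 where
    P3: "\<And>orc z. exec orc P3 (enc z) (enc (assemble (fst z) (snd z :: dat list list))) (T3 orc z) {}"
      "\<And>orc z. T3 orc z \<le> poly q3 (esize z)"
    by (rule polytimeE[OF polytime_assemble]) blast
  \<comment> \<open>Planning, asking and assembling. Only the middle program queries, so the other
    two come from \<open>polytime\<close>.\<close>
  define P where "P = PSeq P1 (PSeq P2 P3)"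
  define q where "q = [:2:] + q1 + pcompose q2 q1 + pcompose q3 q1"
  have "\<exists>y t Q X. exec orc P (Dot d (enc_ntd T)) y t Q \<and> t \<le> poly q (size (Dot d (enc_ntd T))) \<and>
      (\<forall>x\<in>Q. \<exists>H. simple_graph H \<and> real (card (verts H)) \<le> f G \<and> encodes_graph x H) \<and>
      encodes_set y X \<and> cds_approx (c * (1 + \<epsilon>)) G X"
    if G: "simple_graph G" "nice_tree_decomposition G T" "ntd_width T = treewidth G"
      and d: "encodes_graph d G" and c: "1 \<le> c" and orc: "cds_oracle c (f G) orc" for G T d c orc
  proof -
    obtain vs es where vs: "set vs = verts G" "distinct vs" and es: "(\<lambda>(u, v). {u, v}) ` set es = edges G"
      and d': "d = Dot (enc_list vs) (enc_list (map (\<lambda>(u, v). Dot u v) es))"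
      using d unfolding encodes_graph_def encodes_set_def by blast
    define x where "x = ((vs, es), T)"
    have "enc T = enc_ntd T" by (simp add: enc_ntd_def ntd.map_ident_strong)
    moreover have "enc es = enc_list (map (\<lambda>(u, v). Dot u v) es)"
      by (simp add: enc_list_def enc_prod_def[abs_def] case_prod_unfold)
    ultimately have x: "enc x = Dot d (enc_ntd T)" by (simp add: x_def d' enc_dat_list)
    obtain A qs where plan: "plan K x = (A, qs)" by (cases "plan K x")
    note correct = kernel_correct[OF G vs es plan[unfolded x_def] \<epsilon> K_def c]
    have "\<exists>xs. distinct xs \<and> orc (enc p) = enc xs \<and> cds_approx c (graph_of p) (set xs)" if "p \<in> set qs" for p
    proof -
      have "distinct (fst p)" "simple_graph (graph_of p)" "real (card (verts (graph_of p))) \<le> f G"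
        using correct(1) that unfolding f_def by auto
      then obtain X where "encodes_set (orc (enc p)) X" "cds_approx c (graph_of p) X"
        using orc encodes_graph_of unfolding cds_oracle_def by metis
      then show ?thesis unfolding encodes_set_def by (auto simp: enc_dat_list)
    qed
    then obtain ans where ans: "\<And>p. p \<in> set qs \<Longrightarrow> distinct (ans p) \<and> orc (enc p) = enc (ans p) \<and>
        cds_approx c (graph_of p) (set (ans p))"
      by metis
    define out where "out = assemble (x, A) (rev (map ans qs))"
    have out: "distinct out" "cds_approx (c * (1 + \<epsilon>)) G (set out)"
      using correct(2)[of ans] ans unfolding out_def x_def by blast+
    define ds where "ds = map enc qs"
    \<comment> \<open>An answer is a duplicate-free list of vertices of the queried graph, and these
      vertices are part of the query. The oracle promise applies because the query respects the size
      bound.\<close>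
    have small: "size (orc e) \<le> size e" if "e \<in> set ds" for e
    proof -
      obtain p where p: "p \<in> set qs" "e = enc p" using \<open>e \<in> set ds\<close> unfolding ds_def set_map by blast
      have "set (ans p) \<subseteq> set (fst p)"
        using ans[OF p(1)] unfolding cds_approx_def graph_of_def by simp
      then have "esize (ans p) \<le> esize (fst p)"
        using esize_subset ans[OF p(1)] correct(1) p(1) by blast
      also have "\<dots> \<le> esize p" by (simp add: enc_prod_def)
      finally show ?thesis using ans[OF p(1)] p(2) by simp
    qed
    obtain t2 where t2: "exec orc P2 (enc (enc (x, A), ds)) (enc (enc (x, A), rev (map orc ds))) t2 (set ds)"
      "t2 \<le> poly q2 (esize (enc (x, A), ds))"
      using P2[OF small] by blast
    have "map orc ds = map enc (map ans qs)" unfolding ds_def using ans by simp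
    then have "rev (map orc ds) = map enc (rev (map ans qs))" by (simp add: rev_map)
    \<comment> \<open>The collected raw answers and the list of vertex lists expected by
      \<open>assemble\<close> have the same encoding, so no conversion takes place.\<close>
    then have mid: "enc (enc (x, A), rev (map orc ds)) = enc ((x, A), rev (map ans qs))"
      by (simp add: enc_list_def enc_dat_def[abs_def] comp_def)
    have "exec orc P (enc x) (enc out) (Suc (T1 orc x + Suc (t2 + T3 orc ((x, A), rev (map ans qs)))))
        ({} \<union> (set ds \<union> {}))"
      unfolding P_def
    proof (rule exec.Seq[OF P1(1)], rule exec.Seq)
      show "exec orc P2 (enc (enc (x, fst (plan K x)), map enc (snd (plan K x))))
          (enc ((x, A), rev (map ans qs))) t2 (set ds)"
        using t2(1) mid by (simp add: plan ds_def)
      show "exec orc P3 (enc ((x, A), rev (map ans qs))) (enc out) (T3 orc ((x, A), rev (map ans qs))) {}"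
        using P3(1)[of orc "((x, A), rev (map ans qs))"] by (simp add: out_def)
    qed
    moreover have "Suc (T1 orc x + Suc (t2 + T3 orc ((x, A), rev (map ans qs)))) \<le> poly q (esize x)"
    proof -
      have size: "esize (enc (x, A), ds) \<le> poly q1 (esize x)"
        using P1(3)[of x] by (simp add: plan ds_def)
      have "esize (map orc ds) \<le> esize ds" using small by (induction ds) (auto intro: add_mono)
      then have "esize (enc (x, A), rev (map orc ds)) \<le> poly q1 (esize x)" using size by simp
      then have "T3 orc ((x, A), rev (map ans qs)) \<le> poly q3 (poly q1 (esize x))"
        unfolding mid by (rule poly_nat_mono_trans[OF P3(2)])
      moreover have "t2 \<le> poly q2 (poly q1 (esize x))" by (rule poly_nat_mono_trans[OF t2(2) size])
      ultimately show ?thesis using P1(2)[of orc x] by (simp add: q_def poly_pcompose)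
    qed
    moreover have "\<exists>H. simple_graph H \<and> real (card (verts H)) \<le> f G \<and> encodes_graph e H"
      if "e \<in> {} \<union> (set ds \<union> {})" for e
    proof -
      have "e \<in> enc ` set qs" using that unfolding ds_def by simp
      then obtain p where p: "p \<in> set qs" "e = enc p" by blast
      then show ?thesis
        using correct(1) encodes_graph_of[of p] unfolding f_def by (intro exI[of _ "graph_of p"]) simp
    qed
    moreover have "encodes_set (enc out) (set out)"
      using out(1) by (auto simp: encodes_set_def enc_dat_list)
    ultimately show ?thesis using out(2) unfolding x by blast
  qed
  then show "\<exists>P. cds_turing_kernelization (1 + \<epsilon>)
      (\<lambda>G. 402 * ((1 + \<epsilon>) / \<epsilon> * real (treewidth G) * real (max_degree G))) P"
    unfolding cds_turing_kernelization_def f_def by blast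
qed simp

end
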